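(* For positive integers $m,n\equiv1\pmod{24}$ with $m\ne n$ we have $$p_m^+(n)=\left(\frac{6}{\pi m}\right)^{\frac32}\cdot\langle g_m,g_n\rangle_{\mathrm{reg}}.$$
   Context: Write $z=x+iy\in\mathbb{H}$, $q=e^{2\pi i z}$, $q^{r}=e^{2\pi i r z}$ for $r\in\mathbb{Q}$; powers use the principal branch. The eta function $\eta(z)=q^{1/24}\prod_{n\ge1}(1-q^n)$ satisfies $\eta(\gamma z)=\varepsilon(\gamma)(cz+d)^{1/2}\eta(z)$ for $\gamma=\begin{pmatrix}a&b\\c&d\end{pmatrix}\in \mathrm{SL}_2(\mathbb{Z})$, which defines the multiplier system $\varepsilon$. For modular forms $f,g$ of weight $k$, $$\langle f,g\rangle_{\mathrm{reg}}=\lim_{Y\to\infty}\int_{\mathcal{F}(Y)}f(z)\overline{g(z)}\,y^k\,\frac{dx\,dy}{y^2}$$ provided the limit exists, where $\mathcal{F}(Y)=\{z: |x|\le\frac12,\ |z|\ge1,\ y\le Y\}$ is the usual fundamental domain for $\mathrm{SL}_2(\mathbb{Z})$ truncated at height $Y$. (Part of the claim is that the limit exists; here $k=-\tfrac12$.) For positive $m\equiv1\pmod{24}$, $g_m$ is the unique weakly holomorphic modular form of weight $-\frac12$ and multiplier $\overline{\varepsilon}$ on $\mathrm{SL}_2(\mathbb{Z})$ of the form $g_m=\eta^{-1}P_m(j)$, with $P_m$ a monic polynomial in the modular $j$-function $j=q^{-1}+744+\cdots$, such that $g_m=q^{-m/24}+O(q^{23/24})$. For $k=5/2$, $H_k^!(\varepsilon)$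 is the complex vector space of real analytic $f:\mathbb{H}\to\mathbb{C}$ such that $f(\gamma z)=\varepsilon(\gamma)(cz+d)^kf(z)$ for all $\gamma\in\mathrm{SL}_2(\mathbb{Z})$, $\Delta_kf=0$ where $\Delta_k=-y^2\left(\frac{\partial^2}{\partial x^2}+\frac{\partial^2}{\partial y^2}\right)+iky\left(\frac{\partial}{\partial x}+i\frac{\partial}{\partial y}\right)$, and such that in the Fourier expansion $$f(z)=\sum_{n\equiv1\,(24)}a^+(n)q^{n/24}+\sum_{n\equiv-1\,(24)}a^-(n)\,\Gamma\!\left(1-k,\tfrac{\pi ny}{6}\right)q^{-n/24}$$ only finitely many $a^{\pm}(n)$ with $n\le0$ are nonzero. $\beta(y)=\Gamma\!\left(-\tfrac32,\tfrac{\pi y}{6}\right)$, where $\Gamma(s,y)=\int_y^\infty e^{-t}t^{s-1}dt$; for negative real $y$ the principal branch is used ($\arg y=\pi$, path of integration through the upper half plane). For positive $m\equiv1\pmod{24}$ the numbers $p_m^+(n)$ are defined as follows: there is a unique $h_m\in H^!_{5/2}(\varepsilon)$ with Fourier expansion of the form $$h_m(z)=\sum_{0<n\equiv1\,(24)}p_m^+(n)q^{n/24}+i\beta(-my)q^{m/24}+\sum_{0<n\equiv-1\,(24)}p_m^-(n)\beta(ny)q^{-n/24}.$$ *)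

theory Defs
  imports
    "HOL-Complex_Analysis.Complex_Analysis"
    "HOL-Computational_Algebra.Polynomial"
    "HOL-Library.Landau_Symbols"
    "HOL-Number_Theory.Cong"
begin

definition uhp :: "complex set" where
  "uhp = {z. 0 < Im z}"

definition qpow :: "complex \<Rightarrow> real \<Rightarrow> complex" where
  "qpow z r = exp (2 * of_real pi * \<i> * of_real r * z)"

definition eta :: "complex \<Rightarrow> complex" where
  "eta z = qpow z (1/24) * (\<Prod>n. 1 - qpow z (real (Suc n)))"

text \<open>Elements of \<open>SL\<^sub>2(\<int>)\<close> are given by their four entries, subject to \<open>a * d - b * c = 1\<close>.\<close>

definition moebius :: "int \<Rightarrow> int \<Rightarrow> int \<Rightarrow> int \<Rightarrow> complex \<Rightarrow> complex" where
  "moebius a b c d z = (of_int a * z + of_int b) / (of_int c * z + of_int d)"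

definition eta_mult :: "int \<Rightarrow> int \<Rightarrow> int \<Rightarrow> int \<Rightarrow> complex" where
  "eta_mult a b c d =
     (THE e. \<forall>z\<in>uhp. eta (moebius a b c d z) = e * (of_int c * z + of_int d) powr (1/2) * eta z)"

definition modular_transform ::
    "real \<Rightarrow> (int \<Rightarrow> int \<Rightarrow> int \<Rightarrow> int \<Rightarrow> complex) \<Rightarrow> (complex \<Rightarrow> complex) \<Rightarrow> bool" where
  "modular_transform k \<nu> f \<longleftrightarrow>
     (\<forall>a b c d. a * d - b * c = 1 \<longrightarrow>
        (\<forall>z\<in>uhp. f (moebius a b c d z) =
           \<nu> a b c d * (of_int c * z + of_int d) powr (of_real k) * f z))"

text \<open>The last clause is meromorphy at the cusp; exponents in \<open>\<int>/24\<close> suffice for every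
  multiplier system whose value at the translation by 1 is a 24th root of unity.\<close>

definition weakly_holomorphic_form ::
    "real \<Rightarrow> (int \<Rightarrow> int \<Rightarrow> int \<Rightarrow> int \<Rightarrow> complex) \<Rightarrow> (complex \<Rightarrow> complex) \<Rightarrow> bool" where
  "weakly_holomorphic_form k \<nu> f \<longleftrightarrow>
     f holomorphic_on uhp \<and> modular_transform k \<nu> f \<and>
     (\<exists>(a :: int \<Rightarrow> complex) n0.
        \<forall>z\<in>uhp. ((\<lambda>n. a n * qpow z (real_of_int n / 24)) has_sum f z) {n0..})"

definition eisenstein4 :: "complex \<Rightarrow> complex" where
  "eisenstein4 z = 1 + 240 * (\<Sum>n. of_nat (\<Sum>d | d dvd Suc n. d ^ 3) * qpow z (real (Suc n)))"

definition modular_j :: "complex \<Rightarrow> complex" where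
  "modular_j z = eisenstein4 z ^ 3 / eta z ^ 24"

text \<open>\<open>is_g m g\<close>: on the upper half-plane, \<open>g\<close> is the form \<open>g\<^sub>m\<close>. The error term is uniform
  in the real part as the imaginary part tends to infinity.\<close>

definition is_g :: "int \<Rightarrow> (complex \<Rightarrow> complex) \<Rightarrow> bool" where
  "is_g m g \<longleftrightarrow>
     weakly_holomorphic_form (-1/2) (\<lambda>a b c d. cnj (eta_mult a b c d)) g \<and>
     (\<exists>P :: complex poly. lead_coeff P = 1 \<and> (\<forall>z\<in>uhp. g z = inverse (eta z) * poly P (modular_j z))) \<and>
     (\<lambda>z. g z - qpow z (- real_of_int m / 24)) \<in> O[filtercomap Im at_top](\<lambda>z. qpow z (23/24))"

definition trunc_fund_domain :: "real \<Rightarrow> complex set" where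
  "trunc_fund_domain Y = {z \<in> uhp. \<bar>Re z\<bar> \<le> 1/2 \<and> cmod z \<ge> 1 \<and> Im z \<le> Y}"

definition trunc_inner :: "real \<Rightarrow> (complex \<Rightarrow> complex) \<Rightarrow> (complex \<Rightarrow> complex) \<Rightarrow> real \<Rightarrow> complex" where
  "trunc_inner k f g Y =
     (LINT z:trunc_fund_domain Y|lborel. f z * cnj (g z) * of_real (Im z powr k) / of_real ((Im z)\<^sup>2))"

definition reg_inner_exists :: "real \<Rightarrow> (complex \<Rightarrow> complex) \<Rightarrow> (complex \<Rightarrow> complex) \<Rightarrow> bool" where
  "reg_inner_exists k f g \<longleftrightarrow> (\<exists>L. (trunc_inner k f g \<longlongrightarrow> L) at_top)"

definition reg_inner :: "real \<Rightarrow> (complex \<Rightarrow> complex) \<Rightarrow> (complex \<Rightarrow> complex) \<Rightarrow> complex" where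
  "reg_inner k f g = Lim at_top (trunc_inner k f g)"

text \<open>\<open>\<Gamma>(s, y)\<close> for real \<open>y \<noteq> 0\<close>. For \<open>y < 0\<close> the path runs along the upper semicircle from
  \<open>y\<close> to \<open>\<bar>y\<bar>\<close> and then along the real axis; the argument of the variable starts at \<open>\<pi>\<close>
  and decreases to 0, so the principal power is continuous along it.\<close>

definition upper_Gamma :: "complex \<Rightarrow> real \<Rightarrow> complex" where
  "upper_Gamma s y =
     (if y < 0
      then contour_integral (part_circlepath 0 \<bar>y\<bar> pi 0) (\<lambda>t. exp (- t) * t powr (s - 1))
      else 0)
     + integral {\<bar>y\<bar>..} (\<lambda>t::real. exp (- of_real t) * of_real t powr (s - 1))"

definition beta :: "real \<Rightarrow> complex" where
  "beta y = upper_Gamma (-3/2) (pi * y / 6)"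

definition real_analytic_on :: "(complex \<Rightarrow> complex) \<Rightarrow> complex set \<Rightarrow> bool" where
  "real_analytic_on f S \<longleftrightarrow>
     (\<forall>w\<in>S. \<exists>r>0. \<exists>c :: nat \<Rightarrow> nat \<Rightarrow> complex. \<forall>z\<in>ball w r.
        ((\<lambda>(i, l). c i l * of_real (Re z - Re w) ^ i * of_real (Im z - Im w) ^ l) has_sum f z) UNIV)"

definition partial_x :: "(complex \<Rightarrow> complex) \<Rightarrow> complex \<Rightarrow> complex" where
  "partial_x f z = vector_derivative (\<lambda>t. f (Complex t (Im z))) (at (Re z))"

definition partial_y :: "(complex \<Rightarrow> complex) \<Rightarrow> complex \<Rightarrow> complex" where
  "partial_y f z = vector_derivative (\<lambda>t. f (Complex (Re z) t)) (at (Im z))"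

definition hyp_laplacian :: "real \<Rightarrow> (complex \<Rightarrow> complex) \<Rightarrow> complex \<Rightarrow> complex" where
  "hyp_laplacian k f z =
     - of_real ((Im z)\<^sup>2) * (partial_x (partial_x f) z + partial_y (partial_y f) z)
     + \<i> * of_real k * of_real (Im z) * (partial_x f z + \<i> * partial_y f z)"

definition harmonic_forms :: "real \<Rightarrow> (complex \<Rightarrow> complex) set" where
  "harmonic_forms k = {f.
     real_analytic_on f uhp \<and>
     modular_transform k eta_mult f \<and>
     (\<forall>z\<in>uhp. hyp_laplacian k f z = 0) \<and>
     (\<exists>ap am :: int \<Rightarrow> complex.
        finite {n. n \<le> 0 \<and> [n = 1] (mod 24) \<and> ap n \<noteq> 0} \<and>
        finite {n. n \<le> 0 \<and> [n = -1] (mod 24) \<and> am n \<noteq> 0} \<and>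
        (\<forall>z\<in>uhp.
           (\<lambda>n. ap n * qpow z (real_of_int n / 24)) summable_on {n. [n = 1] (mod 24)} \<and>
           (\<lambda>n. am n * upper_Gamma (1 - of_real k) (pi * real_of_int n * Im z / 6)
                * qpow z (- real_of_int n / 24)) summable_on {n. [n = -1] (mod 24)} \<and>
           f z =
             (\<Sum>\<^sub>\<infinity>n | [n = 1] (mod 24). ap n * qpow z (real_of_int n / 24))
           + (\<Sum>\<^sub>\<infinity>n | [n = -1] (mod 24).
                am n * upper_Gamma (1 - of_real k) (pi * real_of_int n * Im z / 6)
                * qpow z (- real_of_int n / 24))))}"

text \<open>\<open>is_h m h pp pm\<close>: on the upper half-plane, \<open>h\<close> is the form \<open>h\<^sub>m\<close>, and
  \<open>pp\<close>, \<open>pm\<close> are its coefficients \<open>p\<^sub>m\<^sup>+\<close>, \<open>p\<^sub>m\<^sup>-\<close> (only the values at positive indices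
  in the relevant residue class matter).\<close>

definition is_h ::
    "int \<Rightarrow> (complex \<Rightarrow> complex) \<Rightarrow> (int \<Rightarrow> complex) \<Rightarrow> (int \<Rightarrow> complex) \<Rightarrow> bool" where
  "is_h m h pp pm \<longleftrightarrow>
     h \<in> harmonic_forms (5/2) \<and>
     (\<forall>z\<in>uhp.
        (\<lambda>n. pp n * qpow z (real_of_int n / 24)) summable_on {n. 0 < n \<and> [n = 1] (mod 24)} \<and>
        (\<lambda>n. pm n * beta (real_of_int n * Im z) * qpow z (- real_of_int n / 24))
          summable_on {n. 0 < n \<and> [n = -1] (mod 24)} \<and>
        h z =
          (\<Sum>\<^sub>\<infinity>n | 0 < n \<and> [n = 1] (mod 24). pp n * qpow z (real_of_int n / 24))
        + \<i> * beta (- real_of_int m * Im z) * qpow z (real_of_int m / 24)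
        + (\<Sum>\<^sub>\<infinity>n | 0 < n \<and> [n = -1] (mod 24).
             pm n * beta (real_of_int n * Im z) * qpow z (- real_of_int n / 24)))"

end

theory Submission
  imports Defs "HOL-Real_Asymp.Real_Asymp"
begin

text \<open>The \<open>\<bar>z\<close>-derivative of \<open>h\<^sub>m\<close> is \<open>(\<i>/2) y\<^bsup>-5/2\<^esup>\<close> times the conjugate of a weakly holomorphic form
  of weight \<open>-1/2\<close> (the shadow) with principal part \<open>C q\<^bsup>-m/24\<^esup>\<close>, where \<open>C = (6/(\<pi>m))\<^bsup>3/2\<^esup>\<close>.
  A form of negative weight that tends to \<open>0\<close> at the cusp vanishes, so the shadow is \<open>C g\<^sub>m\<close>.
  Stokes' theorem for \<open>g\<^sub>n h\<^sub>m dz\<close>, a form of weight 2, on the truncated fundamental domain therefore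
  expresses \<open>C\<close> times the truncated product of \<open>g\<^sub>n\<close> and \<open>g\<^sub>m\<close> as the integral of \<open>g\<^sub>n h\<^sub>m\<close> over
  the top side, which tends to the constant term \<open>p\<^sub>m\<^sup>+(n)\<close>. The factors \<open>g\<^sub>m\<close> and \<open>g\<^sub>n\<close> may be
  exchanged because both have real Fourier coefficients.\<close>

subsection \<open>Cusp forms of negative weight\<close>

text \<open>The constant \<open>C\<close> comes from a branch. On the negative axis the derivative
  of \<open>beta\<close> picks up the phase \<open>(- 1) powr (- 5 / 2) = - \<i>\<close>, which
  cancels the factor \<open>\<i>\<close> in front of \<open>beta (- m * y)\<close>; what remains is
  the positive number \<open>(pi * m / 6) powr (- 3 / 2)\<close>. The obstacle is the limit over the
  top side. The term of \<open>h\<close> containing \<open>beta (- m * y)\<close> grows like exp(pi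
  m y / 12) up to a power of y, so for large m the remainder of \<open>gn\<close> after its
  principal part, which is only O(q^(23/24)), does not make the product small. The contribution
  vanishes exactly instead, at every height: \<open>beta\<close> is constant along a horizontal
  segment, and the remainder times q^(m/24) is holomorphic, has period 1 and tends to 0 at the cusp,
  so its mean is 0. Against the principal part q^(-n/24) the same term has mean 0 because m - n is a
  nonzero multiple of 24.\<close>

lemma mem_uhp_iff: "z \<in> uhp \<longleftrightarrow> 0 < Im z"
  by (simp add: uhp_def)

lemma open_uhp: "open uhp"
  unfolding uhp_def by (simp add: open_halfspace_Im_gt)

lemma convex_uhp: "convex uhp"
  unfolding uhp_def by (simp add: convex_halfspace_Im_gt)

lemma Im_minus_inverse: "Im (- 1 / z) = Im z / (cmod z)\<^sup>2"
  by (simp add: Im_divide cmod_power2)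

lemma minus_inverse_mem_uhp: "z \<in> uhp \<Longrightarrow> - 1 / z \<in> uhp"
  unfolding mem_uhp_iff Im_minus_inverse by (intro divide_pos_pos) auto

lemma eventually_Im_at_top: "eventually P (filtercomap Im at_top) \<longleftrightarrow> (\<exists>Y. \<forall>z. Im z \<ge> Y \<longrightarrow> P z)"
  unfolding eventually_filtercomap eventually_at_top_linorder by metis

text \<open>With \<open>t = x / c\<close> the left side is exp(a (ln t - t + ln c)), so both claims
  reduce to ln t \<le> t - 1, with equality only at t = 1. The strict form contradicts constancy in
  the maximum principle; the weak form also bounds a power by an exponential in the estimates for
  \<open>beta\<close>.\<close>

lemma powr_mult_exp_le:
  fixes a x c :: real
  assumes "0 < a" "0 < x" "0 < c"
  shows "x powr a * exp (- (a * x / c)) \<le> c powr a * exp (- a)"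
    and "x \<noteq> c \<Longrightarrow> x powr a * exp (- (a * x / c)) < c powr a * exp (- a)"
proof -
  have eq: "t powr a * exp (- (a * t / c)) = exp (a * (ln (t / c) - t / c + ln c))" if "0 < t" for t
    using that assms by (simp add: powr_def ln_div flip: exp_add) (simp add: algebra_simps)
  have eq': "c powr a * exp (- a) = exp (a * (- 1 + ln c))"
    using assms by (simp add: powr_def flip: exp_add) (simp add: algebra_simps)
  show "x powr a * exp (- (a * x / c)) \<le> c powr a * exp (- a)"
    using ln_le_minus_one[of "x / c"] assms unfolding eq[OF assms(2)] eq' by auto
  assume "x \<noteq> c"
  then have "ln (x / c) \<noteq> x / c - 1"
    using ln_eq_minus_one[of "x / c"] assms by auto
  then show "x powr a * exp (- (a * x / c)) < c powr a * exp (- a)"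
    using ln_le_minus_one[of "x / c"] assms unfolding eq[OF assms(2)] eq' by auto
qed

text \<open>The invariant function \<open>\<phi> z = \<bar>f z\<bar> y\<^bsup>-k/2\<^esup>\<close> attains its maximum over \<open>y \<ge> 1/2\<close>, and it does so
  at an interior point: for \<open>\<bar>x\<bar> \<le> 1/2\<close> the inversion moves the line \<open>y = 1/2\<close> into \<open>y \<ge> 1\<close>. At a
  maximum of height \<open>c\<close> the holomorphic function \<open>f z * exp (\<i> k z / (2 c))\<close> has maximal modulus,
  since \<open>y\<^bsup>k/2\<^esup> exp (- k y / (2 c))\<close> is largest at \<open>y = c\<close>.\<close>

lemma negative_weight_cusp_form_eq_0:
  fixes f :: "complex \<Rightarrow> complex" and k :: real
  assumes hol: "f holomorphic_on uhp" and k: "0 < k"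
    and T: "\<And>z. z \<in> uhp \<Longrightarrow> cmod (f (z + 1)) = cmod (f z)"
    and S: "\<And>z. z \<in> uhp \<Longrightarrow> cmod (f (- 1 / z)) = cmod z powr (- k) * cmod (f z)"
    and lim: "(f \<longlongrightarrow> 0) (filtercomap Im at_top)"
    and z: "z \<in> uhp"
  shows "f z = 0"
proof -
  define \<phi> where "\<phi> z = cmod (f z) * Im z powr (- k / 2)" for z
  have \<phi>T: "\<phi> (z + of_int n) = \<phi> z" if "z \<in> uhp" for z n
  proof (induction n rule: int_induct[where k = 0])
    case (step1 i)
    then show ?case using T[of "z + of_int i"] that by (simp add: \<phi>_def mem_uhp_iff add.assoc)
  next
    case (step2 i)
    then show ?case using T[of "z + of_int (i - 1)"] that by (simp add: \<phi>_def mem_uhp_iff)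
  qed simp
  have \<phi>S: "\<phi> (- 1 / z) = \<phi> z" if "z \<in> uhp" for z
  proof -
    have z0: "cmod z > 0" "Im z > 0" using that by (auto simp: mem_uhp_iff)
    have "(cmod z)\<^sup>2 powr (- k / 2) = cmod z powr (- k)"
      using z0 by (simp add: powr_powr flip: powr_numeral)
    then have "cmod z powr (- k) * (Im z / (cmod z)\<^sup>2) powr (- k / 2) = Im z powr (- k / 2)"
      using z0 by (simp add: powr_divide)
    then show ?thesis using S[OF that] unfolding \<phi>_def Im_minus_inverse by (simp add: mult_ac)
  qed
  have strip: "\<exists>w. \<bar>Re w\<bar> \<le> 1/2 \<and> Im w = Im z \<and> \<phi> w = \<phi> z" if "z \<in> uhp" for z
    using of_int_round_abs_le[of "Re z"] \<phi>T[OF that, of "- round (Re z)"]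
    by (intro exI[of _ "z - of_int (round (Re z))"]) (auto simp: abs_minus_commute)
  have zero: "f z = 0" if Imz: "Im z > 1/2" for z
  proof (rule ccontr)
    assume "f z \<noteq> 0"
    then have \<phi>z: "\<phi> z > 0" using that by (simp add: \<phi>_def)
    obtain z1 where z1: "\<bar>Re z1\<bar> \<le> 1/2" "Im z1 = Im z" "\<phi> z1 = \<phi> z"
      using strip[of z] Imz by (fastforce simp: mem_uhp_iff)
    \<comment> \<open>The threshold is chosen so that \<open>cmod (f w) < e\<close> at a height of
      at least 1/2 already gives \<open>\<phi> w \<le> \<phi> z1\<close>; hence the supremum of
      \<open>\<phi>\<close> is not approached only at the cusp.\<close>
    define e where "e = \<phi> z1 * (1/2) powr (k / 2)"
    have "e > 0" using z1 \<phi>z by (simp add: e_def)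
    then have "eventually (\<lambda>w. cmod (f w) < e) (filtercomap Im at_top)"
      using lim by (simp add: tendsto_iff)
    then obtain Y0 where Y0: "\<And>w. Im w \<ge> Y0 \<Longrightarrow> cmod (f w) < e"
      by (auto simp: eventually_Im_at_top)
    define Y where "Y = max (Im z1) (max 1 Y0)"
    have \<phi>_high: "\<phi> w \<le> \<phi> z1" if "Im w \<ge> Y" for w
    proof -
      have "\<phi> w \<le> e * Im w powr (- k / 2)"
        unfolding \<phi>_def using Y0[of w] that by (intro mult_right_mono) (auto simp: Y_def)
      also have "\<dots> \<le> e * (1/2) powr (- k / 2)"
        using \<open>e > 0\<close> that k by (intro mult_left_mono powr_mono2') (auto simp: Y_def)
      also have "\<dots> = \<phi> z1" by (simp add: e_def powr_minus)
      finally show ?thesis .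
    qed
    define K where "K = cbox (Complex (-1/2) (1/2)) (Complex (1/2) Y)"
    have K: "w \<in> K \<longleftrightarrow> \<bar>Re w\<bar> \<le> 1/2 \<and> 1/2 \<le> Im w \<and> Im w \<le> Y" for w
      by (auto simp: K_def in_cbox_complex_iff)
    have "K \<subseteq> uhp" by (auto simp: K mem_uhp_iff)
    then have "continuous_on K f"
      using hol holomorphic_on_imp_continuous_on continuous_on_subset by blast
    then have cont: "continuous_on K \<phi>"
      unfolding \<phi>_def by (intro continuous_intros) (auto simp: K)
    have "z1 \<in> K" using z1 Imz by (auto simp: K Y_def)
    then obtain z0 where z0: "z0 \<in> K" "\<And>w. w \<in> K \<Longrightarrow> \<phi> w \<le> \<phi> z0"
      using continuous_attains_sup[OF compact_cbox _ cont[unfolded K_def]] K_def by blast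
    have max: "\<phi> w \<le> \<phi> z0" if w: "Im w \<ge> 1/2" for w
    proof -
      obtain w' where w': "\<bar>Re w'\<bar> \<le> 1/2" "Im w' = Im w" "\<phi> w' = \<phi> w"
        using strip[of w] w by (fastforce simp: mem_uhp_iff)
      show ?thesis
        using z0(2)[of w'] \<phi>_high[of w'] z0(2)[OF \<open>z1 \<in> K\<close>] w w' by (cases "Im w \<le> Y") (auto simp: K)
    qed
    obtain \<xi> where \<xi>: "Im \<xi> > 1/2" "\<phi> \<xi> = \<phi> z0"
    proof (cases "Im z0 > 1/2")
      case True
      then show ?thesis using that by blast
    next
      case False
      then have "Im z0 = 1/2" using z0(1) K by auto
      moreover have "(cmod z0)\<^sup>2 \<le> 1/2"
        using z0(1) abs_square_le_1[of "2 * Re z0"] unfolding cmod_power2 K \<open>Im z0 = 1/2\<close>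
        by (simp add: power2_eq_square abs_mult)
      moreover have "(cmod z0)\<^sup>2 > 0" using \<open>Im z0 = 1/2\<close> by auto
      ultimately have "Im (- 1 / z0) \<ge> 1"
        unfolding Im_minus_inverse by (simp add: field_simps)
      then show ?thesis
        using that[of "- 1 / z0"] \<phi>S[of z0] \<open>Im z0 = 1/2\<close> by (simp add: mem_uhp_iff)
    qed
    define c where "c = Im \<xi>"
    define F where "F w = f w * exp (\<i> * of_real (k / (2 * c)) * w)" for w
    have c: "c > 1/2" using \<xi> by (simp add: c_def)
    have M: "\<phi> \<xi> > 0" using z0(2)[OF \<open>z1 \<in> K\<close>] z1 \<phi>z \<xi> by auto
    have normF: "cmod (F w) = \<phi> w * (Im w powr (k / 2) * exp (- (k / 2 * Im w / c)))" if "Im w > 0" for w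
      using that c by (simp add: F_def \<phi>_def norm_mult powr_minus field_simps)
    have normF\<xi>: "cmod (F \<xi>) = \<phi> \<xi> * (c powr (k / 2) * exp (- (k / 2)))"
      using normF[of \<xi>] c by (simp add: c_def)
    let ?U = "{w. Im w > 1/2}"
    have le: "cmod (F w) \<le> \<phi> \<xi> * (Im w powr (k / 2) * exp (- (k / 2 * Im w / c)))" if "w \<in> ?U" for w
      using that max[of w] \<xi> normF[of w] by (auto intro!: mult_right_mono)
    have "F constant_on ?U"
    proof (rule maximum_modulus_principle[where U = ?U and \<xi> = \<xi>])
      have "f holomorphic_on ?U"
        using hol by (rule holomorphic_on_subset) (auto simp: mem_uhp_iff)
      then show "F holomorphic_on ?U"
        unfolding F_def by (intro holomorphic_intros)
      show "connected ?U" by (intro convex_connected convex_halfspace_Im_gt)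
      show "cmod (F w) \<le> cmod (F \<xi>)" if "w \<in> ?U" for w
      proof -
        have "cmod (F w) \<le> \<phi> \<xi> * (Im w powr (k / 2) * exp (- (k / 2 * Im w / c)))"
          by (rule le[OF that])
        also have "\<dots> \<le> cmod (F \<xi>)" unfolding normF\<xi>
          using M that k c powr_mult_exp_le(1)[of "k / 2" "Im w" c] by (intro mult_left_mono) auto
        finally show ?thesis .
      qed
      show "open ?U" by (rule open_halfspace_Im_gt)
      show "open ?U" by (rule open_halfspace_Im_gt)
    qed (use \<xi> in auto)
    \<comment> \<open>Any point at a height different from \<open>c\<close> contradicts the
      constancy of \<open>F\<close>; this one has height \<open>c + 1\<close>.\<close>
    moreover have "\<xi> + \<i> \<in> ?U" "\<xi> \<in> ?U" using \<xi> by auto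
    ultimately have "F (\<xi> + \<i>) = F \<xi>" unfolding constant_on_def by force
    moreover have "cmod (F (\<xi> + \<i>)) < cmod (F \<xi>)"
    proof -
      have "cmod (F (\<xi> + \<i>)) \<le> \<phi> \<xi> * ((c + 1) powr (k / 2) * exp (- (k / 2 * (c + 1) / c)))"
        using le[of "\<xi> + \<i>"] \<xi> by (simp add: c_def)
      also have "\<dots> < cmod (F \<xi>)" unfolding normF\<xi>
        using M c k powr_mult_exp_le(2)[of "k / 2" "c + 1" c] by (intro mult_strict_left_mono) auto
      finally show ?thesis .
    qed
    ultimately show False by simp
  qed
  show ?thesis
  proof (rule analytic_continuation_open[of "{w. Im w > 1/2}" uhp f "\<lambda>_. 0" z])
    show "{w. Im w > 1/2} \<noteq> {}" by (auto intro: exI[of _ \<i>])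
    show "open {w. Im w > 1/2}" by (rule open_halfspace_Im_gt)
  qed (use hol z zero open_uhp convex_uhp in \<open>auto simp: mem_uhp_iff intro!: convex_connected\<close>)
qed

subsection \<open>The incomplete Gamma function\<close>

text \<open>Since \<open>Re s \<le> 1\<close>, the power of t is decreasing and is bounded by its
  value at \<open>r\<close>, so the exponential alone is an integrable majorant.\<close>

lemma Gamma_integrand_integrable:
  fixes s :: complex and r :: real
  assumes s: "Re s \<le> 1" and r: "0 < r"
  shows "(\<lambda>t::real. exp (- of_real t) * of_real t powr (s - 1) :: complex) integrable_on {r..}"
proof (rule measurable_bounded_by_integrable_imp_integrable)
  show "(\<lambda>t. exp (- of_real t) * of_real t powr (s - 1) :: complex) \<in> borel_measurable (lebesgue_on {r..})"
    using r by (intro continuous_imp_measurable_on_sets_lebesgue continuous_intros) auto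
  show "(\<lambda>t. r powr (Re s - 1) * exp (- 1 * t)) integrable_on {r..}"
    by (intro integrable_on_mult_right integrable_on_exp_minus_to_infinity) simp
  show "cmod (exp (- of_real t) * of_real t powr (s - 1)) \<le> r powr (Re s - 1) * exp (- 1 * t)"
    if "t \<in> {r..}" for t
    using that r s powr_mono2'[of "Re s - 1" r t]
    by (simp add: norm_mult norm_powr_real_powr)
qed simp

text \<open>The integrand has a primitive on the plane slit along the negative imaginary axis, where
  \<open>Ln (- \<i> * t) + \<i> * pi / 2\<close> continues the principal logarithm from the closed upper half plane.\<close>

lemma upper_Gamma_primitive:
  fixes s :: complex
  assumes s: "Re s \<le> 1"
  obtains K :: complex and \<Phi> :: "complex \<Rightarrow> complex"
  where "\<And>y. y \<noteq> 0 \<Longrightarrow> upper_Gamma s y = K - \<Phi> (of_real y)"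
    and "\<And>y::real. y \<noteq> 0 \<Longrightarrow>
      (\<Phi> has_field_derivative exp (- of_real y) * of_real y powr (s - 1)) (at (of_real y))"
proof -
  define S where "S = (\<lambda>z. \<i> * z) ` (- (of_real ` {..0}))"
  have S: "z \<in> S \<longleftrightarrow> - \<i> * z \<notin> \<real>\<^sub>\<le>\<^sub>0" for z
  proof -
    have "z = \<i> * w \<longleftrightarrow> w = - \<i> * z" for w
      by (auto simp: complex_eq_iff)
    then have "z \<in> S \<longleftrightarrow> - \<i> * z \<in> - (of_real ` {..0})"
      unfolding S_def image_iff by auto
    then show ?thesis by (auto simp: nonpos_Reals_def)
  qed
  have "starlike S"
  proof -
    have lin: "linear ((*) \<i>)" by (simp add: linear_iff algebra_simps)
    obtain a where "a \<in> - (of_real ` {..0})"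
      "\<And>z. z \<in> - (of_real ` {..0}) \<Longrightarrow> closed_segment a z \<subseteq> - (complex_of_real ` {..0})"
      using starlike_slotted_complex_plane_left[of 0] unfolding starlike_def by blast
    then show ?thesis
      unfolding starlike_def S_def
      by (intro bexI[of _ "\<i> * a"] ballI) (auto simp: closed_segment_linear_image[OF lin] subset_iff)
  qed
  have "open ((\<lambda>z. - \<i> * z) -` (- \<real>\<^sub>\<le>\<^sub>0))"
    by (intro open_vimage open_Compl closed_nonpos_Reals_complex continuous_intros)
  also have "(\<lambda>z. - \<i> * z) -` (- \<real>\<^sub>\<le>\<^sub>0) = S" by (auto simp only: set_eq_iff S vimage_eq Compl_iff)
  finally have "open S" .
  have up: "z \<in> S" if "0 \<le> Im z" "z \<noteq> 0" for z
    using that unfolding S complex_nonpos_Reals_iff by (auto simp: complex_eq_iff)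
  define L where "L z = Ln (- \<i> * z) + \<i> * of_real pi / 2" for z
  \<comment> \<open>For such \<open>z\<close> the number \<open>- \<i> * z\<close> has nonnegative
    real part, so its argument lies in [-pi/2, pi/2]. Adding pi/2 gives an argument in [0, pi],
    which includes the principal value pi on the negative axis.\<close>
  have L: "L z = Ln z" if "0 \<le> Im z" "z \<noteq> 0" for z
  proof (rule Ln_unique[symmetric])
    have "exp (\<i> * of_real pi / 2) = \<i>" using cis_pi_half by (simp add: cis_conv_exp)
    moreover have "- (\<i> * z * \<i>) = z" by (simp add: complex_eq_iff)
    ultimately show "exp (L z) = z" using that by (simp add: L_def exp_add)
    have "\<bar>Im (Ln (- \<i> * z))\<bar> \<le> pi / 2" using that by (subst Re_Ln_pos_le) auto
    moreover have "Im (L z) = Im (Ln (- \<i> * z)) + pi / 2" by (simp add: L_def)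
    ultimately show "- pi < Im (L z)" "Im (L z) \<le> pi" using pi_gt_zero by linarith+
  qed
  define \<psi> where "\<psi> z = exp (- z) * exp ((s - 1) * L z)" for z
  have \<psi>: "\<psi> z = exp (- z) * z powr (s - 1)" if "0 \<le> Im z" "z \<noteq> 0" for z
    using that L[OF that] by (simp add: \<psi>_def powr_def)
  have "\<psi> holomorphic_on S"
    unfolding \<psi>_def L_def by (intro holomorphic_intros) (auto simp only: S)
  then obtain \<Phi> where \<Phi>: "\<And>z. z \<in> S \<Longrightarrow> (\<Phi> has_field_derivative \<psi> z) (at z)"
    using holomorphic_starlike_primitive[OF _ \<open>starlike S\<close> \<open>open S\<close>, of \<psi> "{}"] \<open>open S\<close>
    by (auto simp: holomorphic_on_open holomorphic_on_imp_continuous_on field_differentiable_def)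
  define f where "f t = (exp (- of_real t) * of_real t powr (s - 1) :: complex)" for t :: real
  define I where "I r = integral {r..} f" for r :: real
  \<comment> \<open>The sum \<open>I r + \<Phi> r\<close> does not depend on r. This makes the tail
    integral a constant minus \<open>\<Phi>\<close> without computing a limit of
    \<open>\<Phi>\<close> at infinity; the constant is later read off at r = 1.\<close>
  have I: "I r + \<Phi> r = I r' + \<Phi> r'" if "0 < r" "r \<le> r'" for r r'
  proof -
    have "(f has_integral (\<Phi> r' - \<Phi> r)) {r..r'}"
    proof (rule fundamental_theorem_of_calculus)
      show "((\<lambda>t. \<Phi> (of_real t)) has_vector_derivative f t) (at t within {r..r'})" if "t \<in> {r..r'}" for t
        using that \<open>0 < r\<close> \<Phi>[of "of_real t"] up[of "of_real t"]
        by (intro has_vector_derivative_real_field) (auto simp: f_def \<psi> intro: has_field_derivative_at_within)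
    qed fact
    moreover have "(f has_integral I r') {r'..}"
      unfolding I_def f_def using Gamma_integrand_integrable[OF s, of r'] that by (simp add: has_integral_integral)
    ultimately have "(f has_integral (\<Phi> r' - \<Phi> r + I r')) ({r..r'} \<union> {r'..})"
      using that by (intro has_integral_Un) (auto intro: negligible_subset[of "{r'}"])
    moreover have "{r..r'} \<union> {r'..} = {r..}" using that by auto
    ultimately have "I r = \<Phi> r' - \<Phi> r + I r'" unfolding I_def[of r] by (simp add: integral_unique)
    then show ?thesis by simp
  qed
  have pos: "I r = (I 1 + \<Phi> 1) - \<Phi> r" if "0 < r" for r
    using I[of r 1] I[of 1 r] that by (cases "r \<le> 1") (auto simp: algebra_simps)
  \<comment> \<open>Added to \<open>I r\<close>, this cancels \<open>\<Phi> r\<close> and leaves the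
    same constant minus \<open>\<Phi> (- r)\<close>, so one formula serves both signs of y.\<close>
  have neg: "contour_integral (part_circlepath 0 r pi 0) (\<lambda>t. exp (- t) * t powr (s - 1))
      = \<Phi> (of_real r) - \<Phi> (of_real (- r))" if "0 < r" for r
  proof -
    have path: "0 \<le> Im z \<and> z \<noteq> 0" if "z \<in> path_image (part_circlepath 0 r pi 0)" for z
    proof -
      have "closed_segment pi 0 = {0..pi}" using pi_ge_zero by (simp add: closed_segment_commute closed_segment_eq_real_ivl)
      then show ?thesis
        using that \<open>0 < r\<close> by (auto simp: path_image_part_circlepath' intro!: mult_nonneg_nonneg sin_ge_zero)
    qed
    have "contour_integral (part_circlepath 0 r pi 0) (\<lambda>t. exp (- t) * t powr (s - 1)) =
        contour_integral (part_circlepath 0 r pi 0) \<psi>"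
      using path \<psi> by (intro contour_integral_eq) auto
    also have "(\<psi> has_contour_integral
        (\<Phi> (pathfinish (part_circlepath 0 r pi 0)) - \<Phi> (pathstart (part_circlepath 0 r pi 0))))
        (part_circlepath 0 r pi 0)"
      using path up by (intro contour_integral_primitive[of S])
        (auto intro: \<Phi> has_field_derivative_at_within)
    then have "contour_integral (part_circlepath 0 r pi 0) \<psi> = \<Phi> (of_real r) - \<Phi> (of_real (- r))"
      by (simp add: contour_integral_unique exp_Euler)
    finally show ?thesis .
  qed
  show thesis
  proof
    show "upper_Gamma s y = (I 1 + \<Phi> 1) - \<Phi> (of_real y)" if "y \<noteq> 0" for y
      using that neg[of "- y"] pos[of "\<bar>y\<bar>"] unfolding upper_Gamma_def f_def[symmetric] I_def[symmetric]
      by (auto simp: abs_if)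
    show "(\<Phi> has_field_derivative exp (- of_real y) * of_real y powr (s - 1)) (at (of_real y))"
      if "y \<noteq> 0" for y :: real
      using that \<Phi>[OF up[of "of_real y"]] \<psi>[of "of_real y"] by simp
  qed
qed

text \<open>On both half-lines \<open>beta\<close> is one constant minus a primitive of the
  integrand. The power must stay complex: for y < 0 it carries the phase of the chosen
  branch.\<close>

lemma beta_has_vector_derivative:
  assumes "y \<noteq> 0"
  shows "(beta has_vector_derivative
    - (of_real (pi / 6) * exp (- of_real (pi * y / 6)) * of_real (pi * y / 6) powr (- 5 / 2))) (at y)"
proof -
  obtain K \<Phi> where K: "\<And>y. y \<noteq> 0 \<Longrightarrow> upper_Gamma (-3/2) y = K - \<Phi> (of_real y)"
    and \<Phi>: "\<And>y::real. y \<noteq> 0 \<Longrightarrow>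
      (\<Phi> has_field_derivative exp (- of_real y) * of_real y powr (-3/2 - 1)) (at (of_real y))"
    using upper_Gamma_primitive[of "-3/2"] by auto
  have d: "((\<lambda>y. pi * y / 6) has_vector_derivative pi / 6) (at y)"
    by (auto intro!: derivative_eq_intros)
  have "((\<lambda>y. K - \<Phi> (of_real (pi * y / 6))) has_vector_derivative
      0 - (pi / 6) *\<^sub>R (exp (- of_real (pi * y / 6)) * of_real (pi * y / 6) powr (-3/2 - 1))) (at y)"
    using vector_diff_chain_at[OF d has_vector_derivative_real_field[OF \<Phi>[of "pi * y / 6"]]] assms
    by (intro has_vector_derivative_diff has_vector_derivative_const) (auto simp: o_def)
  then have "(beta has_vector_derivative
      0 - (pi / 6) *\<^sub>R (exp (- of_real (pi * y / 6)) * of_real (pi * y / 6) powr (-3/2 - 1))) (at y)"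
  proof (rule has_vector_derivative_transform_within_open[where S = "- {0}"])
    show "K - \<Phi> (of_real (pi * y / 6)) = beta y" if "y \<in> - {0}" for y
      using that K[of "pi * y / 6"] by (simp add: beta_def)
  qed (use assms in auto)
  then show ?thesis by (simp add: scaleR_conv_of_real mult.assoc)
qed

section \<open>Size of \<open>beta\<close> on the positive axis\<close>

lemma beta_pos_eq:
  assumes "0 < y"
  shows "(\<lambda>t. exp (- t) * t powr (- 5 / 2)) integrable_on {pi * y / 6..}"
    and "beta y = of_real (integral {pi * y / 6..} (\<lambda>t. exp (- t) * t powr (- 5 / 2)))"
proof -
  let ?f = "\<lambda>t::real. exp (- t) * t powr (- 5 / 2)"
  have eq: "exp (- of_real t) * of_real t powr (-3/2 - 1) = (of_real (?f t) :: complex)"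
    if "t \<in> {pi * y / 6..}" for t
  proof -
    have "0 < pi * y / 6" "pi * y / 6 \<le> t" using that assms by auto
    then have "0 < t" by linarith
    then show ?thesis using powr_of_real[of t "- 5 / 2"] by (simp flip: exp_of_real)
  qed
  have "(\<lambda>t::real. exp (- of_real t) * of_real t powr (-3/2 - 1) :: complex) integrable_on {pi * y / 6..}"
    by (rule Gamma_integrand_integrable) (use assms in auto)
  then have int: "(\<lambda>t. of_real (?f t) :: complex) integrable_on {pi * y / 6..}"
    by (rule integrable_eq) (use eq in auto)
  then have "(\<lambda>t. Re (of_real (?f t))) integrable_on {pi * y / 6..}"
    by (rule integrable_linear[OF _ bounded_linear_Re, unfolded o_def])
  then show *: "?f integrable_on {pi * y / 6..}" by (simp only: Re_complex_of_real)
  have "beta y = integral {pi * y / 6..} (\<lambda>t. exp (- of_real t) * of_real t powr (-3/2 - 1))"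
  proof -
    have "0 < pi * y / 6" using assms by simp
    then have "\<not> pi * y / 6 < 0" "\<bar>pi * y / 6\<bar> = pi * y / 6" by linarith+
    then show ?thesis unfolding beta_def upper_Gamma_def by (simp only: if_False add_0_left)
  qed
  also have "\<dots> = integral {pi * y / 6..} (\<lambda>t. of_real (?f t))"
    by (rule integral_cong) (use eq in auto)
  also have "\<dots> = of_real (integral {pi * y / 6..} ?f)"
    using has_integral_of_real[OF integrable_integral[OF *]] by (rule integral_unique)
  finally show "beta y = of_real (integral {pi * y / 6..} ?f)" .
qed

lemma beta_upper_bound:
  assumes "0 < y"
  shows "cmod (beta y) \<le> (pi * y / 6) powr (- 5 / 2) * exp (- (pi * y / 6))"
proof -
  let ?a = "pi * y / 6"
  have "((\<lambda>t. ?a powr (- 5 / 2) * exp (- 1 * t)) has_integral ?a powr (- 5 / 2) * (exp (- 1 * ?a) / 1)) {?a..}"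
    by (intro has_integral_mult_right has_integral_exp_minus_to_infinity) simp
  moreover have "(\<lambda>t. exp (- t) * t powr (- 5 / 2)) integrable_on {?a..}"
    by (rule beta_pos_eq(1)[OF assms])
  ultimately have "integral {?a..} (\<lambda>t. exp (- t) * t powr (- 5 / 2)) \<le> ?a powr (- 5 / 2) * (exp (- 1 * ?a) / 1)"
    using assms by (intro has_integral_le[OF integrable_integral])
      (auto intro!: mult_left_mono powr_mono2' simp: mult.commute)
  moreover have "integral {?a..} (\<lambda>t. exp (- t) * t powr (- 5 / 2)) \<ge> 0"
    by (intro integral_nonneg beta_pos_eq(1) assms) auto
  ultimately show ?thesis using beta_pos_eq(2)[OF assms] by simp
qed

text \<open>This serves to recover the growth of coefficients from the convergence of a series in
  \<open>beta\<close>. The power of t is absorbed by giving up a factor exp(-t/2), which worsens the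
  rate from pi/6 to pi/4; any fixed rate would do there, because the height is arbitrary.\<close>

lemma beta_lower_bound:
  obtains c where "0 < c" "\<And>y. 0 < y \<Longrightarrow> c * exp (- (pi * y / 4)) \<le> cmod (beta y)"
proof -
  \<comment> \<open>The maximum of t^(5/2) exp(-t/2), attained at t = 5.\<close>
  define C where "C = 5 powr (5 / 2) * exp (- (5 / 2) :: real)"
  have "C > 0" by (simp add: C_def)
  have le: "exp (- (3 / 2) * t) / C \<le> exp (- t) * t powr (- 5 / 2)" if "0 < t" for t
  proof -
    have "t powr (5 / 2) * exp (- (t / 2)) \<le> C"
      using powr_mult_exp_le(1)[of "5 / 2" t 5] that by (simp add: C_def)
    then have "exp (- (t / 2)) \<le> C * t powr (- 5 / 2)"
      using that by (simp add: powr_minus field_simps)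
    then have "exp (- t) * exp (- (t / 2)) \<le> exp (- t) * (C * t powr (- 5 / 2))"
      by (rule mult_left_mono) simp
    also have "exp (- t) * exp (- (t / 2)) = exp (- (3 / 2) * t)"
      by (simp flip: exp_add)
    finally show ?thesis using \<open>C > 0\<close> by (simp add: field_simps)
  qed
  show thesis
  proof (rule that[of "2 / (3 * C)"])
    fix y :: real assume y: "0 < y"
    let ?a = "pi * y / 6"
    have "((\<lambda>t. exp (- (3 / 2) * t) / C) has_integral (exp (- (3 / 2) * ?a) / (3 / 2)) / C) {?a..}"
      by (intro has_integral_divide has_integral_exp_minus_to_infinity) simp
    then have "(exp (- (3 / 2) * ?a) / (3 / 2)) / C \<le> integral {?a..} (\<lambda>t. exp (- t) * t powr (- 5 / 2))"
    proof (rule has_integral_le[OF _ integrable_integral[OF beta_pos_eq(1)[OF y]]])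
      show "exp (- (3 / 2) * t) / C \<le> exp (- t) * t powr (- 5 / 2)" if "t \<in> {?a..}" for t
      proof (rule le)
        have "0 < ?a" "?a \<le> t" using that y by auto
        then show "0 < t" by linarith
      qed
    qed
    also have "\<dots> \<le> cmod (beta y)" by (simp add: beta_pos_eq(2)[OF y])
    finally show "2 / (3 * C) * exp (- (pi * y / 4)) \<le> cmod (beta y)" by (simp add: field_simps)
  qed (use \<open>C > 0\<close> in simp)
qed

subsection \<open>Stokes' theorem on the truncated fundamental domain\<close>

text \<open>A measure that agrees with Lebesgue measure on boxes equals it. Seen as an image of the
  product measure, \<open>lborel\<close> on the complex numbers becomes accessible to Fubini's
  theorem.\<close>

lemma lborel_complex: "(lborel :: complex measure) = distr (lborel \<Otimes>\<^sub>M lborel) borel (\<lambda>(x, y). Complex x y)"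
proof (rule lborel_eqI)
  have [measurable]: "(\<lambda>(x, y). Complex x y) \<in> borel_measurable (lborel \<Otimes>\<^sub>M lborel)"
    unfolding Complex_eq by measurable
  fix l u :: complex
  assume "\<And>b. b \<in> Basis \<Longrightarrow> l \<bullet> b \<le> u \<bullet> b"
  from this[of 1] this[of \<i>] have le: "Re l \<le> Re u" "Im l \<le> Im u"
    by (auto simp: Basis_complex_def)
  have "emeasure (distr (lborel \<Otimes>\<^sub>M lborel) borel (\<lambda>(x, y). Complex x y)) (box l u) =
      emeasure (lborel \<Otimes>\<^sub>M lborel) ((\<lambda>(x, y). Complex x y) -` box l u \<inter> space (lborel \<Otimes>\<^sub>M lborel))"
    by (rule emeasure_distr) auto
  also have "(\<lambda>(x, y). Complex x y) -` box l u \<inter> space (lborel \<Otimes>\<^sub>M lborel) =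
      {Re l<..<Re u} \<times> {Im l<..<Im u}"
    by (auto simp: in_box_complex_iff space_pair_measure)
  also have "emeasure (lborel \<Otimes>\<^sub>M lborel) \<dots> = ennreal (Re u - Re l) * ennreal (Im u - Im l)"
    using le by (simp add: lborel.emeasure_pair_measure_Times)
  also have "\<dots> = (\<Prod>b\<in>Basis. (u - l) \<bullet> b)"
    using le by (simp add: Basis_complex_def ennreal_mult)
  finally show "emeasure (distr (lborel \<Otimes>\<^sub>M lborel) borel (\<lambda>(x, y). Complex x y)) (box l u) =
      (\<Prod>b\<in>Basis. (u - l) \<bullet> b)" .
qed simp

lemma sqrt_one_minus_sq_bounds:
  fixes x :: real
  assumes "x \<in> {-1/2..1/2}"
  shows "1/2 \<le> sqrt (1 - x\<^sup>2)" "sqrt (1 - x\<^sup>2) \<le> 1" "1 - x\<^sup>2 > 0"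
proof -
  have "x\<^sup>2 \<le> (1/2)\<^sup>2" using assms by (intro abs_le_square_iff[THEN iffD1]) auto
  then have "(1/2)\<^sup>2 \<le> 1 - x\<^sup>2" by (simp add: power2_eq_square)
  then show "1/2 \<le> sqrt (1 - x\<^sup>2)" "1 - x\<^sup>2 > 0"
    by (rule real_le_rsqrt, auto simp: power2_eq_square)
  show "sqrt (1 - x\<^sup>2) \<le> 1" by simp
qed

lemma Complex_mem_trunc_fund_domain:
  "Complex x y \<in> trunc_fund_domain Y \<longleftrightarrow> x \<in> {-1/2..1/2} \<and> y \<in> {sqrt (1 - x\<^sup>2)..Y}"
proof (cases "x \<in> {-1/2..1/2}")
  case True
  have "0 < y \<and> 1 \<le> cmod (Complex x y) \<longleftrightarrow> sqrt (1 - x\<^sup>2) \<le> y"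
  proof (cases "0 < y")
    case True
    have "1 \<le> cmod (Complex x y) \<longleftrightarrow> 1 - x\<^sup>2 \<le> y\<^sup>2" by (auto simp: complex_norm)
    also have "\<dots> \<longleftrightarrow> sqrt (1 - x\<^sup>2) \<le> y"
      using True by (meson real_le_lsqrt sqrt_le_D less_imp_le)
    finally show ?thesis using True by simp
  qed (use sqrt_one_minus_sq_bounds[OF True] in auto)
  then show ?thesis using True by (auto simp: trunc_fund_domain_def mem_uhp_iff abs_le_iff)
qed (auto simp: trunc_fund_domain_def abs_le_iff)

text \<open>Points of the domain have height at least sqrt(1 - x^2) \<ge> 1/2, so the open condition
  \<open>0 < Im z\<close> can be traded for a closed one.\<close>

lemma compact_trunc_fund_domain: "compact (trunc_fund_domain Y)"
proof -
  have "trunc_fund_domain Y = cbox (Complex (-1/2) (1/2)) (Complex (1/2) Y) \<inter> {z. 1 \<le> cmod z}"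
  proof (rule set_eqI)
    fix z :: complex
    show "z \<in> trunc_fund_domain Y \<longleftrightarrow> z \<in> cbox (Complex (-1/2) (1/2)) (Complex (1/2) Y) \<inter> {z. 1 \<le> cmod z}"
      using Complex_mem_trunc_fund_domain[of "Re z" "Im z" Y] sqrt_one_minus_sq_bounds[of "Re z"]
      by (auto simp: in_cbox_complex_iff trunc_fund_domain_def mem_uhp_iff abs_le_iff)
  qed
  moreover have "closed {z::complex. 1 \<le> cmod z}"
    by (intro closed_Collect_le continuous_intros)
  ultimately show ?thesis by (simp add: compact_Int_closed)
qed

lemma trunc_fund_domain_subset_uhp: "trunc_fund_domain Y \<subseteq> uhp"
  by (auto simp: trunc_fund_domain_def)

lemma integral_trunc_fund_domain:
  fixes F :: "complex \<Rightarrow> complex"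
  assumes F: "continuous_on uhp F"
  shows "(LINT z:trunc_fund_domain Y|lborel. F z) =
    integral {-1/2..1/2} (\<lambda>x. integral {sqrt (1 - x\<^sup>2)..Y} (\<lambda>y. F (Complex x y)))"
proof -
  let ?D = "trunc_fund_domain Y"
  let ?f = "\<lambda>z. indicator ?D z *\<^sub>R F z"
  let ?C = "\<lambda>(x, y). Complex x y"
  let ?s = "\<lambda>x. sqrt (1 - x\<^sup>2)"
  define G where "G x = integral {?s x..Y} (\<lambda>y. F (Complex x y))" for x
  have C: "?C \<in> borel_measurable (lborel \<Otimes>\<^sub>M lborel)"
    unfolding Complex_eq by measurable
  have int: "integrable lborel ?f"
    using compact_trunc_fund_domain continuous_on_subset[OF F trunc_fund_domain_subset_uhp]
    by (rule borel_integrable_compact)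
  have meas: "?f \<in> borel_measurable borel"
    using int borel_measurable_integrable by force
  have int2: "integrable (lborel \<Otimes>\<^sub>M lborel) (\<lambda>p. ?f (?C p))"
    using int unfolding lborel_complex by (subst (asm) integrable_distr_eq[OF C meas])
  have inner: "(LINT y|lborel. ?f (Complex x y)) = indicator {-1/2..1/2} x *\<^sub>R G x" for x
  proof (cases "x \<in> {-1/2..1/2}")
    case True
    have "set_integrable lborel {?s x..Y} (\<lambda>y. F (Complex x y))"
    proof (intro borel_integrable_atLeastAtMost')
      show "continuous_on {?s x..Y} (\<lambda>y. F (Complex x y))"
        using sqrt_one_minus_sq_bounds[OF True]
        by (intro continuous_on_compose2[OF F]) (auto simp: Complex_eq mem_uhp_iff intro!: continuous_intros)
    qed
    then have "(LINT y:{?s x..Y}|lborel. F (Complex x y)) = G x"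
      unfolding G_def by (rule set_borel_integral_eq_integral)
    moreover have eq: "indicator ?D (Complex x y) = (indicator {?s x..Y} y :: real)" for y
      using True Complex_mem_trunc_fund_domain[of x y Y] by (auto simp: indicator_def)
    ultimately show ?thesis using True unfolding eq by (simp add: set_lebesgue_integral_def)
  next
    case False
    then have eq: "indicator ?D (Complex x y) = (0 :: real)" for y
      using Complex_mem_trunc_fund_domain[of x y Y] by (auto simp: indicator_def)
    show ?thesis unfolding eq using False by simp
  qed
  have "(LINT z:?D|lborel. F z) = (LINT p|(lborel \<Otimes>\<^sub>M lborel). ?f (?C p))"
    unfolding set_lebesgue_integral_def by (subst lborel_complex, subst integral_distr[OF C meas]) simp
  also have "\<dots> = (LINT x|lborel. LINT y|lborel. ?f (?C (x, y)))"
    using lborel_pair.integral_fst'[OF int2] by simp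
  also have "\<dots> = (LINT x:{-1/2..1/2}|lborel. G x)"
    using inner by (simp add: set_lebesgue_integral_def)
  also have "\<dots> = integral {-1/2..1/2} G"
  proof (rule set_borel_integral_eq_integral)
    have "integrable lborel (\<lambda>x. LINT y|lborel. ?f (?C (x, y)))"
      by (rule lborel_pair.integrable_fst'[OF int2])
    then show "set_integrable lborel {-1/2..1/2} G"
      using inner by (simp add: set_integrable_def)
  qed
  finally show ?thesis unfolding G_def .
qed

text \<open>The map z to \<open>- cnj z\<close> only changes the sign of x, and both the strip and
  the lower boundary \<open>sqrt (1 - x\<^sup>2)\<close> are even in x.\<close>

lemma integral_trunc_fund_domain_reflect:
  fixes F :: "complex \<Rightarrow> complex"
  assumes F: "continuous_on uhp F"
  shows "(LINT z:trunc_fund_domain Y|lborel. F (- cnj z)) = (LINT z:trunc_fund_domain Y|lborel. F z)"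
proof -
  have "continuous_on uhp (\<lambda>z. F (- cnj z))"
    by (intro continuous_on_compose2[OF F] continuous_intros) (auto simp: mem_uhp_iff)
  then have "(LINT z:trunc_fund_domain Y|lborel. F (- cnj z)) =
      integral {-1/2..1/2} (\<lambda>x. integral {sqrt (1 - x\<^sup>2)..Y} (\<lambda>y. F (- cnj (Complex x y))))"
    by (rule integral_trunc_fund_domain)
  also have "\<dots> = integral {- (1/2)..- (- 1/2)} (\<lambda>x. integral {sqrt (1 - (- x)\<^sup>2)..Y} (\<lambda>y. F (Complex (- x) y)))"
    by (simp add: Complex_eq complex_cnj_mult)
  also have "\<dots> = integral {-1/2..1/2} (\<lambda>x. integral {sqrt (1 - x\<^sup>2)..Y} (\<lambda>y. F (Complex x y)))"
    by (rule Henstock_Kurzweil_Integration.integral_reflect_real)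
  finally show ?thesis using integral_trunc_fund_domain[OF F] by simp
qed

text \<open>Here \<open>P\<close> and \<open>Q\<close> play the roles of \<open>\<partial>A/\<partial>z\<close> and \<open>\<partial>A/\<partial>\<bar>z\<close>. The substitution
  \<open>y = (1 - u) * sqrt (1 - x\<^sup>2) + u * Y\<close> turns the domain into a rectangle, on which the
  integrand becomes a divergence; the sides cancel by periodicity, and the integrand
  over the arc is odd in \<open>x\<close>.\<close>

lemma integral_trunc_fund_domain_Stokes:
  fixes A P Q :: "complex \<Rightarrow> complex"
  assumes P: "continuous_on uhp P" and Q: "continuous_on uhp Q"
    and A: "\<And>z. z \<in> uhp \<Longrightarrow> (A has_derivative (\<lambda>v. P z * v + Q z * cnj v)) (at z)"
    and T: "\<And>z. z \<in> uhp \<Longrightarrow> A (z + 1) = A z"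
    and S: "\<And>z. z \<in> uhp \<Longrightarrow> A (- 1 / z) = z\<^sup>2 * A z"
    and Y: "1 \<le> Y"
  shows "(LINT z:trunc_fund_domain Y|lborel. 2 * Q z) = \<i> * integral {-1/2..1/2} (\<lambda>x. A (Complex x Y))"
proof -
  define s where "s x = sqrt (1 - x\<^sup>2)" for x :: real
  define s' where "s' x = - x / s x" for x :: real
  define y where "y x u = (1 - u) * s x + u * Y" for x u :: real
  define \<Psi> where "\<Psi> x u = A (Complex x (y x u))" for x u
  \<comment> \<open>\<open>D1\<close> is the x-derivative of (Y - s) \<Psi>, and \<open>D2\<close>
    the u-derivative of (\<i> - (1 - u) s') \<Psi>. Together they form the exterior derivative of
    the pullback of A dz, divided by \<i>: the terms in s' \<Psi> and in P cancel, and 2 Q times the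
    Jacobian Y - s remains. As s' is differentiated only in u, no second derivative of s
    occurs.\<close>
  define D1 where "D1 x u = - of_real (s' x) * \<Psi> x u + of_real (Y - s x) *
    (P (Complex x (y x u)) * (1 + \<i> * of_real ((1 - u) * s' x)) +
     Q (Complex x (y x u)) * (1 - \<i> * of_real ((1 - u) * s' x)))" for x u
  define D2 where "D2 x u = of_real (s' x) * \<Psi> x u + (\<i> - of_real ((1 - u) * s' x)) *
    (\<i> * of_real (Y - s x) * (P (Complex x (y x u)) - Q (Complex x (y x u))))" for x u
  let ?I = "{-1/2..1/2::real}" and ?J = "{0..1::real}"
  let ?R = "cbox (-1/2, 0) (1/2, 1) :: (real \<times> real) set"
  have R: "?R = ?I \<times> ?J" by (auto simp: cbox_Pair_eq)
  note sI = sqrt_one_minus_sq_bounds[folded s_def]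
  have y_pos: "0 < y x u" if "x \<in> ?I" "u \<in> ?J" for x u
  proof -
    have "0 \<le> (1 - u) * (s x - 1/2) + u * (Y - 1/2)"
      using sI[OF that(1)] that Y by (intro add_nonneg_nonneg mult_nonneg_nonneg) auto
    moreover have "(1 - u) * (s x - 1/2) + u * (Y - 1/2) = y x u - 1/2" by (simp add: y_def field_simps)
    ultimately show ?thesis by linarith
  qed
  have s_deriv: "(s has_real_derivative s' x) (at x within X)" if "x \<in> ?I" for x X
  proof -
    have "((\<lambda>x. sqrt (1 - x\<^sup>2)) has_real_derivative s' x) (at x)"
      using sI[OF that] by (auto intro!: derivative_eq_intros simp: s'_def s_def field_simps)
    then show ?thesis unfolding s_def[abs_def] by (rule has_field_derivative_at_within)
  qed
  have s_cont: "continuous_on X s" for X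
    unfolding s_def[abs_def] by (intro continuous_intros)
  have s'_cont: "continuous_on ?I s'"
    unfolding s'_def[abs_def] by (intro continuous_intros s_cont) (use sI in force)
  have z_cont: "continuous_on ?R (\<lambda>(x, u). H (Complex x (y x u)))" if "continuous_on uhp H" for H :: "complex \<Rightarrow> complex"
    unfolding R case_prod_unfold
    by (rule continuous_on_compose2[OF that])
       (auto simp: Complex_eq y_def mem_uhp_iff y_pos[unfolded y_def]
         intro!: continuous_intros continuous_on_compose2[OF s_cont])
  have A_cont: "continuous_on uhp A"
    using A by (meson continuous_at_imp_continuous_on has_derivative_continuous)
  have s_cont2: "continuous_on ?R (\<lambda>p. s (fst p))"
    by (intro continuous_on_compose2[OF s_cont[of UNIV]] continuous_intros) auto
  have s'_cont2: "continuous_on ?R (\<lambda>p. s' (fst p))"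
    unfolding R by (intro continuous_on_compose2[OF s'_cont] continuous_intros) auto
  note zc = z_cont[unfolded case_prod_unfold]
  have D1_cont: "continuous_on ?R (\<lambda>(x, u). D1 x u)"
    unfolding D1_def \<Psi>_def case_prod_unfold
    by (intro continuous_intros zc P Q A_cont s_cont2 s'_cont2)
  have D2_cont: "continuous_on ?R (\<lambda>(x, u). D2 x u)"
    unfolding D2_def \<Psi>_def case_prod_unfold
    by (intro continuous_intros zc P Q A_cont s_cont2 s'_cont2)
  have chain: "((\<lambda>t. A (g t)) has_vector_derivative P (g t) * g' + Q (g t) * cnj g') (at t within X)"
    if "(g has_vector_derivative g') (at t within X)" "g t \<in> uhp" for g g' t X
    using has_derivative_compose[OF that(1)[unfolded has_vector_derivative_def] A[OF that(2)]]
    by (simp add: has_vector_derivative_def scaleR_conv_of_real algebra_simps)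
  have \<Psi>x: "((\<lambda>x. \<Psi> x u) has_vector_derivative
      P (Complex x (y x u)) * (1 + \<i> * of_real ((1 - u) * s' x)) +
      Q (Complex x (y x u)) * (1 - \<i> * of_real ((1 - u) * s' x))) (at x within ?I)"
    if "x \<in> ?I" "u \<in> ?J" for x u
  proof -
    have "((\<lambda>x. Complex x (y x u)) has_vector_derivative (1 + \<i> * of_real ((1 - u) * s' x))) (at x within ?I)"
      unfolding Complex_eq y_def using s_deriv[OF that(1)]
      by (auto intro!: derivative_eq_intros)
    from chain[OF this] show ?thesis using y_pos[OF that] by (simp add: \<Psi>_def mem_uhp_iff)
  qed
  have \<Psi>u: "((\<lambda>u. \<Psi> x u) has_vector_derivative
      \<i> * of_real (Y - s x) * (P (Complex x (y x u)) - Q (Complex x (y x u)))) (at u within ?J)"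
    if "x \<in> ?I" "u \<in> ?J" for x u
  proof -
    have "((\<lambda>u. Complex x (y x u)) has_vector_derivative (\<i> * of_real (Y - s x))) (at u within ?J)"
      unfolding Complex_eq y_def by (auto intro!: derivative_eq_intros)
    from chain[OF this] show ?thesis using y_pos[OF that] by (simp add: \<Psi>_def mem_uhp_iff algebra_simps)
  qed
  have "integral ?I (\<lambda>x. integral ?J (\<lambda>u. D1 x u)) = integral ?J (\<lambda>u. integral ?I (\<lambda>x. D1 x u))"
    using integral_swap_continuous[of "-1/2" 0 "1/2" 1 D1] D1_cont by simp
  also have "\<dots> = integral ?J (\<lambda>u. 0)"
  proof (rule integral_cong)
    fix u assume u: "u \<in> ?J"
    have "((\<lambda>x. D1 x u) has_integral (of_real (Y - s (1/2)) * \<Psi> (1/2) u - of_real (Y - s (-1/2)) * \<Psi> (-1/2) u)) ?I"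
    proof (rule fundamental_theorem_of_calculus)
      fix x assume x: "x \<in> ?I"
      have "((\<lambda>x. of_real (Y - s x)) has_vector_derivative (- of_real (s' x) :: complex)) (at x within ?I)"
        using s_deriv[OF x] by (auto intro!: derivative_eq_intros)
      from has_vector_derivative_mult[OF this \<Psi>x[OF x u]]
      show "((\<lambda>x. of_real (Y - s x) * \<Psi> x u) has_vector_derivative D1 x u) (at x within ?I)"
        by (simp add: D1_def add.commute)
    qed simp
    moreover have "\<Psi> (1/2) u = \<Psi> (-1/2) u"
    proof -
      have "y (1/2) u = y (-1/2) u" by (simp add: y_def s_def)
      moreover have "Complex (1/2) (y (-1/2) u) = Complex (-1/2) (y (-1/2) u) + 1" by (simp add: complex_eq_iff)
      moreover have "Complex (-1/2) (y (-1/2) u) \<in> uhp" using y_pos[of "-1/2" u] u by (simp add: mem_uhp_iff)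
      ultimately show ?thesis unfolding \<Psi>_def using T by metis
    qed
    ultimately show "integral ?I (\<lambda>x. D1 x u) = 0"
      by (simp add: integral_unique s_def)
  qed
  finally have int_D1: "integral ?I (\<lambda>x. integral ?J (\<lambda>u. D1 x u)) = 0" by simp
  \<comment> \<open>Along the arc dz = (1 + \<i> s') dx, so \<open>k\<close> is \<i> times the
    integrand of A dz there. It is the boundary value of the second component at u = 0.\<close>
  define k where "k x = (\<i> - of_real (s' x)) * A (Complex x (s x))" for x
  have inner_D2: "integral ?J (\<lambda>u. D2 x u) = \<i> * A (Complex x Y) - k x" if x: "x \<in> ?I" for x
  proof -
    have "((\<lambda>u. D2 x u) has_integral ((\<i> - of_real ((1 - 1) * s' x)) * \<Psi> x 1 - (\<i> - of_real ((1 - 0) * s' x)) * \<Psi> x 0)) ?J"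
    proof (rule fundamental_theorem_of_calculus)
      fix u assume u: "u \<in> ?J"
      have "((\<lambda>u. \<i> - of_real ((1 - u) * s' x)) has_vector_derivative (of_real (s' x) :: complex)) (at u within ?J)"
        by (auto intro!: derivative_eq_intros)
      from has_vector_derivative_mult[OF this \<Psi>u[OF x u]]
      show "((\<lambda>u. (\<i> - of_real ((1 - u) * s' x)) * \<Psi> x u) has_vector_derivative D2 x u) (at u within ?J)"
        by (simp add: D2_def add.commute)
    qed simp
    then show ?thesis by (simp add: integral_unique \<Psi>_def y_def k_def)
  qed
  have Complex_uhp: "Complex x (s x) \<in> uhp" "Complex x Y \<in> uhp" if "x \<in> ?I" for x
    using sI[OF that] Y by (auto simp: mem_uhp_iff)
  have k_cont: "continuous_on ?I k"
    unfolding k_def[abs_def] Complex_eq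
    by (intro continuous_intros s'_cont continuous_on_compose2[OF A_cont] s_cont)
      (use Complex_uhp in \<open>auto simp: Complex_eq\<close>)
  have top_cont: "continuous_on ?I (\<lambda>x. A (Complex x Y))"
    unfolding Complex_eq
    by (intro continuous_on_compose2[OF A_cont] continuous_intros) (use Y in \<open>auto simp: mem_uhp_iff\<close>)
  \<comment> \<open>On the unit circle -1/\<gamma> is \<open>- cnj \<gamma>\<close>, so the
    inversion reflects the arc. The factor \<gamma>^2 of weight 2 combines with the two forms of dz
    to give -(cnj \<gamma> \<gamma>) = -1.\<close>
  have k_odd: "k (- x) = - k x" if x: "x \<in> ?I" for x
  proof -
    have s0: "s x > 0" and sq: "(s x)\<^sup>2 = 1 - x\<^sup>2" using sI[OF x] by (auto simp: s_def)
    define \<gamma> where "\<gamma> = Complex x (s x)"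
    have s_even: "s (- x) = s x" "s' (- x) = - s' x" by (auto simp: s_def s'_def)
    have "cnj \<gamma> * \<gamma> = 1"
      using sq by (simp add: \<gamma>_def complex_eq_iff power2_eq_square)
    then have inv: "- 1 / \<gamma> = - cnj \<gamma>"
      by (metis divide_minus_left mult.commute mult_zero_left nonzero_eq_divide_eq zero_neq_one)
    have "\<i> + of_real (s' x) = - cnj \<gamma> / of_real (s x)" "\<i> - of_real (s' x) = \<gamma> / of_real (s x)"
      using s0 by (auto simp: complex_eq_iff s'_def \<gamma>_def)
    moreover have "Complex (- x) (s x) = - cnj \<gamma>" by (simp add: \<gamma>_def complex_eq_iff)
    ultimately have "k (- x) = - cnj \<gamma> / of_real (s x) * A (- 1 / \<gamma>)" "k x = \<gamma> / of_real (s x) * A \<gamma>"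
      unfolding k_def s_even inv by (simp_all add: \<gamma>_def)
    moreover have "A (- 1 / \<gamma>) = \<gamma>\<^sup>2 * A \<gamma>"
      using S Complex_uhp[OF x] by (simp add: \<gamma>_def)
    ultimately have "k (- x) = - (cnj \<gamma> * \<gamma>) * k x"
      by (simp add: power2_eq_square)
    then show ?thesis using \<open>cnj \<gamma> * \<gamma> = 1\<close> by simp
  qed
  have "integral ?I k = integral {- (1/2)..- (- 1/2)} (\<lambda>x. k (- x))"
    by (rule Henstock_Kurzweil_Integration.integral_reflect_real[symmetric])
  also have "\<dots> = integral ?I (\<lambda>x. k (- x))" by simp
  also have "\<dots> = integral ?I (\<lambda>x. - k x)" using k_odd by (intro integral_cong)
  finally have int_k: "integral ?I k = 0" by (simp add: integral_neg)
  have int_D2: "integral ?I (\<lambda>x. integral ?J (\<lambda>u. D2 x u)) = \<i> * integral ?I (\<lambda>x. A (Complex x Y))"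
  proof -
    have "integral ?I (\<lambda>x. integral ?J (\<lambda>u. D2 x u)) = integral ?I (\<lambda>x. \<i> * A (Complex x Y) - k x)"
      using inner_D2 by (intro integral_cong) auto
    also have "\<dots> = \<i> * integral ?I (\<lambda>x. A (Complex x Y)) - integral ?I k"
      using top_cont k_cont
      by (subst integral_diff) (auto intro!: integrable_continuous_interval continuous_intros)
    finally show ?thesis using int_k by simp
  qed
  have sum: "D1 x u + D2 x u = of_real (Y - s x) * (2 * Q (Complex x (y x u)))" for x u
    by (simp add: D1_def D2_def algebra_simps)
  have "(LINT z:trunc_fund_domain Y|lborel. 2 * Q z) =
      integral ?I (\<lambda>x. integral {s x..Y} (\<lambda>y. 2 * Q (Complex x y)))"
    unfolding s_def by (intro integral_trunc_fund_domain continuous_intros Q)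
  also have "\<dots> = integral ?I (\<lambda>x. integral ?J (\<lambda>u. D1 x u) + integral ?J (\<lambda>u. D2 x u))"
  proof (rule integral_cong)
    fix x assume x: "x \<in> ?I"
    have y01: "y x 0 = s x" "y x 1 = Y" by (simp_all add: y_def)
    have "((\<lambda>u. (Y - s x) *\<^sub>R (2 * Q (Complex x (y x u)))) has_integral
        integral {y x 0..y x 1} (\<lambda>y. 2 * Q (Complex x y))) ?J"
    proof (rule has_integral_substitution)
      show "y x ` ?J \<subseteq> {s x..Y}"
      proof safe
        fix u assume u: "u \<in> ?J"
        have "0 \<le> u * (Y - s x)" "0 \<le> (1 - u) * (Y - s x)"
          using u sI[OF x] Y by auto
        then show "y x u \<in> {s x..Y}" by (simp add: y_def algebra_simps)
      qed
      show "continuous_on {s x..Y} (\<lambda>y. 2 * Q (Complex x y))"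
        unfolding Complex_eq
        by (intro continuous_intros continuous_on_compose2[OF Q]) (use sI[OF x] in \<open>auto simp: mem_uhp_iff\<close>)
      show "(y x has_real_derivative Y - s x) (at u within ?J)" for u
        unfolding y_def[abs_def] by (auto intro!: derivative_eq_intros)
    qed (use sI[OF x] Y in \<open>auto simp: y_def\<close>)
    then have "integral {s x..Y} (\<lambda>y. 2 * Q (Complex x y)) = integral ?J (\<lambda>u. D1 x u + D2 x u)"
      unfolding sum scaleR_conv_of_real y01 by (rule integral_unique[symmetric])
    also have "\<dots> = integral ?J (\<lambda>u. D1 x u) + integral ?J (\<lambda>u. D2 x u)"
    proof (rule integral_add)
      have "continuous_on ?J (\<lambda>u. (x, u))" by (intro continuous_intros)
      moreover have "(\<lambda>u. (x, u)) ` ?J \<subseteq> ?R" using x unfolding R by auto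
      ultimately have "continuous_on ?J (\<lambda>u. D1 x u)" "continuous_on ?J (\<lambda>u. D2 x u)"
        using continuous_on_compose2[OF D1_cont, of ?J "\<lambda>u. (x, u)"]
          continuous_on_compose2[OF D2_cont, of ?J "\<lambda>u. (x, u)"] by auto
      then show "(\<lambda>u. D1 x u) integrable_on ?J" "(\<lambda>u. D2 x u) integrable_on ?J"
        by (auto intro!: integrable_continuous_interval)
    qed
    finally show "integral {s x..Y} (\<lambda>y. 2 * Q (Complex x y)) =
      integral ?J (\<lambda>u. D1 x u) + integral ?J (\<lambda>u. D2 x u)" .
  qed
  also have "\<dots> = integral ?I (\<lambda>x. integral ?J (\<lambda>u. D1 x u)) + integral ?I (\<lambda>x. integral ?J (\<lambda>u. D2 x u))"
    using integral_continuous_on_param[of ?I 0 1 D1] integral_continuous_on_param[of ?I 0 1 D2]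
      D1_cont[unfolded R] D2_cont[unfolded R]
    by (intro integral_add) (auto intro!: integrable_continuous_interval)
  finally show ?thesis using int_D1 int_D2 by simp
qed

subsection \<open>Series in \<open>q\<close>\<close>

lemma qpow_add: "qpow z (r + s) = qpow z r * qpow z s"
  unfolding qpow_def exp_add[symmetric] by (simp add: algebra_simps)

lemma norm_qpow: "cmod (qpow z r) = exp (- (2 * pi * r * Im z))"
  by (simp add: qpow_def mult_ac)

lemma qpow_nonzero: "qpow z r \<noteq> 0"
  by (simp add: qpow_def)

lemma qpow_0: "qpow z 0 = 1"
  by (simp add: qpow_def)

lemma qpow_minus: "qpow z (- r) = inverse (qpow z r)"
  by (simp add: qpow_def exp_minus)

lemma qpow_plus_1: "qpow (z + 1) r = exp (2 * of_real pi * \<i> * of_real r) * qpow z r"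
  unfolding qpow_def exp_add[symmetric] by (simp add: algebra_simps)

lemma qpow_plus_1_of_int: "qpow (z + 1) (of_int n) = qpow z (of_int n)"
  using exp_integer_2pi[of "of_int n"] by (simp add: qpow_plus_1 mult_ac)

lemma cnj_qpow: "cnj (qpow z r) = qpow (- cnj z) r"
  by (simp add: qpow_def exp_cnj)

lemma holomorphic_on_qpow: "(\<lambda>z. qpow z r) holomorphic_on S"
  unfolding qpow_def by (intro holomorphic_intros)

lemma continuous_on_qpow: "continuous_on S (\<lambda>z. qpow z r)"
  unfolding qpow_def by (intro continuous_intros)

lemma qpow_has_field_derivative:
  "((\<lambda>z. qpow z r) has_field_derivative 2 * of_real pi * \<i> * of_real r * qpow z r) (at z)"
  unfolding qpow_def by (auto intro!: derivative_eq_intros)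

lemma tendsto_qpow_0:
  assumes "0 < r"
  shows "((\<lambda>z. qpow z r) \<longlongrightarrow> 0) (filtercomap Im at_top)"
proof (rule tendsto_norm_zero_cancel)
  have "((\<lambda>y. exp (- (2 * pi * r * y))) \<longlongrightarrow> 0) at_top"
    using assms by real_asymp
  then show "((\<lambda>z. cmod (qpow z r)) \<longlongrightarrow> 0) (filtercomap Im at_top)"
    unfolding norm_qpow by (rule filterlim_compose[OF _ filterlim_filtercomap])
qed

text \<open>The growth condition on the coefficients under which \<open>\<Sum>a\<^sub>j q\<^sup>j\<^sup>+\<^sup>r\<close> converges on the
  whole upper half plane.\<close>

definition subexponential :: "(nat \<Rightarrow> complex) \<Rightarrow> bool" where
  "subexponential a \<longleftrightarrow> (\<forall>\<delta>>0. \<exists>B\<ge>0. \<forall>j. cmod (a j) \<le> B * exp (\<delta> * real j))"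

text \<open>The height y = \<delta>/c produces the prescribed rate \<delta>; the shift r only
  changes the constant.\<close>

lemma subexponentialI:
  assumes c: "0 < c" and bound: "\<And>y. 0 < y \<Longrightarrow> \<exists>B. \<forall>j. cmod (a j) \<le> B * exp (c * (real j + r) * y)"
  shows "subexponential a"
  unfolding subexponential_def
proof (intro allI impI)
  fix \<delta> :: real assume \<delta>: "0 < \<delta>"
  obtain B where B: "\<And>j. cmod (a j) \<le> B * exp (c * (real j + r) * (\<delta> / c))"
    using bound[of "\<delta> / c"] c \<delta> by auto
  have eq: "B * exp (c * (real j + r) * (\<delta> / c)) = B * exp (r * \<delta>) * exp (\<delta> * real j)" for j
    using c unfolding mult.assoc exp_add[symmetric] by (simp add: field_simps)
  have "0 \<le> B * exp (r * \<delta>) * exp (\<delta> * real 0)"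
    using B[of 0] norm_ge_zero[of "a 0"] unfolding eq by linarith
  then have "0 \<le> B * exp (r * \<delta>)" by simp
  then show "\<exists>B\<ge>0. \<forall>j. cmod (a j) \<le> B * exp (\<delta> * real j)"
    using B unfolding eq by blast
qed

lemma subexponential_mult_bounded:
  assumes a: "subexponential a" and b: "\<And>j. cmod (b j) \<le> C * cmod (a j)"
  shows "subexponential b"
  unfolding subexponential_def
proof (intro allI impI)
  fix \<delta> :: real assume "0 < \<delta>"
  then obtain B where B: "B \<ge> 0" "\<And>j. cmod (a j) \<le> B * exp (\<delta> * real j)"
    using a unfolding subexponential_def by blast
  have "cmod (b j) \<le> \<bar>C\<bar> * B * exp (\<delta> * real j)" for j
  proof -
    have "cmod (b j) \<le> \<bar>C\<bar> * cmod (a j)"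
      using b[of j] by (rule order_trans) (simp add: mult_right_mono)
    also have "\<dots> \<le> \<bar>C\<bar> * (B * exp (\<delta> * real j))"
      using B by (intro mult_left_mono) auto
    finally show ?thesis by (simp add: mult.assoc)
  qed
  then show "\<exists>B\<ge>0. \<forall>j. cmod (b j) \<le> B * exp (\<delta> * real j)"
    using B by (intro exI[of _ "\<bar>C\<bar> * B"]) auto
qed

text \<open>Half of the rate c is spent on the coefficients, the other half on the linear factor.
  That factor arises from termwise differentiation.\<close>

lemma subexponential_summable:
  assumes a: "subexponential a" and c: "0 < c" and r: "0 \<le> r"
  shows "summable (\<lambda>j. cmod (a j) * ((real j + r) * exp (- (c * (real j + r)))))"
proof -
  obtain B where B: "B \<ge> 0" "\<And>j. cmod (a j) \<le> B * exp (c / 2 * real j)"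
    using a c unfolding subexponential_def by (metis half_gt_zero)
  have "summable (\<lambda>j. of_nat (Suc j) * exp (- (c / 2)) ^ j)"
    using geometric_deriv_sums[of "exp (- (c / 2)) :: real"] c by (auto simp: sums_iff)
  then have "summable (\<lambda>j. B * (1 + r) * (of_nat (Suc j) * exp (- (c / 2)) ^ j))"
    by (rule summable_mult)
  moreover have "norm (cmod (a j) * ((real j + r) * exp (- (c * (real j + r))))) \<le>
      B * (1 + r) * (of_nat (Suc j) * exp (- (c / 2)) ^ j)" for j
  proof -
    have "real j + r \<le> (1 + r) * real (Suc j)"
      using r by (simp add: algebra_simps)
    moreover have "exp (- (c * (real j + r))) \<le> exp (- (c * real j))"
      using c r by simp
    ultimately have "(real j + r) * exp (- (c * (real j + r))) \<le> (1 + r) * real (Suc j) * exp (- (c * real j))"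
      using r by (intro mult_mono) auto
    then have "cmod (a j) * ((real j + r) * exp (- (c * (real j + r)))) \<le>
        (B * exp (c / 2 * real j)) * ((1 + r) * real (Suc j) * exp (- (c * real j)))"
      by (rule mult_mono[OF B(2)]) (use B r in auto)
    also have "\<dots> = B * (1 + r) * (of_nat (Suc j) * (exp (c / 2 * real j) * exp (- (c * real j))))"
      by (simp only: mult_ac)
    also have "exp (c / 2 * real j) * exp (- (c * real j)) = exp (- (c / 2)) ^ j"
      unfolding exp_add[symmetric] exp_of_nat_mult[symmetric] by (simp add: field_simps)
    finally show ?thesis using r by simp
  qed
  ultimately show ?thesis by (rule summable_comparison_test')
qed

lemma subexponential_summable':
  assumes a: "subexponential a" and c: "0 < c" and r: "0 < r"
  shows "summable (\<lambda>j. cmod (a j) * exp (- (c * (real j + r))))"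
proof (rule summable_comparison_test')
  show "summable (\<lambda>j. inverse r * (cmod (a j) * ((real j + r) * exp (- (c * (real j + r))))))"
    using subexponential_summable[OF a c] r by (intro summable_mult) auto
  show "norm (cmod (a j) * exp (- (c * (real j + r)))) \<le>
      inverse r * (cmod (a j) * ((real j + r) * exp (- (c * (real j + r)))))" for j
  proof -
    have "1 \<le> inverse r * (real j + r)" using r by (simp add: field_simps)
    then have "1 * (cmod (a j) * exp (- (c * (real j + r)))) \<le>
        inverse r * (real j + r) * (cmod (a j) * exp (- (c * (real j + r))))"
      by (intro mult_right_mono) auto
    then show ?thesis by (simp add: mult_ac)
  qed
qed

lemma qseries_bound:
  assumes "0 < r" and "Im z \<ge> y"
  shows "cmod (a j * qpow z (real j + r)) \<le> cmod (a j) * exp (- (2 * pi * y * (real j + r)))"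
proof -
  have "2 * pi * (real j + r) * y \<le> 2 * pi * (real j + r) * Im z"
    using assms by (intro mult_left_mono) auto
  then show ?thesis by (simp add: norm_mult norm_qpow mult_left_mono mult_ac)
qed

lemma qseries_uniform_limit:
  assumes a: "subexponential a" and r: "0 < r" and y: "0 < y"
  shows "uniform_limit {z. y \<le> Im z} (\<lambda>n z. \<Sum>j<n. a j * qpow z (real j + r))
    (\<lambda>z. \<Sum>j. a j * qpow z (real j + r)) sequentially"
proof (rule Weierstrass_m_test)
  show "summable (\<lambda>j. cmod (a j) * exp (- (2 * pi * y * (real j + r))))"
    using y r by (intro subexponential_summable' a) auto
qed (use qseries_bound[OF r] in auto)

lemma qseries_summable:
  assumes a: "subexponential a" and r: "0 < r" and z: "z \<in> uhp"
  shows "summable (\<lambda>j. a j * qpow z (real j + r))"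
proof (rule summable_comparison_test')
  show "summable (\<lambda>j. cmod (a j) * exp (- (2 * pi * Im z * (real j + r))))"
    using z r by (intro subexponential_summable' a) (auto simp: mem_uhp_iff)
qed (use qseries_bound[OF r, of "Im z" z] in auto)

lemma holomorphic_qseries:
  assumes a: "subexponential a" and r: "0 < r"
  shows "(\<lambda>z. \<Sum>j. a j * qpow z (real j + r)) holomorphic_on uhp"
proof (rule holomorphic_uniform_sequence[OF open_uhp])
  show "(\<lambda>z. \<Sum>j<n. a j * qpow z (real j + r)) holomorphic_on uhp" for n
    by (intro holomorphic_intros holomorphic_on_qpow)
  fix z assume z: "z \<in> uhp"
  have sub: "cball z (Im z / 2) \<subseteq> {w. Im z / 2 \<le> Im w}"
  proof
    fix w assume "w \<in> cball z (Im z / 2)"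
    then have "\<bar>Im (z - w)\<bar> \<le> Im z / 2"
      using abs_Im_le_cmod[of "z - w"] by (auto simp: dist_norm)
    then show "w \<in> {w. Im z / 2 \<le> Im w}" by (simp add: abs_if split: if_splits)
  qed
  have "uniform_limit (cball z (Im z / 2)) (\<lambda>n z. \<Sum>j<n. a j * qpow z (real j + r))
      (\<lambda>z. \<Sum>j. a j * qpow z (real j + r)) sequentially"
    using z by (intro uniform_limit_on_subset[OF qseries_uniform_limit[OF a r] sub]) (simp add: mem_uhp_iff)
  moreover have "cball z (Im z / 2) \<subseteq> uhp" using sub z by (auto simp: mem_uhp_iff subset_iff)
  ultimately show "\<exists>d>0. cball z d \<subseteq> uhp \<and> uniform_limit (cball z d) (\<lambda>n z. \<Sum>j<n. a j * qpow z (real j + r))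
      (\<lambda>z. \<Sum>j. a j * qpow z (real j + r)) sequentially"
    using z by (intro exI[of _ "Im z / 2"]) (simp add: mem_uhp_iff)
qed

lemma tendsto_qseries_0:
  assumes a: "subexponential a" and r: "0 < r"
  shows "((\<lambda>z. \<Sum>j. a j * qpow z (real j + r)) \<longlongrightarrow> 0) (filtercomap Im at_top)"
proof (rule swap_uniform_limit'[OF _ _ qseries_uniform_limit[OF a r, of 1]])
  show "\<forall>\<^sub>F n in sequentially. ((\<lambda>z. \<Sum>j<n. a j * qpow z (real j + r)) \<longlongrightarrow> 0) (filtercomap Im at_top)"
  proof (intro always_eventually allI tendsto_null_sum)
    show "((\<lambda>z. a j * qpow z (real j + r)) \<longlongrightarrow> 0) (filtercomap Im at_top)" for j
      using tendsto_mult_right_zero[OF tendsto_qpow_0[of "real j + r"], of "a j"] r by simp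
  qed
qed (auto simp: eventually_Im_at_top)

text \<open>The terms of a convergent series are bounded. At z = \<i> y this bounds the coefficients
  by an exponential of rate proportional to y, and y may be taken arbitrarily small.\<close>

lemma subexponential_of_summable_qseries:
  assumes r: "0 < r" and sm: "\<And>z. z \<in> uhp \<Longrightarrow> summable (\<lambda>j. a j * qpow z (real j + r))"
  shows "subexponential a"
proof (rule subexponentialI[where c = "2 * pi" and r = r])
  fix y :: real assume y: "0 < y"
  have "(\<lambda>j. a j * qpow (\<i> * of_real y) (real j + r)) \<longlonglongrightarrow> 0"
    using y by (intro summable_LIMSEQ_zero sm) (simp add: mem_uhp_iff)
  from convergent_imp_Bseq[OF convergentI[OF this]]
  obtain B where "\<And>j. cmod (a j * qpow (\<i> * of_real y) (real j + r)) \<le> B"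
    by (elim BseqE) blast
  then have "cmod (a j) \<le> B * exp (2 * pi * (real j + r) * y)" for j
    by (simp add: norm_mult norm_qpow exp_minus divide_simps)
  then show "\<exists>B. \<forall>j. cmod (a j) \<le> B * exp (2 * pi * (real j + r) * y)" by blast
qed simp

text \<open>As for a q-series, with z = \<i> y. Writing \<kappa> = j + r, the lower bound for
  \<open>beta\<close> costs exp(-6 pi \<kappa> y), while the power of q contributes exp(2 pi
  \<kappa> y); the difference of the rates is the 4 pi below.\<close>

lemma subexponential_of_summable_beta_series:
  assumes r: "0 < r"
    and sm: "\<And>z. z \<in> uhp \<Longrightarrow> summable (\<lambda>j. a j * beta (24 * (real j + r) * Im z) * qpow z (- (real j + r)))"
  shows "subexponential a"
proof (rule subexponentialI[where c = "4 * pi" and r = r])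
  obtain c where c: "0 < c" "\<And>y. 0 < y \<Longrightarrow> c * exp (- (pi * y / 4)) \<le> cmod (beta y)"
    using beta_lower_bound by blast
  fix y :: real assume y: "0 < y"
  have "(\<lambda>j. a j * beta (24 * (real j + r) * Im (\<i> * of_real y)) * qpow (\<i> * of_real y) (- (real j + r))) \<longlonglongrightarrow> 0"
    using y by (intro summable_LIMSEQ_zero sm) (simp add: mem_uhp_iff)
  from convergent_imp_Bseq[OF convergentI[OF this]]
  obtain B where B: "\<And>j. cmod (a j * beta (24 * (real j + r) * Im (\<i> * of_real y)) * qpow (\<i> * of_real y) (- (real j + r))) \<le> B"
    by (elim BseqE) blast
  have "cmod (a j) \<le> B / c * exp (4 * pi * (real j + r) * y)" for j
  proof -
    let ?\<kappa> = "real j + r"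
    have \<kappa>: "0 < ?\<kappa>" using r by simp
    have "cmod (a j) * (c * exp (- (pi * (24 * ?\<kappa> * y) / 4))) * exp (2 * pi * ?\<kappa> * y) \<le>
        cmod (a j) * cmod (beta (24 * ?\<kappa> * y)) * exp (2 * pi * ?\<kappa> * y)"
      using c(2)[of "24 * ?\<kappa> * y"] \<kappa> y by (intro mult_right_mono mult_left_mono) auto
    also have "\<dots> \<le> B" using B[of j] unfolding norm_mult norm_qpow by (simp add: algebra_simps)
    also have "cmod (a j) * (c * exp (- (pi * (24 * ?\<kappa> * y) / 4))) * exp (2 * pi * ?\<kappa> * y) =
        cmod (a j) * c * (exp (- (pi * (24 * ?\<kappa> * y) / 4)) * exp (2 * pi * ?\<kappa> * y))" by (simp only: mult_ac)
    also have "exp (- (pi * (24 * ?\<kappa> * y) / 4)) * exp (2 * pi * ?\<kappa> * y) = inverse (exp (4 * pi * ?\<kappa> * y))"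
      unfolding exp_add[symmetric] exp_minus[symmetric] by simp
    finally show ?thesis using c(1) by (simp add: field_simps)
  qed
  then show "\<exists>B. \<forall>j. cmod (a j) \<le> B * exp (4 * pi * (real j + r) * y)" by blast
qed simp

subsection \<open>Nonholomorphic series\<close>

text \<open>A positive factor leaves the argument unchanged, so it splits off from the principal
  logarithm even when \<open>t\<close> is negative.\<close>

lemma complex_powr_mult_of_real:
  assumes "0 < y" "t \<noteq> 0"
  shows "(of_real (t * y) :: complex) powr a = of_real t powr a * of_real y powr a"
proof -
  have "Ln (of_real (t * y)) = Ln (of_real y) + Ln (of_real t :: complex)"
    using Ln_times_of_real[of y "of_real t"] assms by (simp add: mult.commute Ln_of_real)
  then show ?thesis using assms by (simp add: powr_def ring_distribs exp_add Ln_of_real mult.commute)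
qed

lemma minus_one_powr_minus_five_halves: "(- 1 :: complex) powr (- 5 / 2) = - \<i>"
proof -
  have "(- 1 :: complex) powr (- 5 / 2) = cis (- (pi / 2) - 2 * pi)"
    by (simp add: powr_def cis_conv_exp algebra_simps)
  also have "\<dots> = cis (- (pi / 2))" by (simp only: cis_divide[symmetric] cis_2pi div_by_1)
  finally show ?thesis by (simp add: complex_eq_iff)
qed

text \<open>The index \<kappa> = n/24 is the exponent of q up to sign. Then
  \<open>beta (24 * \<kappa> * y)\<close> is \<Gamma>(-3/2, 4 pi \<kappa> y), and its y-derivative
  is this constant times exp(-4 pi \<kappa> y) y^(-5/2). The complex power covers both signs of
  \<kappa>.\<close>

definition beta_const :: "real \<Rightarrow> complex" where
  "beta_const \<kappa> = - (of_real (4 * pi * \<kappa>) * of_real (4 * pi * \<kappa>) powr (- 5 / 2))"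

lemma beta_const_pos:
  assumes "0 < \<kappa>"
  shows "beta_const \<kappa> = - of_real ((4 * pi * \<kappa>) powr (- 3 / 2))"
proof -
  have "(4 * pi * \<kappa>) * (4 * pi * \<kappa>) powr (- 5 / 2) = (4 * pi * \<kappa>) powr (- 3 / 2)"
    using assms powr_mult_base[of "4 * pi * \<kappa>" "- 5 / 2"] by simp
  moreover have "(of_real (4 * pi * \<kappa>) :: complex) powr (- 5 / 2) = of_real ((4 * pi * \<kappa>) powr (- 5 / 2))"
    using powr_of_real[of "4 * pi * \<kappa>" "- 5 / 2"] assms by simp
  ultimately show ?thesis unfolding beta_const_def by (metis of_real_mult)
qed

lemma beta_const_neg:
  assumes "0 < \<kappa>"
  shows "beta_const (- \<kappa>) = - \<i> * of_real ((4 * pi * \<kappa>) powr (- 3 / 2))"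
proof -
  have "(of_real (4 * pi * (- \<kappa>)) :: complex) powr (- 5 / 2) = - \<i> * of_real (4 * pi * \<kappa>) powr (- 5 / 2)"
    using complex_powr_mult_of_real[of "4 * pi * \<kappa>" "- 1" "- 5 / 2"] assms minus_one_powr_minus_five_halves by simp
  then have "beta_const (- \<kappa>) = \<i> * beta_const \<kappa>"
    unfolding beta_const_def by simp
  then show ?thesis using beta_const_pos[OF assms] by simp
qed

definition beta_coeff_deriv :: "real \<Rightarrow> real \<Rightarrow> complex" where
  "beta_coeff_deriv \<kappa> y = beta_const \<kappa> * exp (- of_real (4 * pi * \<kappa> * y)) * of_real (y powr (- 5 / 2))"

lemma beta_scaled_has_vector_derivative:
  assumes "\<kappa> \<noteq> 0" "0 < y"
  shows "((\<lambda>y. beta (24 * \<kappa> * y)) has_vector_derivative beta_coeff_deriv \<kappa> y) (at y)"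
proof -
  have d: "((\<lambda>y. 24 * \<kappa> * y) has_vector_derivative 24 * \<kappa>) (at y)"
    by (auto intro!: derivative_eq_intros)
  have ne: "24 * \<kappa> * y \<noteq> 0" using assms by simp
  have eq: "pi * (24 * \<kappa> * y) / 6 = 4 * pi * \<kappa> * y" by simp
  have pw: "(of_real (4 * pi * \<kappa> * y) :: complex) powr (- 5 / 2) =
      of_real (4 * pi * \<kappa>) powr (- 5 / 2) * of_real (y powr (- 5 / 2))"
    using complex_powr_mult_of_real[of y "4 * pi * \<kappa>" "- 5 / 2"] powr_of_real[of y "- 5 / 2"] assms by simp
  have "((\<lambda>y. beta (24 * \<kappa> * y)) has_vector_derivative (24 * \<kappa>) *\<^sub>R
      - (of_real (pi / 6) * exp (- of_real (4 * pi * \<kappa> * y)) * of_real (4 * pi * \<kappa> * y) powr (- 5 / 2))) (at y)"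
    using vector_diff_chain_at[OF d beta_has_vector_derivative[OF ne]] unfolding eq by (simp only: o_def)
  then show ?thesis
    unfolding pw by (simp add: beta_coeff_deriv_def beta_const_def scaleR_conv_of_real mult_ac)
qed

text \<open>Positive \<kappa> = n/24 gives the decaying nonholomorphic terms, and \<kappa> = -m/24
  gives the growing one, so a single computation of derivatives serves both.\<close>

definition beta_term :: "real \<Rightarrow> complex \<Rightarrow> complex" where
  "beta_term \<kappa> z = beta (24 * \<kappa> * Im z) * qpow z (- \<kappa>)"

definition beta_term_dz :: "real \<Rightarrow> complex \<Rightarrow> complex" where
  "beta_term_dz \<kappa> z = (- \<i> / 2 * beta_coeff_deriv \<kappa> (Im z)
     - 2 * of_real pi * \<i> * of_real \<kappa> * beta (24 * \<kappa> * Im z)) * qpow z (- \<kappa>)"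

definition beta_term_dzbar :: "real \<Rightarrow> complex \<Rightarrow> complex" where
  "beta_term_dzbar \<kappa> z = \<i> / 2 * beta_const \<kappa> * of_real (Im z powr (- 5 / 2)) * cnj (qpow z \<kappa>)"

text \<open>This identity is the reason why the derivative with respect to the conjugate variable
  is, apart from a power of y, antiholomorphic: the exponential coming from \<open>beta\<close>
  turns q^(-\<kappa>) into the conjugate of q^\<kappa>.\<close>

lemma cnj_qpow_eq: "cnj (qpow z \<kappa>) = exp (- of_real (4 * pi * \<kappa> * Im z)) * qpow z (- \<kappa>)"
  unfolding cnj_qpow unfolding qpow_def exp_add[symmetric] by (rule arg_cong[of _ _ exp]) (simp add: complex_eq_iff)

lemma beta_term_dzbar_alt: "beta_term_dzbar \<kappa> z = \<i> / 2 * beta_coeff_deriv \<kappa> (Im z) * qpow z (- \<kappa>)"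
  by (simp add: beta_term_dzbar_def beta_coeff_deriv_def cnj_qpow_eq)

text \<open>Real differentiability is recorded by the pair of Wirtinger derivatives, as coefficients
  of \<open>v\<close> and \<open>cnj v\<close>. The y-derivative is shared between them through Im v
  = -\<i>/2 (v - cnj v).\<close>

lemma beta_term_has_derivative:
  assumes \<kappa>: "\<kappa> \<noteq> 0" and z: "z \<in> uhp"
  shows "(beta_term \<kappa> has_derivative
    (\<lambda>v. beta_term_dz \<kappa> z * v + beta_term_dzbar \<kappa> z * cnj v)) (at z)"
proof -
  have "((\<lambda>y. beta (24 * \<kappa> * y)) has_derivative (\<lambda>h. h *\<^sub>R beta_coeff_deriv \<kappa> (Im z))) (at (Im z))"
    using beta_scaled_has_vector_derivative[OF \<kappa>, of "Im z"] z
    by (simp add: has_vector_derivative_def mem_uhp_iff)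
  from has_derivative_compose[OF has_derivative_Im[OF has_derivative_ident] this]
  have b: "((\<lambda>z. beta (24 * \<kappa> * Im z)) has_derivative (\<lambda>v. Im v *\<^sub>R beta_coeff_deriv \<kappa> (Im z))) (at z)" .
  have q: "((\<lambda>z. qpow z (- \<kappa>)) has_derivative (*) (2 * of_real pi * \<i> * of_real (- \<kappa>) * qpow z (- \<kappa>))) (at z)"
    by (rule qpow_has_field_derivative[unfolded has_field_derivative_def])
  have Im: "of_real (Im v) = - \<i> / 2 * (v - cnj v)" for v
    by (simp add: complex_eq_iff)
  show ?thesis
    unfolding beta_term_def[abs_def] beta_term_dzbar_alt
    by (rule has_derivative_eq_rhs[OF has_derivative_mult[OF b q]])
      (simp add: fun_eq_iff scaleR_conv_of_real Im beta_term_dz_def field_simps)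
qed

lemma continuous_on_beta_term:
  assumes "\<kappa> \<noteq> 0"
  shows "continuous_on uhp (beta_term \<kappa>)" "continuous_on uhp (beta_term_dz \<kappa>)"
proof -
  show "continuous_on uhp (beta_term \<kappa>)"
    using beta_term_has_derivative[OF assms] by (meson continuous_at_imp_continuous_on has_derivative_continuous)
  have "continuous_on {0<..} (\<lambda>y. beta (24 * \<kappa> * y))"
    using beta_scaled_has_vector_derivative[OF assms]
    by (intro continuous_at_imp_continuous_on) (auto intro: has_vector_derivative_continuous)
  then have b: "continuous_on uhp (\<lambda>z. beta (24 * \<kappa> * Im z))"
    by (rule continuous_on_compose2) (auto intro!: continuous_intros simp: mem_uhp_iff)
  have "continuous_on uhp (\<lambda>z. beta_coeff_deriv \<kappa> (Im z))"
    unfolding beta_coeff_deriv_def by (intro continuous_intros) (auto simp: mem_uhp_iff)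
  with b show "continuous_on uhp (beta_term_dz \<kappa>)"
    unfolding beta_term_dz_def[abs_def] by (intro continuous_intros continuous_on_qpow)
qed

text \<open>The decay exp(-4 pi \<kappa> Im z) of \<open>beta\<close> outweighs the growth exp(2 pi
  \<kappa> Im z) of q^(-\<kappa>). The constant is uniform in \<kappa> \<ge> r and Im z \<ge> y, as
  a Weierstrass majorant requires.\<close>

lemma beta_term_bounds:
  assumes r: "0 < r" "r \<le> \<kappa>" and y: "0 < y" "y \<le> Im z"
  defines "C \<equiv> (4 * pi * r * y) powr (- 5 / 2)"
  shows "cmod (beta_term \<kappa> z) \<le> C * exp (- (2 * pi * y * \<kappa>))"
    and "cmod (beta_term_dz \<kappa> z) \<le> 4 * pi * C * (\<kappa> * exp (- (2 * pi * y * \<kappa>)))"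
    and "cmod (beta_term_dzbar \<kappa> z) \<le> 4 * pi * C * (\<kappa> * exp (- (2 * pi * y * \<kappa>)))"
proof -
  have \<kappa>: "0 < \<kappa>" using r by simp
  have Im: "0 < Im z" using y by simp
  let ?t = "4 * pi * \<kappa> * Im z"
  have t: "4 * pi * r * y \<le> ?t" "0 < 4 * pi * r * y"
    using r y by (auto intro!: mult_mono)
  have C: "?t powr (- 5 / 2) \<le> C" "0 \<le> C"
    unfolding C_def using t by (auto intro!: powr_mono2')
  have e: "exp (- ?t) * cmod (qpow z (- \<kappa>)) \<le> exp (- (2 * pi * y * \<kappa>))"
  proof -
    have "exp (- ?t) * cmod (qpow z (- \<kappa>)) = exp (- (2 * pi * Im z * \<kappa>))"
      unfolding norm_qpow exp_add[symmetric] by (simp add: algebra_simps)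
    also have "\<dots> \<le> exp (- (2 * pi * y * \<kappa>))" using y \<kappa> by simp
    finally show ?thesis .
  qed
  have b: "cmod (beta (24 * \<kappa> * Im z)) \<le> C * exp (- ?t)"
  proof -
    have "cmod (beta (24 * \<kappa> * Im z)) \<le> ?t powr (- 5 / 2) * exp (- ?t)"
      using beta_upper_bound[of "24 * \<kappa> * Im z"] \<kappa> Im by (simp add: mult_ac)
    also have "\<dots> \<le> C * exp (- ?t)" using C by (intro mult_right_mono) auto
    finally show ?thesis .
  qed
  have "(4 * pi * \<kappa>) powr (- 3 / 2) = (4 * pi * \<kappa>) * (4 * pi * \<kappa>) powr (- 5 / 2)"
    using \<kappa> powr_mult_base[of "4 * pi * \<kappa>" "- 5 / 2"] by simp
  then have "(4 * pi * \<kappa>) powr (- 3 / 2) * Im z powr (- 5 / 2) = (4 * pi * \<kappa>) * ?t powr (- 5 / 2)"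
    using \<kappa> Im by (simp add: powr_mult)
  then have "cmod (beta_coeff_deriv \<kappa> (Im z)) = 4 * pi * \<kappa> * ?t powr (- 5 / 2) * exp (- ?t)"
    using \<kappa> by (simp add: beta_coeff_deriv_def beta_const_pos norm_mult mult_ac)
  also have "\<dots> \<le> 4 * pi * \<kappa> * C * exp (- ?t)"
    using C \<kappa> by (intro mult_right_mono mult_left_mono) auto
  finally have d: "cmod (beta_coeff_deriv \<kappa> (Im z)) \<le> 4 * pi * \<kappa> * C * exp (- ?t)" .
  have "cmod (beta_term \<kappa> z) \<le> C * exp (- ?t) * cmod (qpow z (- \<kappa>))"
    unfolding beta_term_def norm_mult using b by (intro mult_right_mono) auto
  also have "\<dots> \<le> C * exp (- (2 * pi * y * \<kappa>))"
    using mult_left_mono[OF e C(2)] by (simp add: mult.assoc)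
  finally show "cmod (beta_term \<kappa> z) \<le> C * exp (- (2 * pi * y * \<kappa>))" .
  have "cmod (- \<i> / 2 * beta_coeff_deriv \<kappa> (Im z) - 2 * of_real pi * \<i> * of_real \<kappa> * beta (24 * \<kappa> * Im z)) \<le>
      cmod (beta_coeff_deriv \<kappa> (Im z)) / 2 + 2 * pi * \<kappa> * cmod (beta (24 * \<kappa> * Im z))"
    using \<kappa> by (intro order_trans[OF norm_triangle_ineq4]) (simp add: norm_mult norm_divide)
  also have "\<dots> \<le> 4 * pi * \<kappa> * C * exp (- ?t) / 2 + 2 * pi * \<kappa> * (C * exp (- ?t))"
    using b d \<kappa> by (intro add_mono mult_left_mono divide_right_mono) auto
  also have "\<dots> = 4 * pi * \<kappa> * C * exp (- ?t)" by simp
  finally have "cmod (beta_term_dz \<kappa> z) \<le> 4 * pi * \<kappa> * C * exp (- ?t) * cmod (qpow z (- \<kappa>))"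
    unfolding beta_term_dz_def norm_mult by (intro mult_right_mono) auto
  moreover have "cmod (beta_term_dzbar \<kappa> z) \<le> 4 * pi * \<kappa> * C * exp (- ?t) * cmod (qpow z (- \<kappa>))"
  proof -
    have "cmod (\<i> / 2 * beta_coeff_deriv \<kappa> (Im z)) \<le> cmod (beta_coeff_deriv \<kappa> (Im z))"
      by (simp add: norm_mult norm_divide)
    also note d
    finally show ?thesis
      unfolding beta_term_dzbar_alt norm_mult[of _ "qpow z (- \<kappa>)"] by (intro mult_right_mono) auto
  qed
  moreover have "4 * pi * \<kappa> * C * exp (- ?t) * cmod (qpow z (- \<kappa>)) \<le> 4 * pi * C * (\<kappa> * exp (- (2 * pi * y * \<kappa>)))"
    using mult_left_mono[OF e, of "4 * pi * \<kappa> * C"] \<kappa> C by (simp add: mult_ac)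
  ultimately show "cmod (beta_term_dz \<kappa> z) \<le> 4 * pi * C * (\<kappa> * exp (- (2 * pi * y * \<kappa>)))"
    "cmod (beta_term_dzbar \<kappa> z) \<le> 4 * pi * C * (\<kappa> * exp (- (2 * pi * y * \<kappa>)))"
    by linarith+
qed

lemma beta_term_series_bounds:
  assumes a: "subexponential a" and r: "0 < r" and y: "0 < y"
  shows "\<exists>M. summable M \<and> (\<forall>j z. y \<le> Im z \<longrightarrow>
    cmod (a j * beta_term (real j + r) z) \<le> M j \<and>
    cmod (a j * beta_term_dz (real j + r) z) \<le> M j \<and>
    cmod (a j * beta_term_dzbar (real j + r) z) \<le> M j)"
proof -
  define C where "C = (4 * pi * r * y) powr (- 5 / 2)"
  define e where "e j = exp (- (2 * pi * y * (real j + r)))" for j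
  define M where "M j = C * (cmod (a j) * e j) + 4 * pi * C * (cmod (a j) * ((real j + r) * e j))" for j
  have nonneg: "0 \<le> C" "0 \<le> e j" "0 \<le> real j + r" for j
    using r by (auto simp: C_def e_def)
  show ?thesis
  proof (intro exI[of _ M] conjI allI impI)
    show "summable M"
      unfolding M_def e_def using y r
      by (intro summable_add summable_mult subexponential_summable subexponential_summable' a) auto
  next
    fix j z assume z: "y \<le> Im z"
    note b = beta_term_bounds[OF r, of "real j + r" y z, folded C_def]
    have "cmod (a j * beta_term (real j + r) z) \<le> cmod (a j) * (C * e j)"
      unfolding norm_mult e_def using b(1) y z by (intro mult_left_mono) auto
    also have "\<dots> \<le> M j"
      using nonneg(1) nonneg(2,3)[of j] by (simp add: M_def mult_ac)
    finally show "cmod (a j * beta_term (real j + r) z) \<le> M j" .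
    have le: "cmod (a j) * (4 * pi * C * ((real j + r) * e j)) \<le> M j"
      using nonneg(1) nonneg(2,3)[of j] by (simp add: M_def mult_ac)
    have "cmod (a j * beta_term_dz (real j + r) z) \<le> cmod (a j) * (4 * pi * C * ((real j + r) * e j))"
      unfolding norm_mult[of "a j"] e_def using b(2) y z by (intro mult_left_mono) auto
    also note le
    finally show "cmod (a j * beta_term_dz (real j + r) z) \<le> M j" .
    have "cmod (a j * beta_term_dzbar (real j + r) z) \<le> cmod (a j) * (4 * pi * C * ((real j + r) * e j))"
      unfolding norm_mult[of "a j"] e_def using b(3) y z by (intro mult_left_mono) auto
    also note le
    finally show "cmod (a j * beta_term_dzbar (real j + r) z) \<le> M j" .
  qed
qed

section \<open>Series of nonholomorphic terms\<close>

definition beta_series :: "(nat \<Rightarrow> complex) \<Rightarrow> real \<Rightarrow> complex \<Rightarrow> complex" where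
  "beta_series a r z = (\<Sum>j. a j * beta_term (real j + r) z)"

definition beta_series_dz :: "(nat \<Rightarrow> complex) \<Rightarrow> real \<Rightarrow> complex \<Rightarrow> complex" where
  "beta_series_dz a r z = (\<Sum>j. a j * beta_term_dz (real j + r) z)"

text \<open>The coefficients of the holomorphic \<open>q\<close>-series whose conjugate is, up to a factor,
  the \<open>\<bar>z\<close>-derivative of \<open>beta_series a r\<close>.\<close>

definition shadow_coeff :: "(nat \<Rightarrow> complex) \<Rightarrow> real \<Rightarrow> nat \<Rightarrow> complex" where
  "shadow_coeff a r j = - cnj (a j) * of_real ((4 * pi * (real j + r)) powr (- 3 / 2))"

lemma subexponential_shadow_coeff:
  assumes a: "subexponential a" and r: "0 < r"
  shows "subexponential (shadow_coeff a r)"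
proof (rule subexponential_mult_bounded[OF a])
  show "cmod (shadow_coeff a r j) \<le> (4 * pi * r) powr (- 3 / 2) * cmod (a j)" for j
  proof -
    have "(4 * pi * (real j + r)) powr (- 3 / 2) \<le> (4 * pi * r) powr (- 3 / 2)"
      using r by (intro powr_mono2') auto
    then have "cmod (a j) * (4 * pi * (real j + r)) powr (- 3 / 2) \<le> cmod (a j) * (4 * pi * r) powr (- 3 / 2)"
      by (intro mult_left_mono) auto
    then show ?thesis by (simp add: shadow_coeff_def norm_mult mult.commute)
  qed
qed

lemma beta_series_dzbar:
  assumes a: "subexponential a" and r: "0 < r" and z: "z \<in> uhp"
  shows "(\<Sum>j. a j * beta_term_dzbar (real j + r) z) =
    \<i> / 2 * of_real (Im z powr (- 5 / 2)) * cnj (\<Sum>j. shadow_coeff a r j * qpow z (real j + r))"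
proof -
  have sm: "summable (\<lambda>j. shadow_coeff a r j * qpow z (real j + r))"
    by (intro qseries_summable subexponential_shadow_coeff a r z)
  have "a j * beta_term_dzbar (real j + r) z =
      \<i> / 2 * of_real (Im z powr (- 5 / 2)) * cnj (shadow_coeff a r j * qpow z (real j + r))" for j
    using r by (simp add: beta_term_dzbar_def beta_const_pos shadow_coeff_def)
  moreover have "(\<lambda>j. cnj (shadow_coeff a r j * qpow z (real j + r))) sums
      cnj (\<Sum>j. shadow_coeff a r j * qpow z (real j + r))"
    using bounded_linear.sums[OF bounded_linear_cnj summable_sums[OF sm]] .
  ultimately show ?thesis
    by (simp only: sums_mult sums_unique[symmetric])
qed

lemma beta_series_summable:
  assumes a: "subexponential a" and r: "0 < r" and z: "z \<in> uhp"
  shows "summable (\<lambda>j. a j * beta_term (real j + r) z)"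
proof -
  define y where "y = Im z"
  have y: "0 < y" using z by (simp add: y_def mem_uhp_iff)
  obtain M where M: "summable M"
      "\<And>j z. y \<le> Im z \<Longrightarrow> cmod (a j * beta_term (real j + r) z) \<le> M j"
      "\<And>j z. y \<le> Im z \<Longrightarrow> cmod (a j * beta_term_dz (real j + r) z) \<le> M j"
      "\<And>j z. y \<le> Im z \<Longrightarrow> cmod (a j * beta_term_dzbar (real j + r) z) \<le> M j"
    using beta_term_series_bounds[OF a r y] by blast
  show ?thesis
    by (rule summable_comparison_test'[OF M(1) M(2)]) (simp add: y_def)
qed

text \<open>Boundedness near the cusp is all that is asked of the nonholomorphic part, since it will
  be multiplied by a function tending to 0.\<close>

lemma beta_series_bounded:
  assumes a: "subexponential a" and r: "0 < r"
  obtains B where "\<And>z. 1 \<le> Im z \<Longrightarrow> cmod (beta_series a r z) \<le> B"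
proof -
  obtain M where M: "summable M"
      "\<And>j z. 1 \<le> Im z \<Longrightarrow> cmod (a j * beta_term (real j + r) z) \<le> M j"
      "\<And>j z. 1 \<le> Im z \<Longrightarrow> cmod (a j * beta_term_dz (real j + r) z) \<le> M j"
      "\<And>j z. 1 \<le> Im z \<Longrightarrow> cmod (a j * beta_term_dzbar (real j + r) z) \<le> M j"
    using beta_term_series_bounds[OF a r zero_less_one] by blast
  show thesis
  proof (rule that)
    show "cmod (beta_series a r z) \<le> suminf M" if "1 \<le> Im z" for z
      unfolding beta_series_def by (rule norm_suminf_le[OF M(2)[OF that] M(1)])
  qed
qed

lemma continuous_on_beta_series_dz:
  assumes a: "subexponential a" and r: "0 < r"
  shows "continuous_on uhp (beta_series_dz a r)"
proof (rule continuous_at_imp_continuous_on, rule ballI)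
  fix z assume z: "z \<in> uhp"
  define y where "y = Im z / 2"
  have y: "0 < y" "y < Im z" using z by (auto simp: y_def mem_uhp_iff)
  let ?U = "{w. y < Im w}"
  have U: "?U \<subseteq> uhp" using y by (auto simp: mem_uhp_iff)
  obtain M where M: "summable M"
      "\<And>j z. y \<le> Im z \<Longrightarrow> cmod (a j * beta_term (real j + r) z) \<le> M j"
      "\<And>j z. y \<le> Im z \<Longrightarrow> cmod (a j * beta_term_dz (real j + r) z) \<le> M j"
      "\<And>j z. y \<le> Im z \<Longrightarrow> cmod (a j * beta_term_dzbar (real j + r) z) \<le> M j"
    using beta_term_series_bounds[OF a r y(1)] by blast
  have "continuous_on ?U (\<lambda>z. \<Sum>j. a j * beta_term_dz (real j + r) z)"
  proof (rule uniform_limit_theorem)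
    show "uniform_limit ?U (\<lambda>n z. \<Sum>j<n. a j * beta_term_dz (real j + r) z)
        (\<lambda>z. \<Sum>j. a j * beta_term_dz (real j + r) z) sequentially"
      using M by (intro Weierstrass_m_test[where M = M]) auto
    show "\<forall>\<^sub>F n in sequentially. continuous_on ?U (\<lambda>z. \<Sum>j<n. a j * beta_term_dz (real j + r) z)"
      using r by (intro always_eventually allI continuous_intros
        continuous_on_subset[OF continuous_on_beta_term(2) U]) auto
  qed simp
  moreover have "open ?U" by (rule open_halfspace_Im_gt)
  ultimately show "isCont (beta_series_dz a r) z"
    unfolding beta_series_dz_def[abs_def] using y by (simp add: continuous_on_eq_continuous_at)
qed

text \<open>Termwise differentiation in the real sense: on a half plane above a positive height,
  which is convex and open, both series of Wirtinger derivatives converge uniformly.\<close>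

lemma beta_series_has_derivative:
  assumes a: "subexponential a" and r: "0 < r" and z: "z \<in> uhp"
  shows "(beta_series a r has_derivative (\<lambda>v. beta_series_dz a r z * v +
    \<i> / 2 * of_real (Im z powr (- 5 / 2)) * cnj (\<Sum>j. shadow_coeff a r j * qpow z (real j + r)) * cnj v)) (at z)"
proof -
  define y where "y = Im z / 2"
  have y: "0 < y" "y < Im z" using z by (auto simp: y_def mem_uhp_iff)
  let ?U = "{w. y < Im w}"
  have U: "?U \<subseteq> uhp" using y by (auto simp: mem_uhp_iff)
  have open_U: "open ?U" by (rule open_halfspace_Im_gt)
  define p where "p j z = a j * beta_term_dz (real j + r) z" for j z
  define q where "q j z = a j * beta_term_dzbar (real j + r) z" for j z
  obtain M where M: "summable M"
      "\<And>j z. y \<le> Im z \<Longrightarrow> cmod (a j * beta_term (real j + r) z) \<le> M j"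
      "\<And>j z. y \<le> Im z \<Longrightarrow> cmod (a j * beta_term_dz (real j + r) z) \<le> M j"
      "\<And>j z. y \<le> Im z \<Longrightarrow> cmod (a j * beta_term_dzbar (real j + r) z) \<le> M j"
    using beta_term_series_bounds[OF a r y(1)] by blast
  note M = M(1) M(3,4)[folded p_def q_def]
  have "uniform_limit ?U (\<lambda>n z. \<Sum>j<n. p j z) (\<lambda>z. \<Sum>j. p j z) sequentially"
    "uniform_limit ?U (\<lambda>n z. \<Sum>j<n. q j z) (\<lambda>z. \<Sum>j. q j z) sequentially"
    using M by (intro Weierstrass_m_test[where M = M]; auto)+
  note lim = this
  have "\<exists>g. \<forall>z\<in>?U. (\<lambda>j. a j * beta_term (real j + r) z) sums g z \<and>
      (g has_derivative (\<lambda>v. (\<Sum>j. p j z) * v + (\<Sum>j. q j z) * cnj v)) (at z within ?U)"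
  proof (rule has_derivative_series)
    show "convex ?U" by (rule convex_halfspace_Im_gt)
    show "((\<lambda>z. a j * beta_term (real j + r) z) has_derivative (\<lambda>v. p j z * v + q j z * cnj v)) (at z within ?U)"
      if "z \<in> ?U" for j z
    proof -
      have "((\<lambda>z. a j * beta_term (real j + r) z) has_derivative
          (\<lambda>v. a j * (beta_term_dz (real j + r) z * v + beta_term_dzbar (real j + r) z * cnj v))) (at z)"
        using that U r by (intro has_derivative_mult_right beta_term_has_derivative) auto
      from has_derivative_at_withinI[OF this] show ?thesis
        by (rule has_derivative_eq_rhs) (simp add: p_def q_def fun_eq_iff ring_distribs mult.assoc)
    qed
    \<comment> \<open>The operator norm of v to P v + Q \<open>cnj v\<close> is at most the sum of
      the moduli of P and Q, so an error of e/2 in each series suffices.\<close>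
    show "\<forall>\<^sub>F n in sequentially. \<forall>z\<in>?U. \<forall>v. cmod ((\<Sum>j<n. p j z * v + q j z * cnj v) -
        ((\<Sum>j. p j z) * v + (\<Sum>j. q j z) * cnj v)) \<le> e * cmod v" if "0 < e" for e
      using uniform_limitD[OF lim(1) half_gt_zero[OF that]] uniform_limitD[OF lim(2) half_gt_zero[OF that]]
    proof (eventually_elim, intro ballI allI)
      fix n z v
      assume 1: "\<forall>z\<in>?U. dist (\<Sum>j<n. p j z) (\<Sum>j. p j z) < e / 2"
        and 2: "\<forall>z\<in>?U. dist (\<Sum>j<n. q j z) (\<Sum>j. q j z) < e / 2" and z: "z \<in> ?U"
      have "(\<Sum>j<n. p j z * v + q j z * cnj v) - ((\<Sum>j. p j z) * v + (\<Sum>j. q j z) * cnj v) =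
          ((\<Sum>j<n. p j z) - (\<Sum>j. p j z)) * v + ((\<Sum>j<n. q j z) - (\<Sum>j. q j z)) * cnj v"
        by (simp add: sum.distrib sum_distrib_left sum_distrib_right algebra_simps)
      also have "cmod \<dots> \<le> e / 2 * cmod v + e / 2 * cmod (cnj v)"
      proof (intro order_trans[OF norm_triangle_ineq] add_mono)
        show "cmod (((\<Sum>j<n. p j z) - (\<Sum>j. p j z)) * v) \<le> e / 2 * cmod v"
          unfolding norm_mult using 1 z by (intro mult_right_mono) (auto simp: dist_norm intro: less_imp_le)
        show "cmod (((\<Sum>j<n. q j z) - (\<Sum>j. q j z)) * cnj v) \<le> e / 2 * cmod (cnj v)"
          unfolding norm_mult using 2 z by (intro mult_right_mono) (auto simp: dist_norm intro: less_imp_le)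
      qed
      finally show "cmod ((\<Sum>j<n. p j z * v + q j z * cnj v) -
        ((\<Sum>j. p j z) * v + (\<Sum>j. q j z) * cnj v)) \<le> e * cmod v" by simp
    qed
    show "z \<in> ?U" using y by simp
    show "(\<lambda>j. a j * beta_term (real j + r) z) sums (\<Sum>j. a j * beta_term (real j + r) z)"
      by (intro summable_sums beta_series_summable a r z)
  qed
  then obtain g where g: "\<And>z. z \<in> ?U \<Longrightarrow> (\<lambda>j. a j * beta_term (real j + r) z) sums g z"
    "\<And>z. z \<in> ?U \<Longrightarrow> (g has_derivative (\<lambda>v. (\<Sum>j. p j z) * v + (\<Sum>j. q j z) * cnj v)) (at z within ?U)"
    by blast
  have "(g has_derivative (\<lambda>v. (\<Sum>j. p j z) * v + (\<Sum>j. q j z) * cnj v)) (at z)"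
    using g(2)[of z] y open_U by (simp add: at_within_open[of z ?U])
  then have "(beta_series a r has_derivative (\<lambda>v. (\<Sum>j. p j z) * v + (\<Sum>j. q j z) * cnj v)) (at z)"
  proof (rule has_derivative_transform_within_open[OF _ open_U])
    show "g w = beta_series a r w" if "w \<in> ?U" for w
      using g(1)[OF that] by (simp add: beta_series_def sums_iff)
  qed (use y in auto)
  then show ?thesis
    using beta_series_dzbar[OF a r z] unfolding p_def q_def beta_series_dz_def by simp
qed

text \<open>As 0 < c < 24, the positive members of the class are exactly 24 j + c with j \<ge> 0.
  Unordered sums over them thus become ordinary series.\<close>

lemma residue_class_sums:
  fixes f :: "int \<Rightarrow> complex" and c :: int
  assumes c: "0 < c" "c < 24" and f: "f summable_on {n. 0 < n \<and> n mod 24 = c}"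
  shows "(\<lambda>j. f (24 * int j + c)) sums (\<Sum>\<^sub>\<infinity>n | 0 < n \<and> n mod 24 = c. f n)"
proof -
  have bij: "bij_betw (\<lambda>j. 24 * int j + c) UNIV {n. 0 < n \<and> n mod 24 = c}"
  proof (rule bij_betwI')
    fix n assume n: "n \<in> {n. 0 < n \<and> n mod 24 = c}"
    then have "0 \<le> n div 24" by (simp add: pos_imp_zdiv_nonneg_iff)
    then have "int (nat (n div 24)) = n div 24" by simp
    moreover have "n mod 24 = c" using n by simp
    ultimately have "n = 24 * int (nat (n div 24)) + c" using mult_div_mod_eq[of 24 n] by linarith
    then show "\<exists>j\<in>UNIV. n = 24 * int j + c" by blast
  qed (use c in auto)
  have "(\<lambda>j. f (24 * int j + c)) summable_on UNIV"
    using f summable_on_reindex_bij_betw[OF bij, of f] by simp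
  then have "((\<lambda>j. f (24 * int j + c)) has_sum (\<Sum>\<^sub>\<infinity>j. f (24 * int j + c))) UNIV"
    by (rule has_sum_infsum)
  then show ?thesis
    using infsum_reindex_bij_betw[OF bij, of f] has_sum_imp_sums by metis
qed

subsection \<open>Horizontal integrals\<close>

lemma sums_integral_uniform:
  fixes f :: "nat \<Rightarrow> real \<Rightarrow> complex"
  assumes f: "\<And>j. continuous_on {a..b} (f j)" and M: "summable M"
    and le: "\<And>j x. x \<in> {a..b} \<Longrightarrow> cmod (f j x) \<le> M j"
  shows "(\<lambda>j. integral {a..b} (f j)) sums integral {a..b} (\<lambda>x. \<Sum>j. f j x)"
proof -
  have "uniform_limit {a..b} (\<lambda>n x. \<Sum>j<n. f j x) (\<lambda>x. \<Sum>j. f j x) sequentially"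
    using M le by (intro Weierstrass_m_test) auto
  then obtain I J where I: "\<And>n. ((\<lambda>x. \<Sum>j<n. f j x) has_integral I n) {a..b}"
    and J: "((\<lambda>x. \<Sum>j. f j x) has_integral J) {a..b}" and lim: "I \<longlonglongrightarrow> J"
    by (rule uniform_limit_integral) (auto intro!: continuous_intros f)
  have "((\<lambda>x. \<Sum>j<n. f j x) has_integral (\<Sum>j<n. integral {a..b} (f j))) {a..b}" for n
    by (intro has_integral_sum integrable_integral integrable_continuous_interval f) auto
  then have "I = (\<lambda>n. \<Sum>j<n. integral {a..b} (f j))"
    using I has_integral_unique by blast
  then show ?thesis using lim integral_unique[OF J] by (simp add: sums_def)
qed

lemma integral_qpow:
  "integral {-1/2..1/2} (\<lambda>x. qpow (Complex x y) (of_int k)) = (if k = 0 then 1 else 0)"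
proof (cases "k = 0")
  case False
  let ?c = "2 * of_real pi * \<i> * of_int k :: complex"
  have c: "?c \<noteq> 0" using False by simp
  have "((\<lambda>x. qpow (Complex x y) (of_int k)) has_integral
      (qpow (Complex (1/2) y) (of_int k) / ?c - qpow (Complex (-1/2) y) (of_int k) / ?c)) {-1/2..1/2}"
  proof (rule fundamental_theorem_of_calculus)
    fix x :: real
    have "((\<lambda>x. Complex x y) has_vector_derivative 1) (at x within {-1/2..1/2})"
      unfolding Complex_eq by (auto intro!: derivative_eq_intros)
    moreover have "((\<lambda>z. qpow z (of_int k) / ?c) has_field_derivative qpow (Complex x y) (of_int k)) (at (Complex x y))"
      using DERIV_cdivide[OF qpow_has_field_derivative[of "of_int k" "Complex x y"], of ?c] c by simp
    ultimately have "((\<lambda>z. qpow z (of_int k) / ?c) \<circ> (\<lambda>x. Complex x y) has_vector_derivative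
        1 * qpow (Complex x y) (of_int k)) (at x within {-1/2..1/2})"
      by (rule field_vector_diff_chain_within[OF _ has_field_derivative_at_within])
    then show "((\<lambda>x. qpow (Complex x y) (of_int k) / ?c) has_vector_derivative qpow (Complex x y) (of_int k))
        (at x within {-1/2..1/2})" by (simp add: o_def)
  qed simp
  moreover have "Complex (1/2) y = Complex (-1/2) y + 1" by (simp add: complex_eq_iff)
  ultimately show ?thesis using False by (simp only: qpow_plus_1_of_int) (simp add: integral_unique)
qed (simp add: qpow_0)

lemma continuous_on_horizontal:
  assumes "continuous_on uhp f" and "0 < y"
  shows "continuous_on S (\<lambda>x. f (Complex x y))"
  unfolding Complex_eq
  by (intro continuous_on_compose2[OF assms(1)] continuous_intros) (use assms(2) in \<open>auto simp: mem_uhp_iff\<close>)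

text \<open>By Cauchy's theorem the integral does not depend on the height.\<close>

lemma integral_periodic_holomorphic_eq_0:
  assumes hol: "f holomorphic_on uhp" and per: "\<And>z. z \<in> uhp \<Longrightarrow> f (z + 1) = f z"
    and lim: "(f \<longlongrightarrow> 0) (filtercomap Im at_top)" and Y: "0 < Y"
  shows "integral {-1/2..1/2} (\<lambda>x. f (Complex x Y)) = 0"
proof (rule ccontr)
  let ?I = "{-1/2..1/2::real}"
  let ?J = "\<lambda>y. integral ?I (\<lambda>x. f (Complex x y))"
  assume "?J Y \<noteq> 0"
  have cont: "continuous_on uhp f" "continuous_on uhp (deriv f)"
    using hol holomorphic_deriv[OF hol open_uhp] holomorphic_on_imp_continuous_on by auto
  \<comment> \<open>The integral of \<i> f' over the rectangle is taken in both orders: vertically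
    first it gives the difference of the two means, horizontally first it vanishes by
    periodicity.\<close>
  have const: "?J y = ?J Y" if y: "Y \<le> y" for y
  proof -
    have C: "continuous_on (cbox (-1/2, Y) (1/2, y)) (\<lambda>(x, t). \<i> * deriv f (Complex x t))"
      unfolding case_prod_unfold Complex_eq
      by (intro continuous_intros continuous_on_compose2[OF cont(2)]) (use Y in \<open>auto simp: mem_uhp_iff cbox_Pair_eq\<close>)
    have vert: "((\<lambda>t. \<i> * deriv f (Complex x t)) has_integral (f (Complex x y) - f (Complex x Y))) {Y..y}" for x
    proof (rule fundamental_theorem_of_calculus[OF y])
      fix t assume t: "t \<in> {Y..y}"
      have "((\<lambda>t. Complex x t) has_vector_derivative \<i>) (at t within {Y..y})"
        unfolding Complex_eq by (auto intro!: derivative_eq_intros)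
      moreover have "(f has_field_derivative deriv f (Complex x t)) (at (Complex x t))"
        using t Y by (intro holomorphic_derivI[OF hol open_uhp]) (auto simp: mem_uhp_iff)
      ultimately have "(f \<circ> (\<lambda>t. Complex x t) has_vector_derivative \<i> * deriv f (Complex x t)) (at t within {Y..y})"
        by (rule field_vector_diff_chain_within[OF _ has_field_derivative_at_within])
      then show "((\<lambda>t. f (Complex x t)) has_vector_derivative \<i> * deriv f (Complex x t)) (at t within {Y..y})"
        by (simp add: o_def)
    qed
    have hor: "((\<lambda>x. \<i> * deriv f (Complex x t)) has_integral
        (\<i> * f (Complex (1/2) t) - \<i> * f (Complex (-1/2) t))) ?I" if t: "t \<in> {Y..y}" for t
    proof (rule fundamental_theorem_of_calculus)
      fix x :: real
      have "((\<lambda>x. Complex x t) has_vector_derivative 1) (at x within ?I)"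
        unfolding Complex_eq by (auto intro!: derivative_eq_intros)
      moreover have "(f has_field_derivative deriv f (Complex x t)) (at (Complex x t))"
        using t Y by (intro holomorphic_derivI[OF hol open_uhp]) (auto simp: mem_uhp_iff)
      ultimately have "(f \<circ> (\<lambda>x. Complex x t) has_vector_derivative 1 * deriv f (Complex x t)) (at x within ?I)"
        by (rule field_vector_diff_chain_within[OF _ has_field_derivative_at_within])
      then show "((\<lambda>x. \<i> * f (Complex x t)) has_vector_derivative \<i> * deriv f (Complex x t)) (at x within ?I)"
        by (auto simp: o_def intro: has_vector_derivative_mult_right)
    qed simp
    have hor0: "integral ?I (\<lambda>x. \<i> * deriv f (Complex x t)) = 0" if t: "t \<in> {Y..y}" for t
    proof -
      have "Complex (1/2) t = Complex (-1/2) t + 1" by (simp add: complex_eq_iff)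
      moreover have "Complex (-1/2) t \<in> uhp" using t Y by (simp add: mem_uhp_iff)
      ultimately have "f (Complex (1/2) t) = f (Complex (-1/2) t)" using per by metis
      then show ?thesis using integral_unique[OF hor[OF t]] by simp
    qed
    have "?J y - ?J Y = integral ?I (\<lambda>x. f (Complex x y) - f (Complex x Y))"
      using y Y by (intro integral_diff[symmetric] integrable_continuous_interval continuous_on_horizontal cont(1)) auto
    also have "\<dots> = integral ?I (\<lambda>x. integral {Y..y} (\<lambda>t. \<i> * deriv f (Complex x t)))"
      by (intro integral_cong) (rule integral_unique[OF vert, symmetric])
    also have "\<dots> = integral {Y..y} (\<lambda>t. integral ?I (\<lambda>x. \<i> * deriv f (Complex x t)))"
      using integral_swap_continuous[OF C] by simp
    also have "\<dots> = integral {Y..y} (\<lambda>t. 0)"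
      using hor0 by (intro integral_cong)
    finally show ?thesis by simp
  qed
  have "\<forall>\<^sub>F z in filtercomap Im at_top. cmod (f z) < cmod (?J Y) / 2"
    using tendstoD[OF lim half_gt_zero] \<open>?J Y \<noteq> 0\<close> by simp
  then obtain Y' where Y': "\<And>z. Y' \<le> Im z \<Longrightarrow> cmod (f z) < cmod (?J Y) / 2"
    by (auto simp: eventually_Im_at_top)
  define y where "y = max Y Y'"
  have "continuous_on ?I (\<lambda>x. f (Complex x y))"
    using Y by (intro continuous_on_horizontal cont(1)) (simp add: y_def)
  moreover have "cmod (f (Complex x y)) \<le> cmod (?J Y) / 2" for x
    using Y'[of "Complex x y"] by (simp add: y_def)
  ultimately have "cmod (?J y) \<le> cmod (?J Y) / 2 * (1/2 - (-1/2))"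
    by (intro integral_bound) auto
  then show False using const[of y] \<open>?J Y \<noteq> 0\<close> by (simp add: y_def)
qed

lemma tendsto_integral_horizontal_0:
  fixes f :: "complex \<Rightarrow> complex"
  assumes lim: "(f \<longlongrightarrow> 0) (filtercomap Im at_top)" and f: "continuous_on uhp f"
  shows "((\<lambda>Y. integral {-1/2..1/2} (\<lambda>x. f (Complex x Y))) \<longlongrightarrow> 0) at_top"
proof (rule tendstoI)
  fix e :: real assume "0 < e"
  then have "\<forall>\<^sub>F z in filtercomap Im at_top. cmod (f z) < e / 2"
    using tendstoD[OF lim half_gt_zero] by simp
  then obtain Y' where Y': "\<And>z. Y' \<le> Im z \<Longrightarrow> cmod (f z) < e / 2"
    by (auto simp: eventually_Im_at_top)
  show "\<forall>\<^sub>F Y in at_top. dist (integral {-1/2..1/2} (\<lambda>x. f (Complex x Y))) 0 < e"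
    using eventually_ge_at_top[of Y'] eventually_gt_at_top[of 0]
  proof eventually_elim
    case (elim Y)
    have "cmod (integral {-1/2..1/2} (\<lambda>x. f (Complex x Y))) \<le> e / 2 * (1/2 - (-1/2))"
      using Y' elim by (intro integral_bound continuous_on_horizontal f) (auto intro!: less_imp_le)
    then show ?case using \<open>0 < e\<close> by simp
  qed
qed

subsection \<open>The forms of weight \<open>-1/2\<close>\<close>

lemma filtercomap_Im_at_top_neq_bot: "filtercomap Im at_top \<noteq> bot"
  by (intro filtercomap_neq_bot_surj surjI[of _ "\<lambda>y. Complex 0 y"]) auto

lemma filterlim_Im_at_top_self:
  assumes "\<And>z. Im (f z) = Im z"
  shows "filterlim f (filtercomap Im at_top) (filtercomap Im at_top)"
  unfolding filterlim_iff eventually_Im_at_top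
proof (intro allI impI, elim exE)
  fix P Y assume "\<forall>z. Y \<le> Im z \<longrightarrow> P z"
  then have "\<forall>z. Y \<le> Im z \<longrightarrow> P (f z)" using assms by simp
  then show "\<exists>Y. \<forall>z. Y \<le> Im z \<longrightarrow> P (f z)" by blast
qed

lemma modular_transform_T:
  assumes "modular_transform k \<nu> f" "z \<in> uhp"
  shows "f (z + 1) = \<nu> 1 1 0 1 * f z"
proof -
  have "f (moebius 1 1 0 1 z) = \<nu> 1 1 0 1 * (of_int 0 * z + of_int 1) powr (of_real k) * f z"
    using assms unfolding modular_transform_def by (metis mult_1 mult_zero_right diff_zero)
  then show ?thesis by (simp add: moebius_def)
qed

lemma modular_transform_S:
  assumes "modular_transform k \<nu> f" "z \<in> uhp"
  shows "f (- 1 / z) = \<nu> 0 (-1) 1 0 * z powr (of_real k) * f z"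
proof -
  have "f (moebius 0 (-1) 1 0 z) = \<nu> 0 (-1) 1 0 * (of_int 1 * z + of_int 0) powr (of_real k) * f z"
    using assms(1)[unfolded modular_transform_def, rule_format, of 0 0 "-1" 1 z] assms(2) by simp
  then show ?thesis by (simp add: moebius_def)
qed

section \<open>Branches of half-integral powers\<close>

lemma Ln_uhp:
  assumes "z \<in> uhp"
  shows "Ln (- 1 / z) = \<i> * of_real pi - Ln z" and "Ln (- cnj z) = \<i> * of_real pi + cnj (Ln z)"
proof -
  have "z \<noteq> 0" using assms by (auto simp: mem_uhp_iff)
  then have z: "z \<noteq> 0" "0 < Im (Ln z)" "Im (Ln z) < pi"
    using assms Im_Ln_pos_lt[of z] by (auto simp: mem_uhp_iff)
  show "Ln (- 1 / z) = \<i> * of_real pi - Ln z"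
    by (rule Ln_unique) (use z in \<open>auto simp: exp_diff exp_add exp_pi_i' mult.commute\<close>)
  show "Ln (- cnj z) = \<i> * of_real pi + cnj (Ln z)"
    by (rule Ln_unique) (use z in \<open>auto simp: exp_add exp_cnj[symmetric] exp_pi_i'\<close>)
qed

lemma exp_pi_half: "exp (\<i> * of_real pi / 2) = \<i>"
  using cis_pi_half by (simp add: cis_conv_exp)

text \<open>The arguments of z and -1/z both lie in (0, pi) and add up to pi, so the product is
  exp(-\<i> pi/2) on the principal branch.\<close>

lemma powr_half_inversion:
  assumes "z \<in> uhp"
  shows "(- 1 / z) powr (- 1 / 2) * z powr (- 1 / 2) = - \<i>"
proof -
  have "z \<noteq> 0" using assms by (auto simp: mem_uhp_iff)
  have "(- 1 / z) powr (- 1 / 2) * z powr (- 1 / 2) = exp (- 1 / 2 * Ln (- 1 / z) + - 1 / 2 * Ln z)"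
    using \<open>z \<noteq> 0\<close> by (simp only: powr_def exp_add) simp
  also have "\<dots> = exp (- (\<i> * of_real pi / 2))"
    unfolding Ln_uhp(1)[OF assms] by (rule arg_cong[of _ _ exp]) (simp add: field_simps)
  also have "\<dots> = - \<i>" unfolding exp_minus exp_pi_half by simp
  finally show ?thesis .
qed

lemma powr_half_reflection:
  assumes "z \<in> uhp"
  shows "cnj ((- cnj z) powr (- 1 / 2)) = \<i> * z powr (- 1 / 2)"
proof -
  have "z \<noteq> 0" using assms by (auto simp: mem_uhp_iff)
  have "cnj ((- cnj z) powr (- 1 / 2)) = exp (cnj (- 1 / 2 * Ln (- cnj z)))"
    using \<open>z \<noteq> 0\<close> by (simp add: powr_def exp_cnj)
  also have "cnj (- 1 / 2 * Ln (- cnj z)) = \<i> * of_real pi / 2 + - 1 / 2 * Ln z"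
    unfolding Ln_uhp(2)[OF assms] by (simp add: field_simps)
  finally show ?thesis using \<open>z \<noteq> 0\<close> unfolding exp_add exp_pi_half by (simp add: powr_def)
qed

text \<open>The conjugate of z^(5/2) is |z|^5 z^(-5/2). The factor z^2 will come from the derivative
  of -1/z, so that weight 5/2 turns into weight 2 - 5/2 = -1/2 for the shadow.\<close>

lemma cnj_powr_five_halves:
  assumes "z \<in> uhp"
  shows "cnj (z powr (5 / 2)) * z\<^sup>2 = of_real (cmod z ^ 5) * z powr (- 1 / 2)"
proof -
  have z: "z \<noteq> 0" using assms by (auto simp: mem_uhp_iff)
  have "cmod (z powr (5 / 2)) ^ 2 = cmod z ^ 5"
    using z powr_powr[of "cmod z" "5 / 2" 2] by (simp add: norm_powr_real_powr' flip: powr_numeral)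
  then have 1: "of_real (cmod z ^ 5) = z powr (5 / 2) * cnj (z powr (5 / 2))"
    using complex_norm_square[of "z powr (5 / 2)"] by (simp flip: of_real_power)
  have 2: "z\<^sup>2 = z powr (- 1 / 2) * z powr (5 / 2)"
    using z powr_add[of z "- 1 / 2" "5 / 2"] by simp
  show ?thesis unfolding 1 2 by (simp only: mult_ac)
qed

text \<open>The difference is a cusp form of negative weight. The multipliers enter only through
  \<open>s\<close> and \<open>t\<close>, which disappear on taking absolute values.\<close>

lemma weight_minus_half_unique:
  fixes f g :: "complex \<Rightarrow> complex" and s t :: complex
  assumes hol: "f holomorphic_on uhp" "g holomorphic_on uhp"
    and T: "\<And>z. z \<in> uhp \<Longrightarrow> f (z + 1) = t * f z" "\<And>z. z \<in> uhp \<Longrightarrow> g (z + 1) = t * g z"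
    and S: "\<And>z. z \<in> uhp \<Longrightarrow> f (- 1 / z) = s * z powr (- 1 / 2) * f z"
      "\<And>z. z \<in> uhp \<Longrightarrow> g (- 1 / z) = s * z powr (- 1 / 2) * g z"
    and norm: "cmod s = 1" "cmod t = 1"
    and lim: "((\<lambda>z. f z - g z) \<longlongrightarrow> 0) (filtercomap Im at_top)" and z: "z \<in> uhp"
  shows "f z = g z"
proof -
  have "f z - g z = 0"
  proof (rule negative_weight_cusp_form_eq_0[where f = "\<lambda>z. f z - g z" and k = "1 / 2"])
    show "(\<lambda>z. f z - g z) holomorphic_on uhp" by (intro holomorphic_intros hol)
    fix z assume z: "z \<in> uhp"
    have "f (z + 1) - g (z + 1) = t * (f z - g z)" unfolding T(1)[OF z] T(2)[OF z] by (simp add: algebra_simps)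
    then show "cmod (f (z + 1) - g (z + 1)) = cmod (f z - g z)" using norm by (simp add: norm_mult)
    have "f (- 1 / z) - g (- 1 / z) = s * z powr (- 1 / 2) * (f z - g z)" unfolding S(1)[OF z] S(2)[OF z] by (simp add: algebra_simps)
    then show "cmod (f (- 1 / z) - g (- 1 / z)) = cmod z powr (- (1 / 2)) * cmod (f z - g z)"
      using norm by (simp only: norm_mult) (simp add: norm_powr_real_powr')
  qed (use lim z in auto)
  then show ?thesis by simp
qed

lemma is_g_tendsto:
  assumes "is_g m g"
  shows "((\<lambda>z. g z - qpow z (- of_int m / 24)) \<longlongrightarrow> 0) (filtercomap Im at_top)"
proof -
  have "(\<lambda>z. g z - qpow z (- real_of_int m / 24)) \<in> O[filtercomap Im at_top](\<lambda>z. qpow z (23/24))"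
    using assms by (simp add: is_g_def)
  then obtain c where "\<forall>\<^sub>F z in filtercomap Im at_top. cmod (g z - qpow z (- of_int m / 24)) \<le> c * cmod (qpow z (23/24))"
    by (elim landau_o.bigE)
  then show ?thesis
    by (intro tendsto_0_le[OF tendsto_qpow_0[of "23/24"], where K = c]) (auto simp: mult.commute elim: eventually_mono)
qed

lemma is_g_forms:
  assumes "is_g m g"
  shows "g holomorphic_on uhp"
    and "z \<in> uhp \<Longrightarrow> g (z + 1) = cnj (eta_mult 1 1 0 1) * g z"
    and "z \<in> uhp \<Longrightarrow> g (- 1 / z) = cnj (eta_mult 0 (-1) 1 0) * z powr (- 1 / 2) * g z"
  using assms modular_transform_T[of "-1/2" "\<lambda>a b c d. cnj (eta_mult a b c d)" g z]
    modular_transform_S[of "-1/2" "\<lambda>a b c d. cnj (eta_mult a b c d)" g z]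
  by (auto simp: is_g_def weakly_holomorphic_form_def)

text \<open>The two values of the multiplier system that matter are determined by the
  existence of \<open>g\<^sub>m\<close> alone, so the transformation law of \<open>\<eta>\<close> is not needed.\<close>

lemma is_g_multipliers:
  assumes g: "is_g m g" and m: "0 < m"
  shows "cnj (eta_mult 1 1 0 1) * exp (2 * of_real pi * \<i> * of_real (of_int m / 24)) = 1"
    and "(cnj (eta_mult 0 (-1) 1 0))\<^sup>2 = \<i>"
proof -
  let ?F = "filtercomap Im at_top" and ?r = "real_of_int m / 24"
  let ?t = "cnj (eta_mult 1 1 0 1)" and ?s = "cnj (eta_mult 0 (-1) 1 0)"
  have "((\<lambda>z. (g z - qpow z (- ?r)) * qpow z ?r) \<longlongrightarrow> 0 * 0) ?F"
    using is_g_tendsto[OF g] m by (intro tendsto_mult tendsto_qpow_0) auto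
  moreover have "(g z - qpow z (- ?r)) * qpow z ?r = g z * qpow z ?r - 1" for z
    by (simp only: qpow_minus ring_distribs) (simp add: qpow_nonzero)
  ultimately have lim: "((\<lambda>z. g z * qpow z ?r) \<longlongrightarrow> 1) ?F"
    by (simp add: LIM_zero_iff)
  have uhp: "\<forall>\<^sub>F z in ?F. z \<in> uhp"
    unfolding eventually_Im_at_top mem_uhp_iff by (auto intro: exI[of _ 1])
  \<comment> \<open>Replacing z by z + 1 multiplies the function by \<open>?c\<close> but leaves its
    limit 1 unchanged.\<close>
  let ?c = "?t * exp (2 * of_real pi * \<i> * of_real ?r)"
  have "((\<lambda>z. ?c * (g z * qpow z ?r)) \<longlongrightarrow> ?c * 1) ?F"
    by (intro tendsto_mult lim tendsto_const)
  moreover have "((\<lambda>z. g (z + 1) * qpow (z + 1) ?r) \<longlongrightarrow> 1) ?F"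
    using filterlim_compose[OF lim filterlim_Im_at_top_self[of "\<lambda>z. z + 1"]] by simp
  then have "((\<lambda>z. ?c * (g z * qpow z ?r)) \<longlongrightarrow> 1) ?F"
  proof (rule Lim_transform_eventually)
    show "\<forall>\<^sub>F z in ?F. g (z + 1) * qpow (z + 1) ?r = ?c * (g z * qpow z ?r)"
      using uhp by eventually_elim (simp add: is_g_forms(2)[OF g] qpow_plus_1)
  qed
  ultimately show "?c = 1"
    using tendsto_unique[OF filtercomap_Im_at_top_neq_bot] by fastforce
  have "\<forall>\<^sub>F z in ?F. g z * qpow z ?r \<noteq> 0"
    using lim by (rule tendsto_imp_eventually_ne) simp
  with uhp have "\<forall>\<^sub>F z in ?F. z \<in> uhp \<and> g z \<noteq> 0"
    by eventually_elim auto
  then obtain z where z: "z \<in> uhp" "g z \<noteq> 0"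
    using eventually_happens'[OF filtercomap_Im_at_top_neq_bot] by blast
  \<comment> \<open>Inverting twice leads back to z; where g does not vanish, the product of the two
    automorphy factors must be 1.\<close>
  let ?w = "- 1 / z"
  have w: "?w \<in> uhp" "- 1 / ?w = z" using minus_inverse_mem_uhp[OF z(1)] z(1) by (auto simp: mem_uhp_iff)
  have "g z = ?s * ?w powr (- 1 / 2) * (?s * z powr (- 1 / 2) * g z)"
    using is_g_forms(3)[OF g w(1)] is_g_forms(3)[OF g z(1)] unfolding w(2) by simp
  also have "\<dots> = ?s\<^sup>2 * (?w powr (- 1 / 2) * z powr (- 1 / 2)) * g z"
    by (simp only: power2_eq_square mult_ac)
  also have "\<dots> = - \<i> * ?s\<^sup>2 * g z"
    unfolding powr_half_inversion[OF z(1)] by simp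
  finally have "1 * g z = (- \<i> * ?s\<^sup>2) * g z" by simp
  then have "- \<i> * ?s\<^sup>2 = 1" using mult_right_cancel[OF z(2)] by metis
  then have "\<i> * (- \<i> * ?s\<^sup>2) = \<i> * 1" by (rule arg_cong)
  then show "?s\<^sup>2 = \<i>" by (simp only: mult.assoc[symmetric]) simp
qed

lemma is_g_multipliers_norm:
  assumes g: "is_g m g" and m: "0 < m"
  shows "cmod (eta_mult 1 1 0 1) = 1" "cmod (eta_mult 0 (-1) 1 0) = 1"
proof -
  have "cmod (cnj (eta_mult 1 1 0 1) * exp (2 * of_real pi * \<i> * of_real (of_int m / 24))) = 1"
    using is_g_multipliers(1)[OF assms] by simp
  then show "cmod (eta_mult 1 1 0 1) = 1" by (simp add: norm_mult)
  have "cmod ((cnj (eta_mult 0 (-1) 1 0))\<^sup>2) = 1" using is_g_multipliers(2)[OF assms] by simp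
  then have "cmod (eta_mult 0 (-1) 1 0) = 1 \<or> cmod (eta_mult 0 (-1) 1 0) = - 1"
    by (simp add: norm_power power2_eq_1_iff)
  moreover have "0 \<le> cmod (eta_mult 0 (-1) 1 0)" by simp
  ultimately show "cmod (eta_mult 0 (-1) 1 0) = 1" by linarith
qed

text \<open>Equivalently, the Fourier coefficients of \<open>g\<^sub>m\<close> are real.\<close>

lemma is_g_reflection:
  assumes g: "is_g m g" and m: "0 < m" and z: "z \<in> uhp"
  shows "g (- cnj z) = cnj (g z)"
proof -
  let ?t = "eta_mult 1 1 0 1" and ?s = "eta_mult 0 (-1) 1 0"
  define g' where "g' z = cnj (g (- cnj z))" for z
  have tt: "?t * cnj ?t = 1" and ss: "?s * cnj ?s = 1"
    using is_g_multipliers_norm[OF g m] by (auto simp: complex_norm_square[symmetric])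
  \<comment> \<open>Conjugating the power (- \<open>cnj z\<close>)^(-1/2) produces a factor \<i>;
    this relation absorbs it, so the reflected form has the same multiplier at the inversion as
    \<open>g\<close>.\<close>
  have "cnj ?s = ?s * cnj ?s * cnj ?s" using ss by simp
  also have "\<dots> = \<i> * ?s" using is_g_multipliers(2)[OF g m] by (simp add: power2_eq_square mult_ac)
  finally have s: "cnj ?s = \<i> * ?s" .
  have refl: "- cnj w \<in> uhp" if "w \<in> uhp" for w using that by (simp add: mem_uhp_iff)
  have "g' z = g z"
  proof (rule weight_minus_half_unique[of g' g "cnj ?t" "cnj ?s"])
    have "g \<circ> (\<lambda>w. - w) holomorphic_on (cnj ` uhp)"
      by (rule holomorphic_on_compose_gen[OF _ is_g_forms(1)[OF g]])
        (auto simp: mem_uhp_iff intro!: holomorphic_intros)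
    then have "(\<lambda>w. g (- w)) holomorphic_on (cnj ` uhp)" by (simp add: o_def)
    from holomorphic_on_compose_cnj_cnj[OF this] show "g' holomorphic_on uhp"
      using open_uhp by (simp add: g'_def[abs_def] o_def)
    show "g' (w + 1) = cnj ?t * g' w" if w: "w \<in> uhp" for w
    proof -
      have "- cnj (w + 1) \<in> uhp" using refl w by (simp add: mem_uhp_iff)
      from is_g_forms(2)[OF g this] have "g (- cnj w) = cnj ?t * g (- cnj (w + 1))" by simp
      then have "g' w = ?t * g' (w + 1)" by (simp add: g'_def)
      then have "cnj ?t * g' w = (?t * cnj ?t) * g' (w + 1)" by simp
      then show ?thesis using tt by simp
    qed
    show "g' (- 1 / w) = cnj ?s * w powr (- 1 / 2) * g' w" if w: "w \<in> uhp" for w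
    proof -
      have "g' (- 1 / w) = cnj (g (- 1 / (- cnj w)))" by (simp add: g'_def)
      also have "\<dots> = ?s * cnj ((- cnj w) powr (- 1 / 2)) * g' w"
        unfolding is_g_forms(3)[OF g refl[OF w]] g'_def by simp
      also have "\<dots> = cnj ?s * w powr (- 1 / 2) * g' w"
        unfolding powr_half_reflection[OF w] s by simp
      finally show ?thesis .
    qed
    have "((\<lambda>w. cnj (g (- cnj w) - qpow (- cnj w) (- of_int m / 24))) \<longlongrightarrow> cnj 0) (filtercomap Im at_top)"
      by (intro tendsto_cnj filterlim_compose[OF is_g_tendsto[OF g] filterlim_Im_at_top_self]) simp
    then have "((\<lambda>w. g' w - qpow w (- of_int m / 24)) \<longlongrightarrow> 0) (filtercomap Im at_top)"
      by (simp add: g'_def cnj_qpow)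
    from tendsto_diff[OF this is_g_tendsto[OF g]]
    show "((\<lambda>w. g' w - g w) \<longlongrightarrow> 0) (filtercomap Im at_top)" by simp
  qed (use is_g_forms[OF g] is_g_multipliers_norm[OF g m] z in auto)
  then show ?thesis by (metis complex_cnj_cnj g'_def)
qed

subsection \<open>The form of weight \<open>5/2\<close> and its shadow\<close>

text \<open>The values at 1 and \<i> separate the two coefficients. Applied to both sides of a
  transformation law for h, it extracts the law for the conjugate derivative alone.\<close>

lemma wirtinger_unique:
  fixes f :: "complex \<Rightarrow> complex"
  assumes "(f has_derivative (\<lambda>v. P * v + Q * cnj v)) (at z)"
    and "(f has_derivative (\<lambda>v. P' * v + Q' * cnj v)) (at z)"
  shows "Q = Q'"
proof -
  have eq: "(\<lambda>v. P * v + Q * cnj v) = (\<lambda>v. P' * v + Q' * cnj v)"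
    using assms by (rule has_derivative_unique)
  from fun_cong[OF eq, of 1] have 1: "P + Q = P' + Q'" by simp
  from fun_cong[OF eq, of \<i>] have "\<i> * (P - Q) = \<i> * (P' - Q')" by (simp add: algebra_simps)
  then have 2: "P - Q = P' - Q'" by simp
  have "2 * Q = (P + Q) - (P - Q)" by simp
  also have "\<dots> = 2 * Q'" unfolding 1 2 by simp
  finally show ?thesis by simp
qed

definition h_plus :: "(int \<Rightarrow> complex) \<Rightarrow> complex \<Rightarrow> complex" where
  "h_plus pp z = (\<Sum>j. pp (24 * int j + 1) * qpow z (real j + 1/24))"

definition h_minus :: "(int \<Rightarrow> complex) \<Rightarrow> complex \<Rightarrow> complex" where
  "h_minus pm = beta_series (\<lambda>j. pm (24 * int j + 23)) (23/24)"

lemma is_h_sums: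
  assumes h: "is_h m h pp pm" and z: "z \<in> uhp"
  shows "(\<lambda>j. pp (24 * int j + 1) * qpow z (real j + 1/24)) sums
      (\<Sum>\<^sub>\<infinity>n | 0 < n \<and> [n = 1] (mod 24). pp n * qpow z (of_int n / 24))"
    and "(\<lambda>j. pm (24 * int j + 23) * beta (24 * (real j + 23/24) * Im z) * qpow z (- (real j + 23/24))) sums
      (\<Sum>\<^sub>\<infinity>n | 0 < n \<and> [n = -1] (mod 24). pm n * beta (of_int n * Im z) * qpow z (- of_int n / 24))"
proof -
  have sets: "{n::int. 0 < n \<and> [n = 1] (mod 24)} = {n. 0 < n \<and> n mod 24 = 1}"
    "{n::int. 0 < n \<and> [n = -1] (mod 24)} = {n. 0 < n \<and> n mod 24 = 23}"
    by (auto simp: cong_def)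
  have 1: "(\<lambda>n. pp n * qpow z (of_int n / 24)) summable_on {n. 0 < n \<and> n mod 24 = 1}"
    and 2: "(\<lambda>n. pm n * beta (of_int n * Im z) * qpow z (- of_int n / 24)) summable_on {n. 0 < n \<and> n mod 24 = 23}"
    using h z unfolding is_h_def sets by auto
  have e1: "real_of_int (24 * int j + 1) / 24 = real j + 1/24" for j by simp
  have e2: "real_of_int (24 * int j + 23) = 24 * (real j + 23/24)"
    "- (24 * (real j + 23/24)) / 24 = - (real j + 23/24)" for j by simp_all
  show "(\<lambda>j. pp (24 * int j + 1) * qpow z (real j + 1/24)) sums
      (\<Sum>\<^sub>\<infinity>n | 0 < n \<and> [n = 1] (mod 24). pp n * qpow z (of_int n / 24))"
    using residue_class_sums[OF _ _ 1] unfolding sets e1 by simp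
  show "(\<lambda>j. pm (24 * int j + 23) * beta (24 * (real j + 23/24) * Im z) * qpow z (- (real j + 23/24))) sums
      (\<Sum>\<^sub>\<infinity>n | 0 < n \<and> [n = -1] (mod 24). pm n * beta (of_int n * Im z) * qpow z (- of_int n / 24))"
    using residue_class_sums[OF _ _ 2] unfolding sets e2 by simp
qed

lemma is_h_subexponential:
  assumes h: "is_h m h pp pm"
  shows "subexponential (\<lambda>j. pp (24 * int j + 1))" "subexponential (\<lambda>j. pm (24 * int j + 23))"
proof -
  show "subexponential (\<lambda>j. pp (24 * int j + 1))"
    by (rule subexponential_of_summable_qseries[of "1/24"]) (use is_h_sums(1)[OF h] in \<open>auto simp: sums_iff\<close>)
  show "subexponential (\<lambda>j. pm (24 * int j + 23))"
    by (rule subexponential_of_summable_beta_series[of "23/24"])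
      (simp, rule sums_summable[OF is_h_sums(2)[OF h]])
qed

lemma is_h_eq:
  assumes h: "is_h m h pp pm" and z: "z \<in> uhp"
  shows "h z = h_plus pp z + \<i> * beta_term (- (of_int m / 24)) z + h_minus pm z"
proof -
  have "24 * - (real_of_int m / 24) * Im z = - real_of_int m * Im z" by simp
  then have "beta_term (- (of_int m / 24)) z = beta (- real_of_int m * Im z) * qpow z (real_of_int m / 24)"
    unfolding beta_term_def by (simp only: minus_minus)
  moreover have "h_plus pp z = (\<Sum>\<^sub>\<infinity>n | 0 < n \<and> [n = 1] (mod 24). pp n * qpow z (of_int n / 24))"
    unfolding h_plus_def using is_h_sums(1)[OF h z] by (simp add: sums_iff)
  moreover have "h_minus pm z = (\<Sum>\<^sub>\<infinity>n | 0 < n \<and> [n = -1] (mod 24). pm n * beta (of_int n * Im z) * qpow z (- of_int n / 24))"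
    unfolding h_minus_def beta_series_def beta_term_def using is_h_sums(2)[OF h z]
    by (simp only: sums_iff mult.assoc)
  ultimately show ?thesis using h z by (simp add: is_h_def mult.assoc)
qed

section \<open>The shadow and its transformation law\<close>

definition h_shadow :: "int \<Rightarrow> (int \<Rightarrow> complex) \<Rightarrow> complex \<Rightarrow> complex" where
  "h_shadow m pm z = of_real ((6 / (pi * of_int m)) powr (3/2)) * qpow z (- of_int m / 24) +
     (\<Sum>j. shadow_coeff (\<lambda>j. pm (24 * int j + 23)) (23/24) j * qpow z (real j + 23/24))"

definition h_dz :: "int \<Rightarrow> (int \<Rightarrow> complex) \<Rightarrow> (int \<Rightarrow> complex) \<Rightarrow> complex \<Rightarrow> complex" where
  "h_dz m pp pm z = deriv (h_plus pp) z + \<i> * beta_term_dz (- (of_int m / 24)) z +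
     beta_series_dz (\<lambda>j. pm (24 * int j + 23)) (23/24) z"

lemma holomorphic_h_plus:
  assumes "is_h m h pp pm"
  shows "h_plus pp holomorphic_on uhp"
  unfolding h_plus_def[abs_def] using is_h_subexponential(1)[OF assms] by (intro holomorphic_qseries) auto

lemma is_h_has_derivative:
  assumes h: "is_h m h pp pm" and m: "0 < m" and z: "z \<in> uhp"
  shows "(h has_derivative (\<lambda>v. h_dz m pp pm z * v +
    \<i> / 2 * of_real (Im z powr (- 5 / 2)) * cnj (h_shadow m pm z) * cnj v)) (at z)"
proof -
  let ?\<kappa> = "real_of_int m / 24"
  let ?b = "\<lambda>j. pm (24 * int j + 23)"
  let ?S = "\<Sum>j. shadow_coeff ?b (23/24) j * qpow z (real j + 23/24)"
  let ?y = "complex_of_real (Im z powr (- 5 / 2))"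
  let ?C = "complex_of_real ((6 / (pi * of_int m)) powr (3/2))"
  have "(h_plus pp has_derivative (\<lambda>v. deriv (h_plus pp) z * v)) (at z)"
    using holomorphic_derivI[OF holomorphic_h_plus[OF h] open_uhp z]
    by (simp add: has_field_derivative_def)
  moreover have "(beta_term (- ?\<kappa>) has_derivative
      (\<lambda>v. beta_term_dz (- ?\<kappa>) z * v + beta_term_dzbar (- ?\<kappa>) z * cnj v)) (at z)"
    using m z by (intro beta_term_has_derivative) auto
  moreover have "(h_minus pm has_derivative (\<lambda>v. beta_series_dz ?b (23/24) z * v +
      \<i> / 2 * ?y * cnj ?S * cnj v)) (at z)"
    unfolding h_minus_def using is_h_subexponential(2)[OF h] z by (intro beta_series_has_derivative) auto
  ultimately have "((\<lambda>z. h_plus pp z + \<i> * beta_term (- ?\<kappa>) z + h_minus pm z) has_derivative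
      (\<lambda>v. deriv (h_plus pp) z * v +
        \<i> * (beta_term_dz (- ?\<kappa>) z * v + beta_term_dzbar (- ?\<kappa>) z * cnj v) +
        (beta_series_dz ?b (23/24) z * v + \<i> / 2 * ?y * cnj ?S * cnj v))) (at z)"
    by (intro has_derivative_add has_derivative_mult_right)
  \<comment> \<open>The factor \<i> cancels the phase -\<i> in
    \<open>beta_const (- ?\<kappa>)\<close>, and 4 pi m/24 = pi m/6 gives the constant of the
    theorem.\<close>
  moreover have "\<i> * beta_term_dzbar (- ?\<kappa>) z = \<i> / 2 * ?y * cnj (?C * qpow z (- of_int m / 24))"
  proof -
    have "(4 * pi * ?\<kappa>) powr (- 3 / 2) = (6 / (pi * of_int m)) powr (3/2)"
    proof -
      define t where "t = pi * of_int m / 6"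
      have t: "0 < t" "4 * pi * ?\<kappa> = t" "6 / (pi * of_int m) = 1 / t"
        using m by (auto simp: t_def)
      show ?thesis unfolding t(2,3) using t(1) powr_minus_divide[of t "3/2"] by (simp add: powr_divide)
    qed
    then show ?thesis
      using m by (simp add: beta_term_dzbar_def beta_const_neg)
  qed
  ultimately have "((\<lambda>z. h_plus pp z + \<i> * beta_term (- ?\<kappa>) z + h_minus pm z) has_derivative
      (\<lambda>v. h_dz m pp pm z * v + \<i> / 2 * ?y * cnj (h_shadow m pm z) * cnj v)) (at z)"
    unfolding h_dz_def h_shadow_def
    by (elim has_derivative_eq_rhs) (simp add: fun_eq_iff ring_distribs mult.assoc[symmetric])
  then show ?thesis
    by (rule has_derivative_transform_within_open[OF _ open_uhp z]) (simp add: is_h_eq[OF h])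
qed

lemma continuous_on_h_dz:
  assumes h: "is_h m h pp pm" and m: "0 < m"
  shows "continuous_on uhp (h_dz m pp pm)"
  unfolding h_dz_def[abs_def]
proof (intro continuous_intros continuous_on_beta_term continuous_on_beta_series_dz is_h_subexponential(2)[OF h])
  show "continuous_on uhp (deriv (h_plus pp))"
    by (intro holomorphic_on_imp_continuous_on holomorphic_deriv[OF holomorphic_h_plus[OF h] open_uhp])
qed (use m in auto)

text \<open>The laws arise from differentiating those of h with respect to the conjugate variable.
  The automorphy factor is holomorphic, so its derivative only affects the coefficient of
  \<open>v\<close>; solving for the shadow conjugates the multiplier.\<close>

lemma h_shadow_forms:
  assumes h: "is_h m h pp pm" and m: "0 < m"
  shows "h_shadow m pm holomorphic_on uhp"
    and "z \<in> uhp \<Longrightarrow> h_shadow m pm (z + 1) = cnj (eta_mult 1 1 0 1) * h_shadow m pm z"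
    and "z \<in> uhp \<Longrightarrow> h_shadow m pm (- 1 / z) = cnj (eta_mult 0 (-1) 1 0) * z powr (- 1 / 2) * h_shadow m pm z"
proof -
  let ?b = "\<lambda>j. pm (24 * int j + 23)"
  let ?H = "h_shadow m pm" and ?P = "h_dz m pp pm"
  let ?t = "eta_mult 1 1 0 1" and ?s = "eta_mult 0 (-1) 1 0"
  define Q where "Q z = \<i> / 2 * of_real (Im z powr (- 5 / 2)) * cnj (?H z)" for z
  have d: "(h has_derivative (\<lambda>v. ?P z * v + Q z * cnj v)) (at z)" if "z \<in> uhp" for z
    unfolding Q_def by (rule is_h_has_derivative[OF h m that])
  have modular: "modular_transform (5/2) eta_mult h"
    using h by (simp add: is_h_def harmonic_forms_def)
  show "?H holomorphic_on uhp"
    unfolding h_shadow_def[abs_def] using is_h_subexponential(2)[OF h]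
    by (intro holomorphic_intros holomorphic_on_qpow holomorphic_qseries subexponential_shadow_coeff) auto
  show "?H (z + 1) = cnj ?t * ?H z" if z: "z \<in> uhp"
  proof -
    have z1: "z + 1 \<in> uhp" using z by (simp add: mem_uhp_iff)
    have "((\<lambda>w. w + 1) has_derivative (\<lambda>v. v)) (at z)" by (auto intro!: derivative_eq_intros)
    from has_derivative_compose[OF this d[OF z1]]
    have "((\<lambda>w. h (w + 1)) has_derivative (\<lambda>v. ?P (z + 1) * v + Q (z + 1) * cnj v)) (at z)" .
    moreover have "((\<lambda>w. ?t * h w) has_derivative (\<lambda>v. ?t * (?P z * v + Q z * cnj v))) (at z)"
      by (intro has_derivative_mult_right d z)
    then have "((\<lambda>w. h (w + 1)) has_derivative (\<lambda>v. ?t * (?P z * v + Q z * cnj v))) (at z)"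
      by (rule has_derivative_transform_within_open[OF _ open_uhp z])
        (simp add: modular_transform_T[OF modular])
    then have "((\<lambda>w. h (w + 1)) has_derivative (\<lambda>v. (?t * ?P z) * v + (?t * Q z) * cnj v)) (at z)"
      by (simp add: ring_distribs mult.assoc)
    ultimately have "Q (z + 1) = ?t * Q z" by (rule wirtinger_unique)
    then have "cnj (?H (z + 1)) = ?t * cnj (?H z)"
      using z by (simp add: Q_def mem_uhp_iff)
    then show ?thesis by (metis complex_cnj_cnj complex_cnj_mult)
  qed
  show "?H (- 1 / z) = cnj ?s * z powr (- 1 / 2) * ?H z" if z: "z \<in> uhp"
  proof -
    have z0: "z \<noteq> 0" "cmod z > 0" "Im z > 0" using z by (auto simp: mem_uhp_iff)
    have w: "- 1 / z \<in> uhp" by (rule minus_inverse_mem_uhp[OF z])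
    have "((\<lambda>w. - 1 / w) has_field_derivative (1 / z\<^sup>2)) (at z)"
      using z0 by (auto intro!: derivative_eq_intros simp: power2_eq_square)
    then have "((\<lambda>w. - 1 / w) has_derivative (*) (1 / z\<^sup>2)) (at z)"
      by (simp add: has_field_derivative_def)
    from has_derivative_compose[OF this d[OF w]]
    have "((\<lambda>w. h (- 1 / w)) has_derivative
        (\<lambda>v. ?P (- 1 / z) * (1 / z\<^sup>2 * v) + Q (- 1 / z) * cnj (1 / z\<^sup>2 * v))) (at z)" .
    then have 1: "((\<lambda>w. h (- 1 / w)) has_derivative
        (\<lambda>v. (?P (- 1 / z) / z\<^sup>2) * v + (Q (- 1 / z) / (cnj z)\<^sup>2) * cnj v)) (at z)"
      by simp
    have "z \<notin> \<real>\<^sub>\<le>\<^sub>0" using z0 by (auto simp: complex_nonpos_Reals_iff)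
    from has_field_derivative_powr[OF this, of "5/2"]
    have p: "((\<lambda>w. w powr (5/2)) has_derivative (*) (5/2 * z powr (5/2 - 1))) (at z)"
      by (simp add: has_field_derivative_def)
    have "((\<lambda>w. ?s * (w powr (5/2) * h w)) has_derivative
        (\<lambda>v. ?s * (z powr (5/2) * (?P z * v + Q z * cnj v) + (5/2 * z powr (5/2 - 1)) * v * h z))) (at z)"
      by (intro has_derivative_mult_right has_derivative_mult p d z)
    then have "((\<lambda>w. h (- 1 / w)) has_derivative
        (\<lambda>v. ?s * (z powr (5/2) * (?P z * v + Q z * cnj v) + (5/2 * z powr (5/2 - 1)) * v * h z))) (at z)"
    proof (rule has_derivative_transform_within_open[OF _ open_uhp z])
      show "?s * (w powr (5/2) * h w) = h (- 1 / w)" if "w \<in> uhp" for w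
        using modular_transform_S[OF modular that] by (simp add: mult.assoc)
    qed
    then have 2: "((\<lambda>w. h (- 1 / w)) has_derivative
        (\<lambda>v. (?s * (z powr (5/2) * ?P z + 5/2 * z powr (5/2 - 1) * h z)) * v + (?s * z powr (5/2) * Q z) * cnj v)) (at z)"
      by (rule has_derivative_eq_rhs) (simp add: fun_eq_iff algebra_simps)
    have "Q (- 1 / z) / (cnj z)\<^sup>2 = ?s * z powr (5/2) * Q z"
      by (rule wirtinger_unique[OF 1 2])
    then have "Q (- 1 / z) = ?s * z powr (5/2) * (cnj z)\<^sup>2 * Q z"
      using z0 by (simp add: field_simps)
    \<comment> \<open>This power of |z| cancels the one in
      \<open>cnj_powr_five_halves\<close>.\<close>
    moreover have "Im (- 1 / z) powr (- 5 / 2) = cmod z ^ 5 * Im z powr (- 5 / 2)"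
    proof -
      have "(cmod z)\<^sup>2 powr (5 / 2) = cmod z ^ 5"
        using z0 powr_powr[of "cmod z" 2 "5/2"] by (simp flip: powr_numeral)
      then show ?thesis
        unfolding Im_minus_inverse using z0 by (simp add: powr_divide powr_minus field_simps)
    qed
    ultimately have "of_real (cmod z ^ 5) * cnj (?H (- 1 / z)) = ?s * z powr (5/2) * (cnj z)\<^sup>2 * cnj (?H z)"
      using z0 by (simp add: Q_def field_simps)
    then have "cnj (of_real (cmod z ^ 5) * cnj (?H (- 1 / z))) = cnj (?s * z powr (5/2) * (cnj z)\<^sup>2 * cnj (?H z))"
      by (rule arg_cong)
    then have "of_real (cmod z ^ 5) * ?H (- 1 / z) = cnj ?s * (cnj (z powr (5/2)) * z\<^sup>2) * ?H z"
      by (simp add: mult.assoc)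
    then have "of_real (cmod z ^ 5) * ?H (- 1 / z) = of_real (cmod z ^ 5) * (cnj ?s * z powr (- 1 / 2) * ?H z)"
      unfolding cnj_powr_five_halves[OF z] by (simp only: mult_ac)
    moreover have "complex_of_real (cmod z ^ 5) \<noteq> 0" using z0 by simp
    ultimately show ?thesis using mult_left_cancel by blast
  qed
qed

lemma h_shadow_eq:
  assumes h: "is_h m h pp pm" and m: "0 < m" and g: "is_g m g" and z: "z \<in> uhp"
  shows "h_shadow m pm z = of_real ((6 / (pi * of_int m)) powr (3/2)) * g z"
proof (rule weight_minus_half_unique[where f = "h_shadow m pm" and
      g = "\<lambda>z. of_real ((6 / (pi * of_int m)) powr (3/2)) * g z"])
  let ?C = "complex_of_real ((6 / (pi * of_int m)) powr (3/2))"
  let ?S = "\<lambda>z. \<Sum>j. shadow_coeff (\<lambda>j. pm (24 * int j + 23)) (23/24) j * qpow z (real j + 23/24)"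
  show "(\<lambda>z. ?C * g z) holomorphic_on uhp" by (intro holomorphic_intros is_g_forms(1)[OF g])
  show "?C * g (w + 1) = cnj (eta_mult 1 1 0 1) * (?C * g w)" if "w \<in> uhp" for w
    using is_g_forms(2)[OF g that] by simp
  show "?C * g (- 1 / w) = cnj (eta_mult 0 (-1) 1 0) * w powr (- 1 / 2) * (?C * g w)" if "w \<in> uhp" for w
    unfolding is_g_forms(3)[OF g that] by (simp only: mult_ac)
  have "(?S \<longlongrightarrow> 0) (filtercomap Im at_top)"
    using is_h_subexponential(2)[OF h] by (intro tendsto_qseries_0 subexponential_shadow_coeff) auto
  from tendsto_diff[OF this tendsto_mult_right_zero[OF is_g_tendsto[OF g], of ?C]]
  show "((\<lambda>z. h_shadow m pm z - ?C * g z) \<longlongrightarrow> 0) (filtercomap Im at_top)"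
    by (simp add: h_shadow_def algebra_simps)
qed (use h_shadow_forms[OF h m] is_g_multipliers_norm[OF g m] z in auto)

subsection \<open>The regularized inner product\<close>

definition horizontal_integral :: "(complex \<Rightarrow> complex) \<Rightarrow> real \<Rightarrow> complex" where
  "horizontal_integral f Y = integral {-1/2..1/2} (\<lambda>x. f (Complex x Y))"

lemma horizontal_integral_cong:
  assumes "0 < Y" "\<And>z. z \<in> uhp \<Longrightarrow> f z = g z"
  shows "horizontal_integral f Y = horizontal_integral g Y"
  unfolding horizontal_integral_def using assms by (intro integral_cong) (simp add: mem_uhp_iff)

lemma horizontal_integral_add:
  assumes "continuous_on uhp f" "continuous_on uhp g" "0 < Y"
  shows "horizontal_integral (\<lambda>z. f z + g z) Y = horizontal_integral f Y + horizontal_integral g Y"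
  unfolding horizontal_integral_def
  using assms by (intro integral_add integrable_continuous_interval continuous_on_horizontal)

text \<open>After multiplication the exponents are the integers j - l, and uniform convergence on
  the segment allows termwise integration; only j = l survives. The value is exact at every
  height.\<close>

lemma horizontal_integral_h_plus:
  fixes l :: nat
  assumes a: "subexponential (\<lambda>j. pp (24 * int j + 1))" and Y: "0 < Y"
  shows "horizontal_integral (\<lambda>z. qpow z (- (real l + 1/24)) * h_plus pp z) Y = pp (24 * int l + 1)"
proof -
  define a where "a j = pp (24 * int j + 1)" for j
  define M where "M j = exp (2 * pi * (real l + 1/24) * Y) * (cmod (a j) * exp (- (2 * pi * Y * (real j + 1/24))))" for j
  define f where "f j x = qpow (Complex x Y) (- (real l + 1/24)) * (a j * qpow (Complex x Y) (real j + 1/24))" for j x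
  have sub: "subexponential a" using a by (simp add: a_def[abs_def])
  have f_eq: "f j x = a j * qpow (Complex x Y) (of_int (int j - int l))" for j x
    unfolding f_def using qpow_add[of "Complex x Y" "- (real l + 1/24)" "real j + 1/24"] by simp
  have "(\<lambda>j. integral {-1/2..1/2} (f j)) sums integral {-1/2..1/2} (\<lambda>x. \<Sum>j. f j x)"
  proof (rule sums_integral_uniform[where M = M])
    show "continuous_on {-1/2..1/2} (f j)" for j
      unfolding f_def[abs_def] using Y
      by (intro continuous_on_horizontal[where f = "\<lambda>z. qpow z _ * (a j * qpow z _)"] continuous_intros continuous_on_qpow)
    show "summable M"
      unfolding M_def using Y by (intro summable_mult subexponential_summable' sub) auto
    show "cmod (f j x) \<le> M j" for j x
      unfolding f_def M_def norm_mult[of "qpow _ _"] norm_qpow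
      using qseries_bound[of "1/24" Y "Complex x Y" a j] by (intro mult_mono) (auto simp: algebra_simps)
  qed
  moreover have "integral {-1/2..1/2} (f j) = (if j = l then a j else 0)" for j
    unfolding f_eq[abs_def] using integral_qpow[of Y "int j - int l"] by (simp add: integral_mult_right)
  moreover have "(\<lambda>j. if j = l then a j else 0) sums a l" by (rule sums_single)
  ultimately have "integral {-1/2..1/2} (\<lambda>x. \<Sum>j. f j x) = a l"
    using sums_unique2 by (simp only:) blast
  moreover have "(\<Sum>j. f j x) = qpow (Complex x Y) (- (real l + 1/24)) * h_plus pp (Complex x Y)" for x
    unfolding f_def h_plus_def a_def
    using qseries_summable[OF a, of "1/24" "Complex x Y"] Y by (intro suminf_mult) (auto simp: mem_uhp_iff)
  ultimately show ?thesis by (simp add: horizontal_integral_def a_def)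
qed

text \<open>The factor \<open>beta\<close> depends on the height only, so what is integrated is a
  constant times a nontrivial integral power of q.\<close>

lemma horizontal_integral_beta_term:
  assumes k: "k \<noteq> 0" and eq: "- r - \<kappa> = of_int k"
  shows "horizontal_integral (\<lambda>z. qpow z (- r) * beta_term \<kappa> z) Y = 0"
proof -
  have "qpow (Complex x Y) (- r) * beta_term \<kappa> (Complex x Y) = beta (24 * \<kappa> * Y) * qpow (Complex x Y) (of_int k)" for x
    unfolding beta_term_def eq[symmetric] using qpow_add[of "Complex x Y" "- r" "- \<kappa>"] by simp
  then show ?thesis
    unfolding horizontal_integral_def using integral_qpow[of Y k] k by (simp add: integral_mult_right)
qed

lemma horizontal_integral_h_minus:
  fixes l :: nat
  assumes b: "subexponential (\<lambda>j. pm (24 * int j + 23))" and Y: "0 < Y"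
  shows "horizontal_integral (\<lambda>z. qpow z (- (real l + 1/24)) * h_minus pm z) Y = 0"
proof -
  define b where "b j = pm (24 * int j + 23)" for j
  let ?r = "real l + 1/24"
  define f where "f j x = qpow (Complex x Y) (- ?r) * (b j * beta_term (real j + 23/24) (Complex x Y))" for j x
  have sub: "subexponential b" using b by (simp add: b_def[abs_def])
  obtain M where M: "summable M"
      "\<And>j z. Y \<le> Im z \<Longrightarrow> cmod (b j * beta_term (real j + 23/24) z) \<le> M j"
    using beta_term_series_bounds[OF sub _ Y, of "23/24", simplified] by blast
  have "(\<lambda>j. integral {-1/2..1/2} (f j)) sums integral {-1/2..1/2} (\<lambda>x. \<Sum>j. f j x)"
  proof (rule sums_integral_uniform[where M = "\<lambda>j. exp (2 * pi * ?r * Y) * M j"])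
    show "continuous_on {-1/2..1/2} (f j)" for j
      unfolding f_def[abs_def] using Y
      by (intro continuous_on_horizontal[where f = "\<lambda>z. qpow z _ * (b j * beta_term _ z)"]
        continuous_intros continuous_on_qpow continuous_on_beta_term) auto
    show "summable (\<lambda>j. exp (2 * pi * ?r * Y) * M j)" by (intro summable_mult M)
    show "cmod (f j x) \<le> exp (2 * pi * ?r * Y) * M j" for j x
    proof -
      have "cmod (qpow (Complex x Y) (- ?r)) = exp (2 * pi * ?r * Y)"
        unfolding norm_qpow by (simp only: complex.sel mult_minus_right mult_minus_left minus_minus)
      moreover have "cmod (b j * beta_term (real j + 23/24) (Complex x Y)) \<le> M j" by (rule M(2)) simp
      ultimately show ?thesis
        unfolding f_def norm_mult[of "qpow _ _"] by (simp only: mult_left_mono exp_ge_zero)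
    qed
  qed
  moreover have "integral {-1/2..1/2} (f j) = 0" for j
  proof -
    have "f j = (\<lambda>x. b j * (qpow (Complex x Y) (- ?r) * beta_term (real j + 23/24) (Complex x Y)))"
      by (simp add: f_def fun_eq_iff)
    \<comment> \<open>The fractions 1/24 and 23/24 add up to 1, so the total exponent -(l + j + 1)
      is a negative integer and never 0.\<close>
    moreover have "horizontal_integral (\<lambda>z. qpow z (- ?r) * beta_term (real j + 23/24) z) Y = 0"
      by (rule horizontal_integral_beta_term[where k = "- (int l + int j + 1)"]) auto
    ultimately show ?thesis by (simp add: horizontal_integral_def integral_mult_right)
  qed
  ultimately have "integral {-1/2..1/2} (\<lambda>x. \<Sum>j. f j x) = 0"
    by (simp add: sums_iff)
  moreover have "(\<Sum>j. f j x) = qpow (Complex x Y) (- ?r) * h_minus pm (Complex x Y)" for x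
    unfolding f_def h_minus_def beta_series_def b_def
    using beta_series_summable[OF b, of "23/24" "Complex x Y"] Y by (intro suminf_mult) (auto simp: mem_uhp_iff)
  ultimately show ?thesis by (simp add: horizontal_integral_def)
qed

lemma horizontal_integral_tendsto:
  assumes h: "is_h m h pp pm" and m: "0 < m" "[m = 1] (mod 24)"
    and gm: "is_g m gm" and g: "is_g n g" and n: "0 < n" "[n = 1] (mod 24)" and mn: "m \<noteq> n"
  shows "(horizontal_integral (\<lambda>z. g z * h z) \<longlongrightarrow> pp n) at_top"
proof -
  define l where "l = nat (n div 24)"
  have nl: "n = 24 * int l + 1"
  proof -
    have "n mod 24 = 1" using n(2) by (simp add: cong_def)
    moreover have "0 \<le> n div 24" using n(1) by (simp add: pos_imp_zdiv_nonneg_iff)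
    ultimately show ?thesis using mult_div_mod_eq[of 24 n] unfolding l_def by linarith
  qed
  let ?r = "real l + 1/24" and ?\<kappa> = "real_of_int m / 24"
  have n24: "- real_of_int n / 24 = - ?r" by (simp add: nl)
  define e where "e z = g z - qpow z (- ?r)" for z
  have e0: "(e \<longlongrightarrow> 0) (filtercomap Im at_top)"
    using is_g_tendsto[OF g] unfolding e_def[abs_def] n24 .
  have e_hol: "e holomorphic_on uhp"
    unfolding e_def[abs_def] by (intro holomorphic_intros is_g_forms(1)[OF g] holomorphic_on_qpow)
  have cont: "continuous_on uhp (h_plus pp)" "continuous_on uhp (h_minus pm)" "continuous_on uhp (beta_term (- ?\<kappa>))"
    "continuous_on uhp e"
  proof -
    show "continuous_on uhp (h_minus pm)"
      unfolding h_minus_def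
      using beta_series_has_derivative[OF is_h_subexponential(2)[OF h], of "23/24"]
      by (intro continuous_at_imp_continuous_on ballI has_derivative_continuous) auto
  qed (use holomorphic_h_plus[OF h] e_hol m in \<open>auto intro: holomorphic_on_imp_continuous_on continuous_on_beta_term\<close>)
  \<comment> \<open>Smallness of \<open>e\<close> does not help against the growth of
    \<open>beta\<close> here. With \<open>beta\<close> taken out of the integral, the remaining
    integrand is holomorphic and its mean vanishes exactly.\<close>
  have zero: "horizontal_integral (\<lambda>z. e z * (\<i> * beta_term (- ?\<kappa>) z)) Y = 0" if Y: "0 < Y" for Y
  proof -
    have "integral {-1/2..1/2} (\<lambda>x. e (Complex x Y) * qpow (Complex x Y) ?\<kappa>) = 0"
    proof (rule integral_periodic_holomorphic_eq_0[OF _ _ _ Y])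
      show "(\<lambda>z. e z * qpow z ?\<kappa>) holomorphic_on uhp"
        by (intro holomorphic_intros e_hol holomorphic_on_qpow)
      show "((\<lambda>z. e z * qpow z ?\<kappa>) \<longlongrightarrow> 0) (filtercomap Im at_top)"
        using m by (intro tendsto_mult_zero e0 tendsto_qpow_0) auto
      \<comment> \<open>The translation multiplier of \<open>g\<close> is inverse both to exp(2 pi
        \<i> n/24) and to exp(2 pi \<i> m/24), so the factors acquired by \<open>e\<close> and by
        q^(m/24) cancel.\<close>
      show "e (z + 1) * qpow (z + 1) ?\<kappa> = e z * qpow z ?\<kappa>" if z: "z \<in> uhp" for z
      proof -
        let ?t = "cnj (eta_mult 1 1 0 1)"
        let ?E = "\<lambda>r. exp (2 * of_real pi * \<i> * of_real r)"
        have "?t * ?E (real_of_int n / 24) = 1" by (rule is_g_multipliers(1)[OF g n(1)])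
        moreover have "?E (- (real_of_int n / 24)) * ?E (real_of_int n / 24) = 1"
          by (simp flip: exp_add)
        moreover have "?E (real_of_int n / 24) \<noteq> 0" by simp
        ultimately have "?E (- (real_of_int n / 24)) = ?t" by (metis mult_right_cancel)
        then have tn: "?E (- ?r) = ?t" by (simp only: n24[symmetric] minus_divide_left)
        have "e (z + 1) = ?t * g z - ?E (- ?r) * qpow z (- ?r)"
          unfolding e_def is_g_forms(2)[OF g z] qpow_plus_1 ..
        also have "\<dots> = ?t * e z" unfolding tn e_def by (simp add: algebra_simps)
        finally have "e (z + 1) * qpow (z + 1) ?\<kappa> = (?t * ?E ?\<kappa>) * (e z * qpow z ?\<kappa>)"
          unfolding qpow_plus_1 by (simp only: mult_ac)
        then show ?thesis using is_g_multipliers(1)[OF gm m(1)] by simp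
      qed
    qed
    moreover have eq: "e (Complex x Y) * (\<i> * beta_term (- ?\<kappa>) (Complex x Y)) =
        \<i> * beta (- real_of_int m * Y) * (e (Complex x Y) * qpow (Complex x Y) ?\<kappa>)" for x
      by (simp add: beta_term_def)
    ultimately show ?thesis unfolding horizontal_integral_def eq by (simp only: integral_mult_right mult_zero_right)
  qed
  have "horizontal_integral (\<lambda>z. g z * h z) Y = pp n + horizontal_integral (\<lambda>z. e z * (h_plus pp z + h_minus pm z)) Y"
    if Y: "0 < Y" for Y
  proof -
    have "g z * h z = (qpow z (- ?r) * h_plus pp z + (qpow z (- ?r) * (\<i> * beta_term (- ?\<kappa>) z) + qpow z (- ?r) * h_minus pm z))
        + (e z * (\<i> * beta_term (- ?\<kappa>) z) + e z * (h_plus pp z + h_minus pm z))" if "z \<in> uhp" for z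
      unfolding is_h_eq[OF h that] e_def by (simp add: algebra_simps)
    then have "horizontal_integral (\<lambda>z. g z * h z) Y =
        horizontal_integral (\<lambda>z. (qpow z (- ?r) * h_plus pp z + (qpow z (- ?r) * (\<i> * beta_term (- ?\<kappa>) z) + qpow z (- ?r) * h_minus pm z))
        + (e z * (\<i> * beta_term (- ?\<kappa>) z) + e z * (h_plus pp z + h_minus pm z))) Y"
      by (rule horizontal_integral_cong[OF Y])
    also have "\<dots> = (horizontal_integral (\<lambda>z. qpow z (- ?r) * h_plus pp z) Y +
        (horizontal_integral (\<lambda>z. qpow z (- ?r) * (\<i> * beta_term (- ?\<kappa>) z)) Y + horizontal_integral (\<lambda>z. qpow z (- ?r) * h_minus pm z) Y))
        + (horizontal_integral (\<lambda>z. e z * (\<i> * beta_term (- ?\<kappa>) z)) Y + horizontal_integral (\<lambda>z. e z * (h_plus pp z + h_minus pm z)) Y)"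
      by (simp only: horizontal_integral_add[OF _ _ Y] continuous_on_add continuous_on_mult continuous_on_const continuous_on_qpow cont)
    also have "horizontal_integral (\<lambda>z. qpow z (- ?r) * h_plus pp z) Y = pp n"
      unfolding nl by (rule horizontal_integral_h_plus[OF is_h_subexponential(1)[OF h] Y])
    also have "horizontal_integral (\<lambda>z. qpow z (- ?r) * h_minus pm z) Y = 0"
      by (rule horizontal_integral_h_minus[OF is_h_subexponential(2)[OF h] Y])
    also have "horizontal_integral (\<lambda>z. e z * (\<i> * beta_term (- ?\<kappa>) z)) Y = 0"
      by (rule zero[OF Y])
    \<comment> \<open>Here \<open>m \<noteq> n\<close> enters: the exponent (m - n)/24 is a nonzero
      integer. For equal indices the growing term itself would remain.\<close>
    also have "horizontal_integral (\<lambda>z. qpow z (- ?r) * (\<i> * beta_term (- ?\<kappa>) z)) Y = 0"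
    proof -
      have "[m = n] (mod 24)" using m(2) n(2) cong_trans cong_sym by blast
      then obtain k where k: "m - n = 24 * k" by (auto simp: cong_iff_dvd_diff dvd_def)
      have "k \<noteq> 0" using k mn by auto
      moreover have "- ?r - - ?\<kappa> = of_int k"
        using arg_cong[OF k, of real_of_int] n24 by simp
      ultimately have "horizontal_integral (\<lambda>z. qpow z (- ?r) * beta_term (- ?\<kappa>) z) Y = 0"
        by (rule horizontal_integral_beta_term)
      then show ?thesis
        unfolding horizontal_integral_def mult.left_commute[of _ \<i>] by (simp add: integral_mult_right)
    qed
    finally show ?thesis by simp
  qed
  then have "\<forall>\<^sub>F Y in at_top. pp n + horizontal_integral (\<lambda>z. e z * (h_plus pp z + h_minus pm z)) Y =
      horizontal_integral (\<lambda>z. g z * h z) Y"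
    by (intro eventually_mono[OF eventually_gt_at_top[of 0]]) simp
  moreover have "((\<lambda>Y. pp n + horizontal_integral (\<lambda>z. e z * (h_plus pp z + h_minus pm z)) Y) \<longlongrightarrow> pp n + 0) at_top"
  proof (intro tendsto_add tendsto_const)
    have "((\<lambda>z. e z * h_plus pp z) \<longlongrightarrow> 0) (filtercomap Im at_top)"
      unfolding h_plus_def using is_h_subexponential(1)[OF h]
      by (intro tendsto_mult_zero e0 tendsto_qseries_0) auto
    moreover have "((\<lambda>z. e z * h_minus pm z) \<longlongrightarrow> 0) (filtercomap Im at_top)"
    proof -
      obtain B where B: "\<And>z. 1 \<le> Im z \<Longrightarrow> cmod (h_minus pm z) \<le> B"
        unfolding h_minus_def by (rule beta_series_bounded[OF is_h_subexponential(2)[OF h], of "23/24"]) (simp, blast)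
      have "cmod (e z * h_minus pm z) \<le> cmod (e z) * B" if "1 \<le> Im z" for z
        unfolding norm_mult using B[OF that] by (intro mult_left_mono) auto
      then show ?thesis
        by (intro tendsto_0_le[OF e0, where K = B]) (auto simp: eventually_Im_at_top)
    qed
    ultimately have "((\<lambda>z. e z * (h_plus pp z + h_minus pm z)) \<longlongrightarrow> 0) (filtercomap Im at_top)"
      using tendsto_add[of "\<lambda>z. e z * h_plus pp z" 0 _ "\<lambda>z. e z * h_minus pm z" 0] by (simp add: ring_distribs)
    then show "(horizontal_integral (\<lambda>z. e z * (h_plus pp z + h_minus pm z)) \<longlongrightarrow> 0) at_top"
      unfolding horizontal_integral_def[abs_def]
      by (rule tendsto_integral_horizontal_0) (intro continuous_intros cont)
  qed
  ultimately show ?thesis by (simp add: Lim_transform_eventually)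
qed

text \<open>The weights -1/2 and 5/2 add up to 2 and the multipliers are conjugate of modulus 1, so
  g h dz is invariant and Stokes applies. The power y^(-5/2) of the shadow is y^(-1/2) times the
  density y^(-2) of the invariant measure. The form conjugated is \<open>gm\<close>, since it arises
  as the shadow.\<close>

lemma trunc_inner_eq_horizontal_integral:
  assumes h: "is_h m h pp pm" and m: "0 < m" and gm: "is_g m gm" and g: "is_g n g" and Y: "1 \<le> Y"
  shows "of_real ((6 / (pi * of_int m)) powr (3/2)) * trunc_inner (-1/2) g gm Y = horizontal_integral (\<lambda>z. g z * h z) Y"
proof -
  let ?C = "complex_of_real ((6 / (pi * of_int m)) powr (3/2))"
  let ?t = "eta_mult 1 1 0 1" and ?s = "eta_mult 0 (-1) 1 0"
  define P where "P z = g z * h_dz m pp pm z + deriv g z * h z" for z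
  define Q where "Q z = \<i> / 2 * ?C * (g z * cnj (gm z) * of_real (Im z powr (- 5 / 2)))" for z
  have d: "((\<lambda>z. g z * h z) has_derivative (\<lambda>v. P z * v + Q z * cnj v)) (at z)" if z: "z \<in> uhp" for z
  proof -
    have "(g has_derivative (*) (deriv g z)) (at z)"
      using holomorphic_derivI[OF is_g_forms(1)[OF g] open_uhp z] by (simp add: has_field_derivative_def)
    from has_derivative_mult[OF this is_h_has_derivative[OF h m z]]
    show ?thesis
      by (rule has_derivative_eq_rhs)
        (simp add: fun_eq_iff P_def Q_def h_shadow_eq[OF h m gm z] algebra_simps)
  qed
  have contg: "continuous_on uhp g" "continuous_on uhp gm" "continuous_on uhp (deriv g)"
    using is_g_forms(1)[OF g] is_g_forms(1)[OF gm] holomorphic_deriv[OF is_g_forms(1)[OF g] open_uhp]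
    by (auto intro: holomorphic_on_imp_continuous_on)
  have conth: "continuous_on uhp h"
    using is_h_has_derivative[OF h m] by (intro continuous_at_imp_continuous_on ballI has_derivative_continuous)
  have "(LINT z:trunc_fund_domain Y|lborel. 2 * Q z) = \<i> * integral {-1/2..1/2} (\<lambda>x. g (Complex x Y) * h (Complex x Y))"
  proof (rule integral_trunc_fund_domain_Stokes[OF _ _ d])
    show "continuous_on uhp P"
      unfolding P_def by (intro continuous_intros contg conth continuous_on_h_dz[OF h m])
    show "continuous_on uhp Q"
      unfolding Q_def by (intro continuous_intros contg) (auto simp: mem_uhp_iff)
    have modular: "modular_transform (5/2) eta_mult h"
      using h by (simp add: is_h_def harmonic_forms_def)
    have tt: "cnj ?t * ?t = 1" and ss: "cnj ?s * ?s = 1"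
      using is_g_multipliers_norm[OF gm m] by (auto simp: mult.commute[of "cnj _"] complex_norm_square[symmetric])
    show "g (z + 1) * h (z + 1) = g z * h z" if z: "z \<in> uhp" for z
    proof -
      have "g (z + 1) * h (z + 1) = (cnj ?t * ?t) * (g z * h z)"
        unfolding is_g_forms(2)[OF g z] modular_transform_T[OF modular z] by (simp only: mult_ac)
      then show ?thesis using tt by simp
    qed
    show "g (- 1 / z) * h (- 1 / z) = z\<^sup>2 * (g z * h z)" if z: "z \<in> uhp" for z
    proof -
      have "z \<noteq> 0" using z by (auto simp: mem_uhp_iff)
      then have zz: "z powr (- 1 / 2) * z powr (of_real (5/2)) = z\<^sup>2"
        using powr_add[of z "- 1 / 2" "5 / 2"] by simp
      have "g (- 1 / z) * h (- 1 / z) = (cnj ?s * ?s) * (z powr (- 1 / 2) * z powr (of_real (5/2))) * (g z * h z)"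
        unfolding is_g_forms(3)[OF g z] modular_transform_S[OF modular z] by (simp only: mult_ac)
      then show ?thesis unfolding ss zz by simp
    qed
  qed (use Y in auto)
  also have "(LINT z:trunc_fund_domain Y|lborel. 2 * Q z) = \<i> * ?C * trunc_inner (-1/2) g gm Y"
  proof -
    have "2 * Q z = \<i> * ?C * (g z * cnj (gm z) * of_real (Im z powr (-1/2)) / of_real ((Im z)\<^sup>2))" if "z \<in> uhp" for z
    proof -
      have "Im z powr (- 1 / 2) / (Im z)\<^sup>2 = Im z powr (- 5 / 2)"
        using that powr_diff[of "Im z" "- 1 / 2" 2] by (simp add: mem_uhp_iff powr_numeral)
      then have "complex_of_real (Im z powr (- 5 / 2)) = of_real (Im z powr (- 1 / 2)) / of_real ((Im z)\<^sup>2)"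
        by (metis of_real_divide)
      then show ?thesis unfolding Q_def by simp
    qed
    then have "(LINT z:trunc_fund_domain Y|lborel. 2 * Q z) = (LINT z:trunc_fund_domain Y|lborel.
        \<i> * ?C * (g z * cnj (gm z) * of_real (Im z powr (-1/2)) / of_real ((Im z)\<^sup>2)))"
      using trunc_fund_domain_subset_uhp
      by (intro set_lebesgue_integral_cong) (auto simp: compact_imp_closed compact_trunc_fund_domain)
    then show ?thesis unfolding trunc_inner_def by (simp only: set_integral_mult_right)
  qed
  finally have "\<i> * (?C * trunc_inner (-1/2) g gm Y) = \<i> * horizontal_integral (\<lambda>z. g z * h z) Y"
    by (simp add: horizontal_integral_def mult.assoc)
  then show ?thesis by simp
qed

text \<open>The reflection conjugates both forms and preserves y, which moves the conjugation from
  one factor to the other.\<close>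

lemma trunc_inner_commute:
  assumes gm: "is_g m gm" "0 < m" and gn: "is_g n gn" "0 < n"
  shows "trunc_inner k gm gn Y = trunc_inner k gn gm Y"
proof -
  let ?F = "\<lambda>z. gm z * cnj (gn z) * of_real (Im z powr k) / of_real ((Im z)\<^sup>2)"
  have "continuous_on uhp ?F"
    using is_g_forms(1)[OF gm(1)] is_g_forms(1)[OF gn(1)]
    by (intro continuous_intros holomorphic_on_imp_continuous_on) (auto simp: mem_uhp_iff)
  then have "trunc_inner k gm gn Y = (LINT z:trunc_fund_domain Y|lborel. ?F (- cnj z))"
    unfolding trunc_inner_def by (rule integral_trunc_fund_domain_reflect[symmetric])
  also have "\<dots> = trunc_inner k gn gm Y"
    unfolding trunc_inner_def
    using trunc_fund_domain_subset_uhp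
    by (intro set_lebesgue_integral_cong)
      (auto simp: compact_imp_closed compact_trunc_fund_domain subset_iff is_g_reflection[OF gm] is_g_reflection[OF gn])
  finally show ?thesis .
qed

theorem theorem3:
  fixes m n :: int
    and gm gn h :: "complex \<Rightarrow> complex"
    and pp pm :: "int \<Rightarrow> complex"
  assumes "0 < m" and "[m = 1] (mod 24)"
    and "0 < n" and "[n = 1] (mod 24)"
    and "m \<noteq> n"
    and "is_g m gm" and "is_g n gn"
    and "is_h m h pp pm"
  shows "reg_inner_exists (-1/2) gm gn \<and>
    pp n = of_real ((6 / (pi * real_of_int m)) powr (3/2)) * reg_inner (-1/2) gm gn"
proof -
  let ?C = "complex_of_real ((6 / (pi * real_of_int m)) powr (3/2))"
  have C: "?C \<noteq> 0" using assms(1) by simp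
  have "(horizontal_integral (\<lambda>z. gn z * h z) \<longlongrightarrow> pp n) at_top"
    using assms by (intro horizontal_integral_tendsto)
  then have "((\<lambda>Y. horizontal_integral (\<lambda>z. gn z * h z) Y / ?C) \<longlongrightarrow> pp n / ?C) at_top"
    using C by (intro tendsto_divide tendsto_const)
  \<comment> \<open>Since the identity with the top-side integral is exact for every Y \<ge> 1, the
    existence of the limit is inherited from that integral.\<close>
  moreover have "\<forall>\<^sub>F Y in at_top. horizontal_integral (\<lambda>z. gn z * h z) Y / ?C = trunc_inner (-1/2) gm gn Y"
  proof (rule eventually_mono[OF eventually_ge_at_top[of 1]])
    fix Y :: real assume "1 \<le> Y"
    then show "horizontal_integral (\<lambda>z. gn z * h z) Y / ?C = trunc_inner (-1/2) gm gn Y"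
      using trunc_inner_eq_horizontal_integral[OF assms(8,1,6,7), of Y] C
        trunc_inner_commute[OF assms(6,1,7,3)] by (simp add: field_simps)
  qed
  ultimately have lim: "(trunc_inner (-1/2) gm gn \<longlongrightarrow> pp n / ?C) at_top"
    by (rule Lim_transform_eventually)
  then have "reg_inner (-1/2) gm gn = pp n / ?C"
    unfolding reg_inner_def by (intro tendsto_Lim) auto
  with lim C show ?thesis unfolding reg_inner_exists_def by auto
qed

end
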